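(* For closed surfaces in $\mathbb R^3$, none of the energies $E_M(z)$ is Möbius invariant. That is, for every $z\in\mathbb C$ there exist a smooth closed surface $M\subset\mathbb R^3$ and a Möbius transformation $I$ such that $I(M)$ is compact and $E_{I(M)}(z)\ne E_M(z)$.
   Context: A closed surface is a compact two-dimensional submanifold without boundary; $dx,dy$ denote its area element; $\Delta_t=\{(x,y)\in\mathbb R^3\times\mathbb R^3: |x-y|\le t\}$. Möbius transformations are those of $\mathbb R^3\cup\{\infty\}$; "$I(M)$ is compact" means it is a compact subset of $\mathbb R^3$. Put $\psi_M(t)=\int_{(M\times M)\cap\Delta_t}dx\,dy$ for $t\ge0$; it is smooth on some interval $[0,d]$, $d>0$ (including at $0$). For $z\in\mathbb C$ the regularized $z$-energy is Hadamard's finite part: choosing an integer $k\ge 0$ with $\mathrm{Re}\,z>-k-1$, $$E_M(z)=\lim_{\varepsilon\to0^+}\left[\int_{(M\times M)\setminus\Delta_\varepsilon}|x-y|^z\,dxdy+\sum_{j=1}^{k}\frac{\psi_M^{(j)}(0)}{(j-1)!}\,\frac{\varepsilon^{z+j}}{z+j}\right],$$ where $\varepsilon^{0}/0$ is replaced by $\log\varepsilon$ if it occurs. *)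

theory Defs
  imports "HOL-Analysis.Analysis"
begin

primrec higher_differentiable_on ::
    "nat \<Rightarrow> 'a::real_normed_vector set \<Rightarrow> ('a \<Rightarrow> 'b::real_normed_vector) \<Rightarrow> bool" where
  "higher_differentiable_on 0 S f \<longleftrightarrow> continuous_on S f"
| "higher_differentiable_on (Suc n) S f \<longleftrightarrow>
     (\<forall>x\<in>S. f differentiable (at x)) \<and>
     (\<forall>v. higher_differentiable_on n S (\<lambda>x. frechet_derivative f (at x) v))"

text \<open>Intended for open \<open>S\<close> only, since the derivatives are two-sided.\<close>

definition smooth_on :: "'a::real_normed_vector set \<Rightarrow> ('a \<Rightarrow> 'b::real_normed_vector) \<Rightarrow> bool" where
  "smooth_on S f \<longleftrightarrow> (\<forall>n. higher_differentiable_on n S f)"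

definition local_parametrization ::
    "(real^3) set \<Rightarrow> (real^2) set \<Rightarrow> (real^2 \<Rightarrow> real^3) \<Rightarrow> bool" where
  "local_parametrization M U \<phi> \<longleftrightarrow>
     open U \<and> smooth_on U \<phi> \<and>
     (\<forall>u\<in>U. inj (frechet_derivative \<phi> (at u))) \<and>
     openin (top_of_set M) (\<phi> ` U) \<and>
     (\<exists>\<xi>. homeomorphism U (\<phi> ` U) \<phi> \<xi>)"

definition closed_surface :: "(real^3) set \<Rightarrow> bool" where
  "closed_surface M \<longleftrightarrow>
     compact M \<and> (\<forall>p\<in>M. \<exists>U \<phi>. local_parametrization M U \<phi> \<and> p \<in> \<phi> ` U)"

definition area_density :: "(real^2 \<Rightarrow> real^3) \<Rightarrow> real^2 \<Rightarrow> real" where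
  "area_density \<phi> u =
     norm (cross3 (frechet_derivative \<phi> (at u) (axis 1 1))
                  (frechet_derivative \<phi> (at u) (axis 2 1)))"

text \<open>The measure of the area element of \<open>M\<close>, as a Borel measure on the ambient space
  that is concentrated on \<open>M\<close>.\<close>

definition is_area_measure :: "(real^3) set \<Rightarrow> (real^3) measure \<Rightarrow> bool" where
  "is_area_measure M \<mu> \<longleftrightarrow>
     sets \<mu> = sets borel \<and> emeasure \<mu> (- M) = 0 \<and>
     (\<forall>U \<phi>. local_parametrization M U \<phi> \<longrightarrow>
        (\<forall>A\<in>sets borel. A \<subseteq> \<phi> ` U \<longrightarrow>
           emeasure \<mu> A = (\<integral>\<^sup>+u\<in>{u\<in>U. \<phi> u \<in> A}. ennreal (area_density \<phi> u) \<partial>lborel)))"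

definition area_measure :: "(real^3) set \<Rightarrow> (real^3) measure" where
  "area_measure M = (THE \<mu>. is_area_measure M \<mu>)"

lemma is_area_measure_unique:
  assumes M: "closed_surface M" and \<mu>: "is_area_measure M \<mu>" and \<nu>: "is_area_measure M \<nu>"
  shows "\<mu> = \<nu>"
proof -
  have cM: "compact M" using M by (simp add: closed_surface_def)
  have sets: "sets \<mu> = sets borel" "sets \<nu> = sets borel"
    using \<mu> \<nu> by (auto simp: is_area_measure_def)
  define C where "C = {T. open T \<and> (\<exists>U \<phi>. local_parametrization M U \<phi> \<and> M \<inter> T = \<phi> ` U)}"
  have "M \<subseteq> \<Union>C"
  proof
    fix p assume "p \<in> M"
    then obtain U \<phi> where *: "local_parametrization M U \<phi>" "p \<in> \<phi> ` U"
      using M by (auto simp: closed_surface_def)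
    then obtain T where "open T" "\<phi> ` U = M \<inter> T"
      by (auto simp: local_parametrization_def openin_open)
    then have "T \<in> C" using *(1) unfolding C_def by blast
    moreover have "p \<in> T" using \<open>\<phi> ` U = M \<inter> T\<close> *(2) by blast
    ultimately show "p \<in> \<Union>C" by blast
  qed
  moreover have "\<And>T. T \<in> C \<Longrightarrow> open T" by (auto simp: C_def)
  ultimately obtain F where F: "F \<subseteq> C" "finite F" "M \<subseteq> \<Union>F"
    using cM by (meson compactE)
  obtain Ts where Ts: "set Ts = F" using F(2) finite_list by blast
  have closedM: "closed M" using cM by (rule compact_imp_closed)
  have loc: "emeasure \<mu> (A \<inter> M) = emeasure \<nu> (A \<inter> M)"
    if "A \<in> sets borel" "A \<inter> M \<subseteq> T" "T \<in> C" for A T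
  proof -
    obtain U \<phi> where "local_parametrization M U \<phi>" "M \<inter> T = \<phi> ` U"
      using \<open>T \<in> C\<close> by (auto simp: C_def)
    moreover have "A \<inter> M \<in> sets borel" using that(1) closedM by auto
    moreover have "A \<inter> M \<subseteq> \<phi> ` U" using that(2) calculation(2) by blast
    ultimately show ?thesis using \<mu> \<nu> by (simp add: is_area_measure_def)
  qed
  have step: "\<forall>A\<in>sets borel. A \<inter> M \<subseteq> \<Union>(set Ts) \<longrightarrow> emeasure \<mu> (A \<inter> M) = emeasure \<nu> (A \<inter> M)"
    if "set Ts \<subseteq> C" for Ts using that
  proof (induction Ts)
    case Nil
    then show ?case by simp
  next
    case (Cons T Ts)
    have oT: "open T" using Cons.prems by (auto simp: C_def)
    show ?case
    proof (intro ballI impI)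
      fix A :: "(real^3) set" assume A: "A \<in> sets borel" "A \<inter> M \<subseteq> \<Union>(set (T # Ts))"
      have 1: "A \<inter> T \<in> sets borel" "A - T \<in> sets borel" using A oT by auto
      have 2: "emeasure \<kappa> (A \<inter> M) = emeasure \<kappa> (A \<inter> T \<inter> M) + emeasure \<kappa> ((A - T) \<inter> M)"
        if "sets \<kappa> = sets borel" for \<kappa>
      proof -
        have "A \<inter> T \<inter> M \<in> sets \<kappa>" "(A - T) \<inter> M \<in> sets \<kappa>"
          using 1 closedM that by auto
        then have "emeasure \<kappa> (A \<inter> T \<inter> M) + emeasure \<kappa> ((A - T) \<inter> M)
            = emeasure \<kappa> (A \<inter> T \<inter> M \<union> (A - T) \<inter> M)"
          by (rule plus_emeasure) blast
        moreover have "A \<inter> T \<inter> M \<union> (A - T) \<inter> M = A \<inter> M" by auto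
        ultimately show ?thesis by simp
      qed
      have "emeasure \<mu> (A \<inter> T \<inter> M) = emeasure \<nu> (A \<inter> T \<inter> M)"
        by (rule loc[OF 1(1), of T]) (use Cons.prems in auto)
      moreover have "emeasure \<mu> ((A - T) \<inter> M) = emeasure \<nu> ((A - T) \<inter> M)"
      proof -
        have "(A - T) \<inter> M \<subseteq> \<Union>(set Ts)" using A(2) by auto
        moreover have "set Ts \<subseteq> C" using Cons.prems by simp
        ultimately show ?thesis using Cons.IH 1(2) by blast
      qed
      ultimately show "emeasure \<mu> (A \<inter> M) = emeasure \<nu> (A \<inter> M)"
        using 2 sets by simp
    qed
  qed
  have onM: "emeasure \<kappa> A = emeasure \<kappa> (A \<inter> M)"
    if "is_area_measure M \<kappa>" "A \<in> sets borel" for \<kappa> A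
  proof -
    have s: "sets \<kappa> = sets borel" "emeasure \<kappa> (- M) = 0" using that by (auto simp: is_area_measure_def)
    have "- M \<in> null_sets \<kappa>"
      using s closedM by (intro null_setsI) auto
    then have "emeasure \<kappa> (A - (- M)) = emeasure \<kappa> A"
      by (rule emeasure_Diff_null_set) (use s that in simp)
    moreover have "A - (- M) = A \<inter> M" by blast
    ultimately show ?thesis by simp
  qed
  show ?thesis
  proof (rule measure_eqI)
    show "sets \<mu> = sets \<nu>" using sets by simp
    fix A assume "A \<in> sets \<mu>"
    then have A: "A \<in> sets borel" using sets by simp
    have "A \<inter> M \<subseteq> \<Union>(set Ts)" using F Ts by auto
    then have "emeasure \<mu> (A \<inter> M) = emeasure \<nu> (A \<inter> M)"
      using step[of Ts] F Ts A by blast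
    then show "emeasure \<mu> A = emeasure \<nu> A" using onM[OF \<mu> A] onM[OF \<nu> A] by simp
  qed
qed

definition \<psi> :: "(real^3) set \<Rightarrow> real \<Rightarrow> real" where
  "\<psi> M t = measure (area_measure M \<Otimes>\<^sub>M area_measure M)
             {(x, y). x \<in> M \<and> y \<in> M \<and> dist x y \<le> t}"

definition truncated_energy :: "(real^3) set \<Rightarrow> complex \<Rightarrow> real \<Rightarrow> complex" where
  "truncated_energy M z \<epsilon> =
     (LINT (x, y):{(x, y). x \<in> M \<and> y \<in> M \<and> dist x y > \<epsilon>}|(area_measure M \<Otimes>\<^sub>M area_measure M).
        complex_of_real (dist x y) powr z)"

definition counterterm :: "complex \<Rightarrow> real \<Rightarrow> complex" where
  "counterterm w \<epsilon> =
     (if w = 0 then complex_of_real (ln \<epsilon>) else complex_of_real \<epsilon> powr w / w)"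

text \<open>\<open>D j\<close> is the \<open>j\<close>-th derivative of \<open>\<psi> M\<close> on \<open>[0, d]\<close>. It is one-sided
  at the end points: \<open>\<psi> M\<close> vanishes on the negative axis and is not smooth across 0.\<close>

definition has_regularized_energy :: "(real^3) set \<Rightarrow> complex \<Rightarrow> complex \<Rightarrow> bool" where
  "has_regularized_energy M z E \<longleftrightarrow>
     (\<exists>(k::nat) (d::real) (D :: nat \<Rightarrow> real \<Rightarrow> real).
        Re z > - real k - 1 \<and> d > 0 \<and>
        (\<forall>t\<in>{0..d}. D 0 t = \<psi> M t) \<and>
        (\<forall>j<k. \<forall>t\<in>{0..d}. (D j has_real_derivative D (Suc j) t) (at t within {0..d})) \<and>
        ((\<lambda>\<epsilon>. truncated_energy M z \<epsilon> +
               (\<Sum>j=1..k. complex_of_real (D j 0 / fact (j - 1)) * counterterm (z + of_nat j) \<epsilon>))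
           \<longlongrightarrow> E) (at_right 0))"

lemma counterterm_tendsto_0:
  assumes "Re w > 0"
  shows "(counterterm w \<longlongrightarrow> 0) (at_right 0)"
proof -
  have "w \<noteq> 0" using assms by auto
  have "((\<lambda>\<epsilon>::real. \<epsilon> powr Re w) \<longlongrightarrow> 0 powr Re w) (at_right 0)"
    by (rule tendsto_powr'[OF tendsto_ident_at tendsto_const])
       (use assms in \<open>auto simp: eventually_at_filter\<close>)
  then have "((\<lambda>\<epsilon>::real. \<epsilon> powr Re w) \<longlongrightarrow> 0) (at_right 0)" by simp
  moreover have "\<forall>\<^sub>F \<epsilon>::real in at_right 0. norm (complex_of_real \<epsilon> powr w) = \<epsilon> powr Re w"
    by (auto simp: eventually_at_filter norm_powr_real_powr)
  ultimately have "((\<lambda>\<epsilon>. norm (complex_of_real \<epsilon> powr w)) \<longlongrightarrow> 0) (at_right 0)"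
    by (subst tendsto_cong)
  then have "((\<lambda>\<epsilon>. complex_of_real \<epsilon> powr w) \<longlongrightarrow> 0) (at_right 0)"
    by (rule tendsto_norm_zero_cancel)
  then have "((\<lambda>\<epsilon>. complex_of_real \<epsilon> powr w / w) \<longlongrightarrow> 0 / w) (at_right 0)"
    by (intro tendsto_divide tendsto_const) (use \<open>w \<noteq> 0\<close> in auto)
  then show ?thesis using \<open>w \<noteq> 0\<close> by (simp add: counterterm_def[abs_def])
qed

text \<open>The value does not depend on the admissible \<open>k\<close>.\<close>

lemma has_regularized_energy_unique:
  assumes "has_regularized_energy M z E" "has_regularized_energy M z E'"
  shows "E = E'"
proof -
  have key: "E = E'"
    if kk: "k \<le> k'" and k: "Re z > - real k - 1"
    and d: "d > 0" "d' > 0"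
    and D0: "\<And>t. t\<in>{0..d} \<Longrightarrow> D 0 t = \<psi> M t" "\<And>t. t\<in>{0..d'} \<Longrightarrow> D' 0 t = \<psi> M t"
    and D: "\<And>j t. j < k \<Longrightarrow> t\<in>{0..d} \<Longrightarrow> (D j has_real_derivative D (Suc j) t) (at t within {0..d})"
    and D': "\<And>j t. j < k' \<Longrightarrow> t\<in>{0..d'} \<Longrightarrow> (D' j has_real_derivative D' (Suc j) t) (at t within {0..d'})"
    and E: "((\<lambda>\<epsilon>. truncated_energy M z \<epsilon> +
               (\<Sum>j=1..k. complex_of_real (D j 0 / fact (j - 1)) * counterterm (z + of_nat j) \<epsilon>))
           \<longlongrightarrow> E) (at_right 0)"
    and E': "((\<lambda>\<epsilon>. truncated_energy M z \<epsilon> +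
               (\<Sum>j=1..k'. complex_of_real (D' j 0 / fact (j - 1)) * counterterm (z + of_nat j) \<epsilon>))
           \<longlongrightarrow> E') (at_right 0)"
    for k k' :: nat and d d' :: real and D D' :: "nat \<Rightarrow> real \<Rightarrow> real" and E E'
  proof -
    define e where "e = min d d'"
    have e: "e > 0" "{0..e} \<subseteq> {0..d}" "{0..e} \<subseteq> {0..d'}" using d by (auto simp: e_def)
    have eq: "\<forall>t\<in>{0..e}. D j t = D' j t" if "j \<le> k" for j using that
    proof (induction j)
      case 0
      then show ?case using D0 e by (auto simp: subset_iff)
    next
      case (Suc j)
      show ?case
      proof
        fix t assume t: "t \<in> {0..e}"
        have "(D j has_real_derivative D (Suc j) t) (at t within {0..e})"
          by (rule DERIV_subset[OF D e(2)]) (use Suc.prems t e(2) in auto)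
        moreover have "(D' j has_real_derivative D' (Suc j) t) (at t within {0..e})"
          by (rule DERIV_subset[OF D' e(3)]) (use Suc.prems kk t e(3) in auto)
        then have "(D j has_real_derivative D' (Suc j) t) (at t within {0..e})"
          by (rule has_field_derivative_transform_within[OF _ zero_less_one t])
             (use Suc in auto)
        moreover have "at t within {0..e} \<noteq> bot"
          using t e(1) by (simp add: trivial_limit_within islimpt_Icc)
        ultimately show "D (Suc j) t = D' (Suc j) t"
          by (rule has_field_derivative_unique)
      qed
    qed
    have "((\<lambda>\<epsilon>. \<Sum>j=k+1..k'. complex_of_real (D' j 0 / fact (j - 1)) * counterterm (z + of_nat j) \<epsilon>)
        \<longlongrightarrow> (\<Sum>j=k+1..k'. complex_of_real (D' j 0 / fact (j - 1)) * 0)) (at_right 0)"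
      by (intro tendsto_sum tendsto_mult tendsto_const counterterm_tendsto_0) (use k in auto)
    from tendsto_add[OF E this]
    have "((\<lambda>\<epsilon>. (truncated_energy M z \<epsilon> +
               (\<Sum>j=1..k. complex_of_real (D j 0 / fact (j - 1)) * counterterm (z + of_nat j) \<epsilon>)) +
        (\<Sum>j=k+1..k'. complex_of_real (D' j 0 / fact (j - 1)) * counterterm (z + of_nat j) \<epsilon>))
        \<longlongrightarrow> E) (at_right 0)" by simp
    moreover have "(\<Sum>j=1..k. complex_of_real (D j 0 / fact (j - 1)) * counterterm (z + of_nat j) \<epsilon>)
        + (\<Sum>j=k+1..k'. complex_of_real (D' j 0 / fact (j - 1)) * counterterm (z + of_nat j) \<epsilon>)
        = (\<Sum>j=1..k'. complex_of_real (D' j 0 / fact (j - 1)) * counterterm (z + of_nat j) \<epsilon>)" for \<epsilon>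
    proof -
      have "(\<Sum>j=1..k. complex_of_real (D j 0 / fact (j - 1)) * counterterm (z + of_nat j) \<epsilon>)
        = (\<Sum>j=1..k. complex_of_real (D' j 0 / fact (j - 1)) * counterterm (z + of_nat j) \<epsilon>)"
        using eq e(1) by (intro sum.cong refl) simp
      moreover have "{1..k'} = {1..k} \<union> {k+1..k'}" using kk by auto
      ultimately show ?thesis by (simp only:) (rule sum.union_disjoint[symmetric]; auto)
    qed
    ultimately have "((\<lambda>\<epsilon>. truncated_energy M z \<epsilon> +
               (\<Sum>j=1..k'. complex_of_real (D' j 0 / fact (j - 1)) * counterterm (z + of_nat j) \<epsilon>))
           \<longlongrightarrow> E) (at_right 0)" by (simp only: add.assoc)
    then show "E = E'" by (rule tendsto_unique[OF trivial_limit_at_right_real _ E'])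
  qed
  obtain k d D where 1: "Re z > - real k - 1" "d > 0" "\<forall>t\<in>{0..d}. D 0 t = \<psi> M t"
    "\<forall>j<k. \<forall>t\<in>{0..d}. (D j has_real_derivative D (Suc j) t) (at t within {0..d})"
    "((\<lambda>\<epsilon>. truncated_energy M z \<epsilon> +
       (\<Sum>j=1..k. complex_of_real (D j 0 / fact (j - 1)) * counterterm (z + of_nat j) \<epsilon>)) \<longlongrightarrow> E) (at_right 0)"
    using assms(1) unfolding has_regularized_energy_def by blast
  obtain k' d' D' where 2: "Re z > - real k' - 1" "d' > 0" "\<forall>t\<in>{0..d'}. D' 0 t = \<psi> M t"
    "\<forall>j<k'. \<forall>t\<in>{0..d'}. (D' j has_real_derivative D' (Suc j) t) (at t within {0..d'})"
    "((\<lambda>\<epsilon>. truncated_energy M z \<epsilon> +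
       (\<Sum>j=1..k'. complex_of_real (D' j 0 / fact (j - 1)) * counterterm (z + of_nat j) \<epsilon>)) \<longlongrightarrow> E') (at_right 0)"
    using assms(2) unfolding has_regularized_energy_def by blast
  show ?thesis
  proof (cases "k \<le> k'")
    case True
    show ?thesis
      by (rule key[where k = k and k' = k' and d = d and d' = d' and D = D and D' = D'];
          (fact | use 1(3,4) 2(3,4) in blast))
  next
    case False
    then have "k' \<le> k" by simp
    have "E' = E"
      by (rule key[where k = k' and k' = k and d = d' and d' = d and D = D' and D' = D];
          (fact | use 1(3,4) 2(3,4) in blast))
    then show ?thesis ..
  qed
qed

text \<open>\<open>real^3 \<union> {\<infinity>}\<close> is modelled as \<open>(real^3) option\<close>, with \<open>None\<close> as \<open>\<infinity>\<close>.\<close>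

definition sphere_inversion :: "real^3 \<Rightarrow> real \<Rightarrow> (real^3) option \<Rightarrow> (real^3) option" where
  "sphere_inversion a r p =
     (case p of
        None \<Rightarrow> Some a
      | Some x \<Rightarrow> if x = a then None else Some (a + (r\<^sup>2 / (norm (x - a))\<^sup>2) *\<^sub>R (x - a)))"

definition plane_reflection :: "real^3 \<Rightarrow> real \<Rightarrow> (real^3) option \<Rightarrow> (real^3) option" where
  "plane_reflection n c = map_option (\<lambda>x. x - (2 * (n \<bullet> x - c) / (n \<bullet> n)) *\<^sub>R n)"

text \<open>The group generated by inversions in spheres and reflections in planes; it includes
  the orientation-reversing transformations.\<close>

inductive moebius_transformation :: "((real^3) option \<Rightarrow> (real^3) option) \<Rightarrow> bool" where
  moebius_id: "moebius_transformation id"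
| moebius_inversion:
    "moebius_transformation I \<Longrightarrow> r > 0 \<Longrightarrow> moebius_transformation (sphere_inversion a r \<circ> I)"
| moebius_reflection:
    "moebius_transformation I \<Longrightarrow> n \<noteq> 0 \<Longrightarrow> moebius_transformation (plane_reflection n c \<circ> I)"

end

theory Submission
  imports Defs
begin

text \<open>
Dilations are Moebius transformations, being products of inversions in two concentric spheres, and
they already change the energy. Under a dilation by \<open>c\<close> the truncated energy and the counterterms of a
surface \<open>M\<close> are homogeneous of degree \<open>4 + z\<close>, except for the logarithmic counterterm, which occurs
when \<open>z = -j\<close> for a positive integer \<open>j\<close>. Hence (\<open>has_regularized_energy_scaled\<close>)

  \<open>E (c M) = c\<^sup>4\<^sup>+\<^sup>z (E M + a ln c)\<close>,

where \<open>a\<close> is the coefficient of \<open>t\<^sup>j\<^sup>-\<^sup>1\<close> in the expansion of \<open>\<psi>'\<close> at \<open>0\<close> if \<open>z = -j\<close>, and \<open>0\<close> otherwise.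

For \<open>z \<noteq> -4\<close> the unit sphere is a witness. By Archimedes a cap with chord \<open>t\<close> has area \<open>\<pi> t\<^sup>2\<close>, so
\<open>\<psi> t = 4 \<pi>\<^sup>2 t\<^sup>2\<close> on \<open>[0, 2]\<close> and the energy is \<open>8 \<pi>\<^sup>2 2\<^sup>z\<^sup>+\<^sup>2 / (z + 2)\<close>, or \<open>8 \<pi>\<^sup>2 ln 2\<close> for \<open>z = -2\<close>
(\<open>sphere_energy_limit\<close>). It is not zero, and some \<open>c\<close> changes it.

For \<open>z = -4\<close> only the anomaly \<open>a ln c\<close> is left, and \<open>6 a\<close> is the fourth derivative of \<open>\<psi>\<close> at \<open>0\<close>. It vanishes for the sphere, but not
for a torus of revolution, here with radii \<open>2\<close> and \<open>1\<close>. In the angles \<open>(a, u)\<close> and \<open>(b, v)\<close> of two points the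
squared chord is \<open>4 sin\<^sup>2 ((u - v) / 2) + 4 (2 + cos u) (2 + cos v) sin\<^sup>2 ((a - b) / 2)\<close>. Integrating out
the longitudes and substituting for \<open>(u - v) / 2\<close> turns \<open>\<psi> t\<close> into the integral over a fixed rectangle of an
elementary function that is smooth and even in \<open>t\<close> (\<open>\<psi>_torus\<close>). Differentiation under the integral
gives the required smoothness (\<open>torus_distribution\<close>). The sign of the fourth derivative follows without computing
a derivative: pointwise bounds of the integrand give \<open>A t\<^sup>2 + C t\<^sup>4 \<le> \<psi> t \<le> A t\<^sup>2 + C' t\<^sup>4\<close> with \<open>C > 0\<close>
for small \<open>t\<close>, which implies that it is at least \<open>24 C\<close> (\<open>fourth_derivative_positive\<close>).

The area measures of both surfaces have to be exhibited. Each is the push-forward of a density under one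
chart (\<open>is_area_measure_rev_area\<close>). That every other parametrization gives the same areas rests on
inverses of the charts that are differentiable in the ambient space, which makes transition maps
differentiable without the inverse function theorem (\<open>chart_change\<close>).
\<close>

section \<open>Elementary functions are smooth\<close>

text \<open>Iterated Frechet derivatives of concrete functions are handled syntactically: the class below
contains what is needed for the charts and for the integrand of the torus, and it is closed under
directional derivatives. The rule \<open>cong\<close> makes membership depend only on the values on the set.\<close>

inductive elementary :: "'a::real_normed_vector set \<Rightarrow> ('a \<Rightarrow> real) \<Rightarrow> bool" for S where
  const: "elementary S (\<lambda>x. c)"
| linear: "bounded_linear l \<Longrightarrow> elementary S l"
| add: "elementary S f \<Longrightarrow> elementary S g \<Longrightarrow> elementary S (\<lambda>x. f x + g x)"
| mult: "elementary S f \<Longrightarrow> elementary S g \<Longrightarrow> elementary S (\<lambda>x. f x * g x)"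
| sin: "elementary S f \<Longrightarrow> elementary S (\<lambda>x. sin (f x))"
| cos: "elementary S f \<Longrightarrow> elementary S (\<lambda>x. cos (f x))"
| inverse: "elementary S f \<Longrightarrow> (\<And>x. x \<in> S \<Longrightarrow> f x \<noteq> 0) \<Longrightarrow> elementary S (\<lambda>x. inverse (f x))"
| sqrt: "elementary S f \<Longrightarrow> (\<And>x. x \<in> S \<Longrightarrow> f x > 0) \<Longrightarrow> elementary S (\<lambda>x. sqrt (f x))"
| arcsin: "elementary S f \<Longrightarrow> (\<And>x. x \<in> S \<Longrightarrow> \<bar>f x\<bar> < 1) \<Longrightarrow> elementary S (\<lambda>x. arcsin (f x))"
| cong: "elementary S f \<Longrightarrow> (\<And>x. x \<in> S \<Longrightarrow> g x = f x) \<Longrightarrow> elementary S g"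

lemma elementary_minus: "elementary S f \<Longrightarrow> elementary S (\<lambda>x. - f x)"
  using elementary.mult[OF elementary.const[of S "-1"]] by simp

lemma elementary_diff: "elementary S f \<Longrightarrow> elementary S g \<Longrightarrow> elementary S (\<lambda>x. f x - g x)"
  using elementary.add[OF _ elementary_minus] by fastforce

lemma elementary_divide:
  "elementary S f \<Longrightarrow> elementary S g \<Longrightarrow> (\<And>x. x \<in> S \<Longrightarrow> g x \<noteq> 0) \<Longrightarrow> elementary S (\<lambda>x. f x / g x)"
  using elementary.mult[OF _ elementary.inverse] by (fastforce simp: divide_inverse)

lemma elementary_power: "elementary S f \<Longrightarrow> elementary S (\<lambda>x. f x ^ n)"
  by (induction n) (auto intro: elementary.const elementary.mult)

lemmas elementary_intros = elementary.const elementary.add elementary.mult elementary.sin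
  elementary.cos elementary.inverse elementary.sqrt elementary.arcsin elementary_minus
  elementary_diff elementary_divide elementary_power

lemma elementary_derivative:
  assumes "open S" "elementary S f"
  shows "\<exists>f'. (\<forall>x\<in>S. (f has_derivative f' x) (at x)) \<and> (\<forall>v. elementary S (\<lambda>x. f' x v))"
  using assms(2)
proof induction
  case (const c)
  show ?case by (rule exI[of _ "\<lambda>x v. 0"]) (auto intro: elementary.const)
next
  case (linear l)
  show ?case
    by (rule exI[of _ "\<lambda>x. l"]) (auto intro: elementary.const bounded_linear_imp_has_derivative linear)
next
  case (add f g)
  then obtain f' g' where "\<forall>x\<in>S. (f has_derivative f' x) (at x)" "\<forall>v. elementary S (\<lambda>x. f' x v)"
    "\<forall>x\<in>S. (g has_derivative g' x) (at x)" "\<forall>v. elementary S (\<lambda>x. g' x v)" by blast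
  then show ?case
    by (intro exI[of _ "\<lambda>x v. f' x v + g' x v"]) (auto intro!: elementary_intros derivative_intros)
next
  case (mult f g)
  then obtain f' g' where "\<forall>x\<in>S. (f has_derivative f' x) (at x)" "\<forall>v. elementary S (\<lambda>x. f' x v)"
    "\<forall>x\<in>S. (g has_derivative g' x) (at x)" "\<forall>v. elementary S (\<lambda>x. g' x v)" by blast
  then show ?case using mult
    by (intro exI[of _ "\<lambda>x v. f x * g' x v + f' x v * g x"])
       (auto intro!: elementary_intros has_derivative_mult)
next
  case (sin f)
  then obtain f' where "\<forall>x\<in>S. (f has_derivative f' x) (at x)" "\<forall>v. elementary S (\<lambda>x. f' x v)" by blast
  then show ?case using sin
    by (intro exI[of _ "\<lambda>x v. f' x v * cos (f x)"]) (auto intro!: elementary_intros has_derivative_sin)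
next
  case (cos f)
  then obtain f' where "\<forall>x\<in>S. (f has_derivative f' x) (at x)" "\<forall>v. elementary S (\<lambda>x. f' x v)" by blast
  then show ?case using cos
    by (intro exI[of _ "\<lambda>x v. f' x v * - sin (f x)"] conjI ballI allI elementary_intros)
       (fast intro!: has_derivative_cos)+
next
  case (inverse f)
  then obtain f' where "\<forall>x\<in>S. (f has_derivative f' x) (at x)" "\<forall>v. elementary S (\<lambda>x. f' x v)" by blast
  then show ?case using inverse
    by (intro exI[of _ "\<lambda>x v. - (inverse (f x) * f' x v * inverse (f x))"])
       (auto intro!: elementary_intros has_derivative_inverse)
next
  case (sqrt f)
  then obtain f' where "\<forall>x\<in>S. (f has_derivative f' x) (at x)" "\<forall>v. elementary S (\<lambda>x. f' x v)" by blast
  then show ?case using sqrt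
    by (intro exI[of _ "\<lambda>x v. f' x v * (inverse (sqrt (f x)) / 2)"])
       (fastforce intro!: elementary_intros derivative_eq_intros simp: fun_eq_iff)
next
  case (arcsin f)
  then obtain f' where f': "\<forall>x\<in>S. (f has_derivative f' x) (at x)" "\<forall>v. elementary S (\<lambda>x. f' x v)" by blast
  have "(f x)\<^sup>2 < 1" if "x \<in> S" for x using arcsin(2)[OF that] by (simp add: abs_square_less_1)
  then have pos: "1 - (f x)\<^sup>2 > 0" if "x \<in> S" for x using that by simp
  show ?case
  proof (intro exI[of _ "\<lambda>x v. f' x v * inverse (sqrt (1 - (f x)\<^sup>2))"] conjI ballI allI)
    fix x assume x: "x \<in> S"
    have "(arcsin has_field_derivative inverse (sqrt (1 - (f x)\<^sup>2))) (at (f x))"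
      using arcsin(2)[OF x] by (intro DERIV_arcsin) auto
    from DERIV_compose_FDERIV[where g = f, OF this] f'(1) x
    show "((\<lambda>x. arcsin (f x)) has_derivative (\<lambda>v. f' x v * inverse (sqrt (1 - (f x)\<^sup>2)))) (at x)"
      by blast
  next
    fix v
    show "elementary S (\<lambda>x. f' x v * inverse (sqrt (1 - (f x)\<^sup>2)))"
      using f'(2) arcsin(1) pos by (intro elementary_intros) fastforce+
  qed
next
  case (cong f g)
  then obtain f' where f': "\<forall>x\<in>S. (f has_derivative f' x) (at x)" "\<forall>v. elementary S (\<lambda>x. f' x v)" by blast
  have "(g has_derivative f' x) (at x)" if "x \<in> S" for x
    by (rule has_derivative_transform_within_open[OF _ \<open>open S\<close> that]) (use f' that cong(2) in auto)
  then show ?case using f' by blast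
qed

lemma elementary_continuous_on:
  assumes "open S" "elementary S f"
  shows "continuous_on S f"
proof -
  obtain f' where "\<forall>x\<in>S. (f has_derivative f' x) (at x)"
    using elementary_derivative[OF assms] by blast
  then show ?thesis
    by (meson continuous_at_imp_continuous_on has_derivative_continuous)
qed

lemma smooth_on_elementary:
  fixes g :: "'a::real_normed_vector \<Rightarrow> real^'n"
  assumes "open S" "\<And>i. elementary S (\<lambda>x. g x $ i)"
  shows "smooth_on S g"
proof -
  have "higher_differentiable_on n S g" if "\<And>i. elementary S (\<lambda>x. g x $ i)"
    for n and g :: "'a \<Rightarrow> real^'n" using that
  proof (induction n arbitrary: g)
    case 0
    have "continuous_on S (\<lambda>x. \<chi> i. g x $ i)"
      by (intro continuous_on_vec_lambda elementary_continuous_on[OF assms(1)] 0)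
    then show ?case by simp
  next
    case (Suc n)
    have "\<forall>i. \<exists>f'. (\<forall>x\<in>S. ((\<lambda>x. g x $ i) has_derivative f' x) (at x)) \<and> (\<forall>v. elementary S (\<lambda>x. f' x v))"
      using elementary_derivative[OF assms(1) Suc.prems] by blast
    then obtain f' where f': "\<And>i x. x \<in> S \<Longrightarrow> ((\<lambda>x. g x $ i) has_derivative f' i x) (at x)"
        "\<And>i v. elementary S (\<lambda>x. f' i x v)"
      by metis
    have der: "(g has_derivative (\<lambda>v. \<chi> i. f' i x v)) (at x)" if "x \<in> S" for x
    proof -
      have "((\<lambda>x. \<chi> i. g x $ i) has_derivative (\<lambda>v. \<chi> i. f' i x v)) (at x)"
        unfolding has_derivative_componentwise_within[of "\<lambda>x. \<chi> i. g x $ i"]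
        using f'(1)[OF that] by (auto simp: Basis_vec_def inner_axis)
      then show ?thesis by simp
    qed
    have fr: "frechet_derivative g (at x) = (\<lambda>v. \<chi> i. f' i x v)" if "x \<in> S" for x
      using frechet_derivative_at[OF der[OF that]] by simp
    have "higher_differentiable_on n S (\<lambda>x. frechet_derivative g (at x) v)" for v
      by (rule Suc.IH, rule elementary.cong[OF f'(2)]) (simp add: fr)
    then show ?case using der by (auto simp: differentiable_def)
  qed
  then show ?thesis using assms by (simp add: smooth_on_def)
qed

text \<open>Smooth dependence on a parameter: the derivative of an elementary integrand is again elementary, so
differentiation under the integral sign can be repeated. The domain of the parameter is two-sided,
which provides the one-sided derivatives at \<open>0\<close> for free.\<close>

lemma elementary_parametric_integral:
  fixes f :: "real \<times> 'b::euclidean_space \<Rightarrow> real"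
  assumes S: "open S" "elementary S f" and sub: "{l<..<u} \<times> cbox a b \<subseteq> S"
  obtains D :: "nat \<Rightarrow> real \<Rightarrow> real" where
    "D 0 = (\<lambda>t. integral (cbox a b) (\<lambda>q. f (t, q)))"
    "\<And>j t. t \<in> {l<..<u} \<Longrightarrow> (D j has_real_derivative D (Suc j) t) (at t)"
proof -
  define R where "R g g' \<longleftrightarrow> (\<forall>x\<in>S. ((\<lambda>t. g (t, snd x)) has_real_derivative g' x) (at (fst x)))"
    for g g' :: "real \<times> 'b \<Rightarrow> real"
  have step: "\<exists>g'. elementary S g' \<and> R g g'" if g: "elementary S g" for g
  proof -
    obtain g' where g': "\<forall>x\<in>S. (g has_derivative g' x) (at x)" "\<forall>v. elementary S (\<lambda>x. g' x v)"
      using elementary_derivative[OF S(1) g] by blast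
    have "((\<lambda>t. g (t, snd x)) has_real_derivative g' x (1, 0)) (at (fst x))" if "x \<in> S" for x
    proof -
      have "(g has_derivative g' x) (at (fst x, snd x))" using g'(1) that by simp
      moreover have "((\<lambda>t. (t, snd x)) has_derivative (\<lambda>h. (h, 0))) (at (fst x))"
        by (intro derivative_eq_intros) auto
      ultimately have "((\<lambda>t. g (t, snd x)) has_derivative (\<lambda>h. g' x (h, 0))) (at (fst x))"
        using has_derivative_compose by fastforce
      moreover have "(\<lambda>h. g' x (h, 0)) = (\<lambda>h. g' x (1, 0) * h)"
      proof
        fix h :: real
        have "linear (g' x)" using g'(1) that has_derivative_linear by blast
        from linear_scale[OF this, of h "(1, 0)"]
        show "g' x (h, 0) = g' x (1, 0) * h" by (simp add: mult.commute)
      qed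
      ultimately show ?thesis by (simp add: has_field_derivative_def)
    qed
    then have "R g (\<lambda>x. g' x (1, 0))" by (simp add: R_def)
    then show ?thesis using g'(2) by blast
  qed
  define F where "F = rec_nat f (\<lambda>_ g. SOME g'. elementary S g' \<and> R g g')"
  have F0: "F 0 = f" and FS: "F (Suc n) = (SOME g'. elementary S g' \<and> R (F n) g')" for n
    by (auto simp: F_def)
  have Fe: "elementary S (F n)" for n
  proof (induction n)
    case 0 show ?case using S F0 by simp
  next
    case (Suc n)
    show ?case using someI_ex[OF step[OF Suc]] FS by simp
  qed
  have FR: "R (F n) (F (Suc n))" for n
    using someI_ex[OF step[OF Fe[of n]]] FS by simp
  define D where "D n t = integral (cbox a b) (\<lambda>q. F n (t, q))" for n t
  show thesis
  proof
    show "D 0 = (\<lambda>t. integral (cbox a b) (\<lambda>q. f (t, q)))" by (simp add: D_def[abs_def] F0)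
    fix j t assume t: "t \<in> {l<..<u}"
    have cont: "continuous_on ({l<..<u} \<times> cbox a b) (F n)" for n
      using elementary_continuous_on[OF S(1) Fe] sub by (rule continuous_on_subset)
    have "((\<lambda>t. integral (cbox a b) (\<lambda>q. F j (t, q))) has_real_derivative
            integral (cbox a b) (\<lambda>q. F (Suc j) (t, q))) (at t within {l<..<u})"
    proof (rule leibniz_rule_field_derivative[where fx = "\<lambda>x q. F (Suc j) (x, q)"])
      fix x q assume "x \<in> {l<..<u}" "q \<in> cbox a b"
      then have "(x, q) \<in> S" using sub by auto
      with FR[of j] have "((\<lambda>x. F j (x, q)) has_real_derivative F (Suc j) (x, q)) (at x)"
        by (force simp: R_def)
      then show "((\<lambda>x. F j (x, q)) has_real_derivative F (Suc j) (x, q)) (at x within {l<..<u})"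
        by (rule has_field_derivative_at_within)
    next
      fix x assume x: "x \<in> {l<..<u}"
      have "continuous_on (cbox a b) (\<lambda>q. F j (x, q))"
        by (rule continuous_on_compose2[OF cont]) (use x in \<open>auto intro!: continuous_intros\<close>)
      then show "(\<lambda>q. F j (x, q)) integrable_on cbox a b" by (rule integrable_continuous)
    next
      show "continuous_on ({l<..<u} \<times> cbox a b) (\<lambda>(x, t). F (Suc j) (x, t))"
        using cont by simp
    qed (use t in auto)
    then show "(D j has_real_derivative D (Suc j) t) (at t)"
      unfolding at_within_open[OF t open_greaterThanLessThan] D_def[abs_def] .
  qed
qed

section \<open>The round sphere and the torus of revolution\<close>

text \<open>Both surfaces are obtained by rotating a unit circle whose centre has distance \<open>R\<close> from the axis: the
sphere for \<open>R = 0\<close>, a torus for \<open>R > 1\<close>. The two angles of a point are the arguments of the two complex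
numbers \<open>axial\<close> and \<open>meridional\<close>. These are functions on all of space, so that a chart has an inverse
that is differentiable on an open set of the ambient space and not only on the surface.\<close>

definition axial :: "real^3 \<Rightarrow> complex" where
  "axial x = of_real (x $ 1) + \<i> * of_real (x $ 2)"

definition meridional :: "real \<Rightarrow> real^3 \<Rightarrow> complex" where
  "meridional R x = of_real (norm (axial x) - R) + \<i> * of_real (x $ 3)"

definition rev_surface :: "real \<Rightarrow> (real^3) set" where
  "rev_surface R = {x. norm (meridional R x) = 1}"

definition chart :: "real \<Rightarrow> real^2 \<Rightarrow> real^3" where
  "chart R u = vector [(R + cos (u $ 2)) * cos (u $ 1), (R + cos (u $ 2)) * sin (u $ 1), sin (u $ 2)]"

text \<open>The branch of the argument with values within \<open>\<pi>\<close> of \<open>\<alpha>\<close>, and its domain of differentiability.\<close>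

definition angle :: "real \<Rightarrow> complex \<Rightarrow> real" where
  "angle \<alpha> w = \<alpha> + Im (Ln (cis (- \<alpha>) * w))"

definition slit_plane :: "real \<Rightarrow> complex set" where
  "slit_plane \<alpha> = {w. cis (- \<alpha>) * w \<notin> \<real>\<^sub>\<le>\<^sub>0}"

definition window :: "real \<Rightarrow> real \<Rightarrow> real \<Rightarrow> (real^3) set" where
  "window R \<alpha> \<beta> = {x. axial x \<in> slit_plane \<alpha> \<and> meridional R x \<in> slit_plane \<beta>}"

definition chart_domain :: "real \<Rightarrow> real \<Rightarrow> real \<Rightarrow> (real^2) set" where
  "chart_domain R \<alpha> \<beta> = {u. \<bar>u $ 1 - \<alpha>\<bar> < pi \<and> \<bar>u $ 2 - \<beta>\<bar> < pi \<and> R + cos (u $ 2) > 0}"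

definition chart_inverse :: "real \<Rightarrow> real \<Rightarrow> real \<Rightarrow> real^3 \<Rightarrow> real^2" where
  "chart_inverse R \<alpha> \<beta> x = vector [angle \<alpha> (axial x), angle \<beta> (meridional R x)]"

lemma polar_angle: "w \<noteq> 0 \<Longrightarrow> of_real (norm w) * cis (angle \<alpha> w) = w"
proof -
  assume w: "w \<noteq> 0"
  let ?v = "cis (- \<alpha>) * w"
  have v: "?v \<noteq> 0" using w by simp
  have "?v = exp (Ln ?v)" using v by simp
  also have "\<dots> = of_real (exp (Re (Ln ?v))) * cis (Im (Ln ?v))" by (simp add: exp_eq_polar)
  also have "exp (Re (Ln ?v)) = norm w" using v by (simp add: norm_mult)
  finally have "cis \<alpha> * ?v = of_real (norm w) * cis (angle \<alpha> w)"
    by (simp add: angle_def cis_mult[symmetric] algebra_simps)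
  moreover have "cis \<alpha> * ?v = w" by (simp add: mult.assoc[symmetric] cis_mult)
  ultimately show ?thesis by simp
qed

lemma angle_of_polar:
  assumes "r > 0" "\<bar>a - \<alpha>\<bar> < pi"
  shows "angle \<alpha> (of_real r * cis a) = a" "of_real r * cis a \<in> slit_plane \<alpha>"
proof -
  have *: "cis (- \<alpha>) * (of_real r * cis a) = exp (of_real (ln r) + \<i> * of_real (a - \<alpha>))"
    using assms(1) by (simp add: exp_add exp_of_real cis_conv_exp[symmetric] cis_mult)
      (simp add: cis_mult cis_divide[symmetric] cis_conv_exp exp_add exp_diff exp_minus field_simps)
  have L: "Ln (exp (of_real (ln r) + \<i> * of_real (a - \<alpha>))) = of_real (ln r) + \<i> * of_real (a - \<alpha>)"
    by (rule Ln_exp) (use assms(2) in auto)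
  show "angle \<alpha> (of_real r * cis a) = a" unfolding angle_def * L by simp
  show "of_real r * cis a \<in> slit_plane \<alpha>"
  proof -
    let ?v = "exp (of_real (ln r) + \<i> * of_real (a - \<alpha>)) :: complex"
    have "?v \<notin> \<real>\<^sub>\<le>\<^sub>0"
    proof
      assume "?v \<in> \<real>\<^sub>\<le>\<^sub>0"
      then have "Re ?v \<le> 0" "Im ?v = 0" by (auto simp: complex_nonpos_Reals_iff)
      moreover have "?v \<noteq> 0" by simp
      ultimately have "Re ?v < 0" "Im ?v = 0" using complex_eqI[of ?v 0] by force+
      then have "Im (Ln ?v) = pi" using Im_Ln_eq_pi[of ?v] by simp
      then show False using L assms(2) by simp
    qed
    then show ?thesis unfolding slit_plane_def mem_Collect_eq * .
  qed
qed

lemma slit_plane_nonzero: "w \<in> slit_plane \<alpha> \<Longrightarrow> w \<noteq> 0"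
  by (auto simp: slit_plane_def)

lemma angle_bound: "w \<in> slit_plane \<alpha> \<Longrightarrow> \<bar>angle \<alpha> w - \<alpha>\<bar> < pi"
proof -
  assume w: "w \<in> slit_plane \<alpha>"
  let ?v = "cis (- \<alpha>) * w"
  have "?v \<noteq> 0" using slit_plane_nonzero[OF w] by simp
  moreover have "Im (Ln ?v) < pi" using w by (intro Im_Ln_less_pi) (auto simp: slit_plane_def)
  ultimately show ?thesis using mpi_less_Im_Ln[of ?v] by (auto simp: angle_def abs_less_iff)
qed

lemma slit_planeI: "w \<noteq> 0 \<Longrightarrow> w \<in> slit_plane (Arg w)"
  using angle_of_polar(2)[of "norm w" "Arg w" "Arg w"] by (simp add: cis_Arg sgn_eq)

lemma open_slit_plane: "open (slit_plane \<alpha>)"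
proof -
  have "open ((\<lambda>w. cis (- \<alpha>) * w) -` (- \<real>\<^sub>\<le>\<^sub>0))"
    by (intro open_vimage continuous_intros open_Compl closed_nonpos_Reals_complex)
  moreover have "(\<lambda>w. cis (- \<alpha>) * w) -` (- \<real>\<^sub>\<le>\<^sub>0) = slit_plane \<alpha>" by (auto simp: slit_plane_def)
  ultimately show ?thesis by simp
qed

lemma angle_differentiable: "w \<in> slit_plane \<alpha> \<Longrightarrow> angle \<alpha> differentiable (at w)"
proof -
  assume w: "w \<in> slit_plane \<alpha>"
  have "((\<lambda>w. Ln (cis (- \<alpha>) * w)) has_field_derivative (inverse (cis (- \<alpha>) * w) * cis (- \<alpha>))) (at w)"
    by (rule derivative_eq_intros refl)+ (use w in \<open>auto simp: slit_plane_def\<close>)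
  then have "((\<lambda>w. Ln (cis (- \<alpha>) * w)) has_derivative (*) (inverse (cis (- \<alpha>) * w) * cis (- \<alpha>))) (at w)"
    by (simp add: has_field_derivative_def)
  then have "((\<lambda>w. \<alpha> + Im (Ln (cis (- \<alpha>) * w))) has_derivative
      (\<lambda>h. 0 + Im ((inverse (cis (- \<alpha>) * w) * cis (- \<alpha>)) * h))) (at w)"
    by (intro has_derivative_add has_derivative_const has_derivative_Im)
  then show ?thesis unfolding differentiable_def angle_def[abs_def] by blast
qed

lemma linear_axial: "bounded_linear axial"
  unfolding axial_def[abs_def] linear_conv_bounded_linear[symmetric]
  by (intro linearI) (simp_all add: complex_eq_iff)

lemma norm_axial: "norm (axial x) = sqrt ((x $ 1)\<^sup>2 + (x $ 2)\<^sup>2)"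
  by (simp add: axial_def cmod_def)

lemma continuous_on_axial: "continuous_on S axial"
  by (intro linear_continuous_on linear_axial)

lemma continuous_on_meridional: "continuous_on S (meridional R)"
  unfolding meridional_def[abs_def] by (intro continuous_intros continuous_on_axial)

lemma open_window: "open (window R \<alpha> \<beta>)"
proof -
  have "window R \<alpha> \<beta> = axial -` slit_plane \<alpha> \<inter> meridional R -` slit_plane \<beta>"
    by (auto simp: window_def)
  then show ?thesis
    using continuous_on_axial[of UNIV] continuous_on_meridional[of UNIV]
    by (simp add: open_Int continuous_on_open_vimage[of UNIV] open_slit_plane open_vimage)
qed

lemma meridional_differentiable:
  assumes "axial x \<noteq> 0"
  shows "meridional R differentiable (at x)"
proof -
  have 1: "axial differentiable (at x)"
    using linear_axial bounded_linear_imp_differentiable by blast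
  have "norm differentiable (at (axial x))" using assms by (rule differentiable_norm_at)
  from differentiable_chain_at[OF 1 this] have "(\<lambda>x. norm (axial x)) differentiable (at x)"
    by (simp add: o_def)
  then obtain n' where n': "((\<lambda>x. norm (axial x)) has_derivative n') (at x)"
    by (auto simp: differentiable_def)
  have "((\<lambda>x. of_real (norm (axial x) - R) + \<i> * of_real (x $ 3)) has_derivative
     (\<lambda>h. of_real (n' h - 0) + \<i> * of_real (h $ 3))) (at x)"
    by (intro derivative_intros n' bounded_linear.has_derivative[OF bounded_linear_of_real]
          has_derivative_mult_right bounded_linear_imp_has_derivative bounded_linear_vec_nth)
  then show ?thesis unfolding differentiable_def meridional_def[abs_def] by blast
qed

lemma differentiable_vector_2:
  assumes "f differentiable (at x)" "g differentiable (at x)"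
  shows "(\<lambda>x. vector [f x, g x] :: real^2) differentiable (at x)"
proof -
  obtain f' g' where *: "(f has_derivative f') (at x)" "(g has_derivative g') (at x)"
    using assms by (auto simp: differentiable_def)
  have "((\<lambda>x. vector [f x, g x] :: real^2) has_derivative (\<lambda>h. vector [f' h, g' h])) (at x)"
    unfolding has_derivative_componentwise_within[of "\<lambda>x. vector [f x, g x]"]
    using * by (auto simp: Basis_vec_def inner_axis exhaust_2 vector_2 forall_2)
  then show ?thesis by (auto simp: differentiable_def)
qed

lemma chart_inverse_differentiable:
  assumes "x \<in> window R \<alpha> \<beta>"
  shows "chart_inverse R \<alpha> \<beta> differentiable (at x)"
proof -
  have a: "axial x \<in> slit_plane \<alpha>" "meridional R x \<in> slit_plane \<beta>" using assms by (auto simp: window_def)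
  have "(angle \<alpha> \<circ> axial) differentiable (at x)"
    by (rule differentiable_chain_at[OF bounded_linear_imp_differentiable[OF linear_axial]
          angle_differentiable[OF a(1)]])
  moreover have "(angle \<beta> \<circ> meridional R) differentiable (at x)"
    by (rule differentiable_chain_at[OF meridional_differentiable[OF slit_plane_nonzero[OF a(1)]]
          angle_differentiable[OF a(2)]])
  ultimately show ?thesis unfolding chart_inverse_def[abs_def]
    by (intro differentiable_vector_2) (simp_all add: o_def)
qed

lemma chart_nth [simp]:
  "chart R u $ 1 = (R + cos (u $ 2)) * cos (u $ 1)"
  "chart R u $ 2 = (R + cos (u $ 2)) * sin (u $ 1)"
  "chart R u $ 3 = sin (u $ 2)"
  by (simp_all add: chart_def)

lemma axial_chart: "axial (chart R u) = of_real (R + cos (u $ 2)) * cis (u $ 1)"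
  by (simp add: axial_def complex_eq_iff)

lemma meridional_chart:
  assumes "R + cos (u $ 2) > 0"
  shows "meridional R (chart R u) = cis (u $ 2)"
proof -
  have "norm (axial (chart R u)) = R + cos (u $ 2)"
    unfolding axial_chart norm_mult norm_of_real norm_cis using assms by simp
  then show ?thesis by (simp add: meridional_def complex_eq_iff)
qed

lemma chart_in_surface:
  assumes "u \<in> chart_domain R \<alpha> \<beta>"
  shows "chart R u \<in> rev_surface R" "chart R u \<in> window R \<alpha> \<beta>" "chart_inverse R \<alpha> \<beta> (chart R u) = u"
proof -
  have u: "R + cos (u $ 2) > 0" "\<bar>u $ 1 - \<alpha>\<bar> < pi" "\<bar>u $ 2 - \<beta>\<bar> < pi"
    using assms by (auto simp: chart_domain_def)
  show "chart R u \<in> rev_surface R" by (simp add: rev_surface_def meridional_chart u)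
  show "chart R u \<in> window R \<alpha> \<beta>"
    using angle_of_polar(2)[OF u(1,2)] angle_of_polar(2)[OF zero_less_one u(3)]
    by (simp add: window_def axial_chart meridional_chart u)
  show "chart_inverse R \<alpha> \<beta> (chart R u) = u"
    using angle_of_polar(1)[OF u(1,2)] angle_of_polar(1)[OF zero_less_one u(3)]
    by (simp add: chart_inverse_def axial_chart meridional_chart u vec_eq_iff forall_2)
qed

lemma chart_chart_inverse:
  assumes "x \<in> rev_surface R" "x \<in> window R \<alpha> \<beta>"
  shows "chart R (chart_inverse R \<alpha> \<beta> x) = x" "chart_inverse R \<alpha> \<beta> x \<in> chart_domain R \<alpha> \<beta>"
proof -
  define a v where "a = angle \<alpha> (axial x)" and "v = angle \<beta> (meridional R x)"
  have sl: "axial x \<in> slit_plane \<alpha>" "meridional R x \<in> slit_plane \<beta>" using assms by (auto simp: window_def)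
  have A: "of_real (norm (axial x)) * cis a = axial x"
    unfolding a_def by (rule polar_angle[OF slit_plane_nonzero[OF sl(1)]])
  have "of_real (norm (meridional R x)) * cis v = meridional R x"
    unfolding v_def by (rule polar_angle[OF slit_plane_nonzero[OF sl(2)]])
  then have B: "cis v = meridional R x" using assms(1) by (simp add: rev_surface_def)
  then have c: "cos v = norm (axial x) - R" "sin v = x $ 3"
    by (auto simp: complex_eq_iff meridional_def)
  have d: "norm (axial x) * cos a = x $ 1" "norm (axial x) * sin a = x $ 2"
    using A by (auto simp: complex_eq_iff axial_def)
  have G: "chart_inverse R \<alpha> \<beta> x = vector [a, v]" by (simp add: chart_inverse_def a_def v_def)
  show "chart R (chart_inverse R \<alpha> \<beta> x) = x"
    unfolding G using c d by (simp add: vec_eq_iff forall_3)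
  show "chart_inverse R \<alpha> \<beta> x \<in> chart_domain R \<alpha> \<beta>"
    unfolding G chart_domain_def
    using angle_bound[OF sl(1)] angle_bound[OF sl(2)] slit_plane_nonzero[OF sl(1)] c
    by (simp add: a_def v_def)
qed

lemma chart_image: "chart R ` chart_domain R \<alpha> \<beta> = rev_surface R \<inter> window R \<alpha> \<beta>"
proof (intro equalityI subsetI)
  fix x assume "x \<in> rev_surface R \<inter> window R \<alpha> \<beta>"
  then show "x \<in> chart R ` chart_domain R \<alpha> \<beta>"
    using chart_chart_inverse by (intro image_eqI[of _ _ "chart_inverse R \<alpha> \<beta> x"]) simp_all
qed (use chart_in_surface in auto)

lemma has_derivative_chart:
  "(chart R has_derivative (\<lambda>h. vector
     [- sin (u $ 2) * h $ 2 * cos (u $ 1) - (R + cos (u $ 2)) * sin (u $ 1) * h $ 1,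
      - sin (u $ 2) * h $ 2 * sin (u $ 1) + (R + cos (u $ 2)) * cos (u $ 1) * h $ 1,
      cos (u $ 2) * h $ 2])) (at u)"
  unfolding has_derivative_componentwise_within[of "chart R"]
proof
  fix b :: "real^3" assume "b \<in> Basis"
  then obtain i where b: "b = axis i 1" by (auto simp: Basis_vec_def)
  have n: "((\<lambda>u::real^2. u $ k) has_derivative (\<lambda>h. h $ k)) (at u)" for k
    by (intro bounded_linear_imp_has_derivative bounded_linear_vec_nth)
  consider "i = 1" | "i = 2" | "i = 3" using exhaust_3[of i] by blast
  then show "((\<lambda>u. chart R u \<bullet> b) has_derivative (\<lambda>h. vector
     [- sin (u $ 2) * h $ 2 * cos (u $ 1) - (R + cos (u $ 2)) * sin (u $ 1) * h $ 1,
      - sin (u $ 2) * h $ 2 * sin (u $ 1) + (R + cos (u $ 2)) * cos (u $ 1) * h $ 1,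
      cos (u $ 2) * h $ 2] \<bullet> b)) (at u)"
    by cases (auto simp: b inner_axis intro!: derivative_eq_intros n)
qed

lemma area_density_chart:
  assumes "R + cos (u $ 2) > 0"
  shows "area_density (chart R) u = R + cos (u $ 2)"
proof -
  let ?\<rho> = "R + cos (u $ 2)"
  have "frechet_derivative (chart R) (at u) = (\<lambda>h. vector
     [- sin (u $ 2) * h $ 2 * cos (u $ 1) - ?\<rho> * sin (u $ 1) * h $ 1,
      - sin (u $ 2) * h $ 2 * sin (u $ 1) + ?\<rho> * cos (u $ 1) * h $ 1,
      cos (u $ 2) * h $ 2])"
    by (rule frechet_derivative_at[OF has_derivative_chart, symmetric])
  note * = this
  have "cross3 (frechet_derivative (chart R) (at u) (axis 1 1)) (frechet_derivative (chart R) (at u) (axis 2 1))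
    = ?\<rho> *\<^sub>R vector [cos (u $ 1) * cos (u $ 2), sin (u $ 1) * cos (u $ 2), sin (u $ 2)]"
  proof -
    have "?\<rho> * sin (u $ 1) * (sin (u $ 2) * sin (u $ 1)) + ?\<rho> * cos (u $ 1) * (sin (u $ 2) * cos (u $ 1))
      = ?\<rho> * sin (u $ 2) * ((sin (u $ 1))\<^sup>2 + (cos (u $ 1))\<^sup>2)"
      by (simp only: power2_eq_square ring_distribs mult_ac)
    with * show ?thesis by (simp add: cross3_def vec_eq_iff forall_3 axis_def)
  qed
  moreover have "norm (vector [cos (u $ 1) * cos (u $ 2), sin (u $ 1) * cos (u $ 2), sin (u $ 2)] :: real^3) = 1"
  proof -
    have "(cos (u $ 1) * cos (u $ 2))\<^sup>2 + (sin (u $ 1) * cos (u $ 2))\<^sup>2 + (sin (u $ 2))\<^sup>2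
      = ((sin (u $ 1))\<^sup>2 + (cos (u $ 1))\<^sup>2) * (cos (u $ 2))\<^sup>2 + (sin (u $ 2))\<^sup>2"
      by (simp only: power_mult_distrib ring_distribs add_ac)
    then show ?thesis by (simp add: norm_eq_sqrt_inner inner_vec_def sum_3 flip: power2_eq_square)
  qed
  ultimately show ?thesis using assms by (simp add: area_density_def)
qed

lemma open_chart_domain: "open (chart_domain R \<alpha> \<beta>)"
  unfolding chart_domain_def by (intro open_Collect_conj open_Collect_less continuous_intros)

lemma elementary_chart: "open S \<Longrightarrow> elementary S (\<lambda>u. chart R u $ i)"
proof -
  have n: "elementary S (\<lambda>u::real^2. u $ k)" for k
    by (rule elementary.linear, rule bounded_linear_vec_nth)
  consider "i = 1" | "i = 2" | "i = 3" using exhaust_3[of i] by blast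
  then show ?thesis by cases (auto intro!: elementary_intros n)
qed

text \<open>The chart is an immersion because it has a differentiable left inverse.\<close>

lemma local_parametrization_chart:
  "local_parametrization (rev_surface R) (chart_domain R \<alpha> \<beta>) (chart R)"
  unfolding local_parametrization_def
proof (intro conjI ballI)
  let ?U = "chart_domain R \<alpha> \<beta>" and ?G = "chart_inverse R \<alpha> \<beta>"
  show "open ?U" by (rule open_chart_domain)
  show "smooth_on ?U (chart R)"
    by (intro smooth_on_elementary elementary_chart open_chart_domain)
  show "openin (top_of_set (rev_surface R)) (chart R ` ?U)"
    unfolding chart_image using open_window by (auto simp: openin_open)
  have "homeomorphism ?U (chart R ` ?U) (chart R) ?G"
  proof (rule homeomorphismI)
    show "continuous_on ?U (chart R)"
      by (rule has_derivative_continuous_on[OF has_derivative_at_withinI[OF has_derivative_chart]])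
    show "continuous_on (chart R ` ?U) ?G"
      unfolding chart_image
      by (intro continuous_at_imp_continuous_on ballI differentiable_imp_continuous_within
          chart_inverse_differentiable) simp
  qed (use chart_in_surface in auto)
  then show "\<exists>\<xi>. homeomorphism ?U (chart R ` ?U) (chart R) \<xi>" by blast
  fix u assume u: "u \<in> ?U"
  obtain \<phi>' where \<phi>': "(chart R has_derivative \<phi>') (at u)" using has_derivative_chart by blast
  obtain G' where G': "(?G has_derivative G') (at (chart R u))"
    using chart_inverse_differentiable[OF chart_in_surface(2)[OF u]] by (auto simp: differentiable_def)
  have "((?G \<circ> chart R) has_derivative G' \<circ> \<phi>') (at u)" using \<phi>' G' by (rule diff_chain_at)
  moreover have "((?G \<circ> chart R) has_derivative id) (at u)"
    by (rule has_derivative_transform_within_open[OF has_derivative_id open_chart_domain u])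
      (simp add: chart_in_surface)
  ultimately have "G' \<circ> \<phi>' = id" by (rule has_derivative_unique)
  then have "inj (G' \<circ> \<phi>')" by simp
  then have "inj \<phi>'" by (rule inj_on_imageI2)
  then show "inj (frechet_derivative (chart R) (at u))"
    by (simp only: frechet_derivative_at[OF \<phi>', symmetric])
qed

section \<open>Similarity transformations\<close>

text \<open>Only the values on the open set matter, although the definition differentiates total functions.\<close>

lemma higher_differentiable_on_cong:
  assumes "open S" "\<And>x. x \<in> S \<Longrightarrow> f x = g x" "higher_differentiable_on n S f"
  shows "higher_differentiable_on n S g"
  using assms(2,3)
proof (induction n arbitrary: f g)
  case 0
  then show ?case by (simp cong: continuous_on_cong)
next
  case (Suc n)
  have der: "(g has_derivative f') (at x)" if "x \<in> S" "(f has_derivative f') (at x)" for x f'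
    by (rule has_derivative_transform_within_open[OF that(2) \<open>open S\<close> that(1)]) (use Suc.prems in auto)
  have "g differentiable (at x) \<and> frechet_derivative f (at x) = frechet_derivative g (at x)" if "x \<in> S" for x
  proof -
    have "(f has_derivative frechet_derivative f (at x)) (at x)"
      using Suc.prems(2) that by (simp add: frechet_derivative_works)
    from der[OF that this] show ?thesis
      using frechet_derivative_at by (auto simp: differentiable_def)
  qed
  then have g: "\<And>x. x \<in> S \<Longrightarrow> g differentiable (at x)"
    and fg: "\<And>x. x \<in> S \<Longrightarrow> frechet_derivative f (at x) = frechet_derivative g (at x)" by auto
  have "higher_differentiable_on n S (\<lambda>x. frechet_derivative g (at x) v)" for v
    by (rule Suc.IH[of "\<lambda>x. frechet_derivative f (at x) v"]) (use Suc.prems fg in auto)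
  then show ?case using g by simp
qed

lemma frechet_derivative_linear_comp:
  assumes "bounded_linear f" "\<phi> differentiable (at x)"
  shows "(f \<circ> \<phi>) differentiable (at x)"
    "frechet_derivative (f \<circ> \<phi>) (at x) = f \<circ> frechet_derivative \<phi> (at x)"
proof -
  have "((f \<circ> \<phi>) has_derivative (f \<circ> frechet_derivative \<phi> (at x))) (at x)"
    by (rule diff_chain_at[OF iffD1[OF frechet_derivative_works assms(2)]
          bounded_linear_imp_has_derivative[OF assms(1)]])
  then show "(f \<circ> \<phi>) differentiable (at x)"
    "frechet_derivative (f \<circ> \<phi>) (at x) = f \<circ> frechet_derivative \<phi> (at x)"
    using frechet_derivative_at[symmetric] by (auto simp: differentiable_def)
qed

lemma smooth_on_linear_comp:
  assumes "open S" "bounded_linear f" "smooth_on S \<phi>"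
  shows "smooth_on S (f \<circ> \<phi>)"
proof -
  have "higher_differentiable_on n S (\<lambda>x. f (\<phi> x))" if "higher_differentiable_on n S \<phi>" for n \<phi>
    using that
  proof (induction n arbitrary: \<phi>)
    case 0
    then show ?case by (simp add: bounded_linear.continuous_on[OF assms(2)])
  next
    case (Suc n)
    have *: "(\<lambda>x. f (\<phi> x)) differentiable (at x)"
      "frechet_derivative (\<lambda>x. f (\<phi> x)) (at x) v = f (frechet_derivative \<phi> (at x) v)" if "x \<in> S" for x v
      using frechet_derivative_linear_comp[OF assms(2), of \<phi> x] Suc.prems that by (auto simp: o_def)
    have "higher_differentiable_on n S (\<lambda>x. frechet_derivative (\<lambda>x. f (\<phi> x)) (at x) v)" for v
      by (rule higher_differentiable_on_cong[OF assms(1) _ Suc.IH[of "\<lambda>x. frechet_derivative \<phi> (at x) v"]])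
        (use Suc.prems * in auto)
    then show ?case using * by simp
  qed
  then show ?thesis using assms(3) by (simp add: smooth_on_def o_def)
qed

text \<open>Two instances are used: orthogonal maps (the homogeneity of the sphere, needed for its poles and for
  its caps) and dilations (the Moebius transformations that change the energy).\<close>

locale linear_similarity =
  fixes f :: "real^3 \<Rightarrow> real^3" and c :: real
  assumes linear: "linear f" and norm: "norm (f x) = c * norm x" and pos: "c > 0"
begin

lemma bounded_linear: "bounded_linear f"
  using linear linear_conv_bounded_linear by blast

lemma dist: "dist (f x) (f y) = c * dist x y"
  using norm[of "x - y"] linear by (simp add: dist_norm linear_diff)

lemma inj: "inj f"
  using dist pos by (metis dist_eq_0_iff injI mult_eq_0_iff less_irrefl)

lemma surj: "surj f"
  using linear_injective_imp_surjective[OF linear inj] by simp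

lemma continuous: "continuous_on S f"
  using bounded_linear linear_continuous_on by blast

lemma inner: "f x \<bullet> f y = c\<^sup>2 * (x \<bullet> y)"
proof -
  have "(norm (f x + f y))\<^sup>2 = c\<^sup>2 * (norm (x + y))\<^sup>2" "(norm (f x))\<^sup>2 = c\<^sup>2 * (norm x)\<^sup>2"
    "(norm (f y))\<^sup>2 = c\<^sup>2 * (norm y)\<^sup>2"
    using norm[of "x + y"] norm[of x] norm[of y] linear
    by (simp_all add: linear_add power_mult_distrib)
  then show ?thesis by (simp add: power2_norm_eq_inner inner_add algebra_simps inner_commute)
qed

lemma norm_cross: "norm (cross3 (f x) (f y)) = c\<^sup>2 * norm (cross3 x y)"
proof -
  have "(norm (cross3 (f x) (f y)))\<^sup>2 = (c\<^sup>2 * norm (cross3 x y))\<^sup>2"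
    using norm_cross_dot[of "f x" "f y"] norm_cross_dot[of x y]
    by (simp add: norm inner power_mult_distrib algebra_simps) algebra
  then show ?thesis using pos by (simp add: power2_eq_iff_nonneg)
qed

lemma local_parametrization:
  assumes "local_parametrization M U \<phi>"
  shows "local_parametrization (f ` M) U (f \<circ> \<phi>)"
    "\<And>u. u \<in> U \<Longrightarrow> area_density (f \<circ> \<phi>) u = c\<^sup>2 * area_density \<phi> u"
proof -
  have U: "open U" "smooth_on U \<phi>" using assms by (auto simp: local_parametrization_def)
  have "higher_differentiable_on (Suc 0) U \<phi>" using U unfolding smooth_on_def by blast
  then have d: "\<phi> differentiable (at u)" if "u \<in> U" for u using that by simp
  note fr = frechet_derivative_linear_comp(2)[OF bounded_linear d]
  show "area_density (f \<circ> \<phi>) u = c\<^sup>2 * area_density \<phi> u" if "u \<in> U" for u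
    by (simp add: area_density_def fr[OF that] norm_cross)
  have hom: "homeomorphism A (f ` A) f (inv f)" for A
    using inj continuous
    by (intro homeomorphismI) (auto intro!: continuous_on_subset[OF linear_continuous_on]
        simp: linear_conv_bounded_linear[symmetric] linear linear_injective_left_inverse
        inj_linear_imp_inv_linear)
  obtain \<xi> where "homeomorphism U (\<phi> ` U) \<phi> \<xi>" using assms by (auto simp: local_parametrization_def)
  from homeomorphism_compose[OF this hom]
  have "homeomorphism U ((f \<circ> \<phi>) ` U) (f \<circ> \<phi>) (\<xi> \<circ> inv f)" by (simp add: image_comp)
  moreover have "openin (top_of_set (f ` M)) (f ` (\<phi> ` U))"
    using homeomorphism_imp_open_map[OF hom, of M "\<phi> ` U"] assms
    by (auto simp: local_parametrization_def)
  moreover have "inj (frechet_derivative (f \<circ> \<phi>) (at u))" if "u \<in> U" for u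
    unfolding fr[OF that] using assms that inj
    by (intro inj_compose) (auto simp: local_parametrization_def)
  ultimately show "local_parametrization (f ` M) U (f \<circ> \<phi>)"
    unfolding local_parametrization_def
    using U smooth_on_linear_comp[OF U(1) bounded_linear U(2)] by (auto simp: image_comp)
qed

lemma closed_surface: "closed_surface M \<Longrightarrow> closed_surface (f ` M)"
  unfolding closed_surface_def
proof (intro conjI ballI)
  assume M: "compact M \<and> (\<forall>p\<in>M. \<exists>U \<phi>. local_parametrization M U \<phi> \<and> p \<in> \<phi> ` U)"
  then show "compact (f ` M)" using continuous compact_continuous_image by blast
  fix q assume "q \<in> f ` M"
  then obtain p U \<phi> where "q = f p" "local_parametrization M U \<phi>" "p \<in> \<phi> ` U" using M by blast
  then show "\<exists>U \<phi>. local_parametrization (f ` M) U \<phi> \<and> q \<in> \<phi> ` U"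
    using local_parametrization(1) by (intro exI[of _ U] exI[of _ "f \<circ> \<phi>"]) auto
qed

lemma inverse: "linear_similarity (inv f) (1 / c)"
proof (rule linear_similarity.intro)
  show "linear (inv f)" using inj_linear_imp_inv_linear[OF linear inj] .
  show "norm (inv f x) = 1 / c * norm x" for x
    using norm[of "inv f x"] surj pos by (simp add: surj_f_inv_f field_simps)
  show "1 / c > 0" using pos by simp
qed

end

lemma local_parametrization_area_measurable:
  assumes "local_parametrization M U \<phi>"
  shows "(\<lambda>u. ennreal (area_density \<phi> u) * indicator U u) \<in> borel_measurable borel"
    and "\<And>A. A \<in> sets borel \<Longrightarrow> {u \<in> U. \<phi> u \<in> A} \<in> sets borel"
proof -
  have U: "open U" "smooth_on U \<phi>" using assms by (auto simp: local_parametrization_def)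
  then have "higher_differentiable_on (Suc 0) U \<phi>" "higher_differentiable_on 0 U \<phi>"
    unfolding smooth_on_def by blast+
  then have c: "continuous_on U (\<lambda>u. frechet_derivative \<phi> (at u) v)" "continuous_on U \<phi>" for v by auto
  have "continuous_on U (area_density \<phi>)"
    unfolding area_density_def[abs_def] by (intro continuous_on_norm continuous_on_cross c)
  then have "(\<lambda>u. indicator U u *\<^sub>R area_density \<phi> u) \<in> borel_measurable borel"
    using U by (intro borel_measurable_continuous_on_indicator) auto
  then have "(\<lambda>u. ennreal (indicator U u *\<^sub>R area_density \<phi> u)) \<in> borel_measurable borel" by measurable
  moreover have "ennreal (indicator U u *\<^sub>R area_density \<phi> u) = ennreal (area_density \<phi> u) * indicator U u" for u
    by (auto split: split_indicator)
  ultimately show "(\<lambda>u. ennreal (area_density \<phi> u) * indicator U u) \<in> borel_measurable borel" by simp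
  fix A :: "(real^3) set" assume A: "A \<in> sets borel"
  have "\<phi> \<in> measurable (restrict_space borel U) borel"
    using c(2) by (rule borel_measurable_continuous_on_restrict)
  from measurable_sets[OF this A] have "\<phi> -` A \<inter> U \<in> sets (restrict_space borel U)"
    by (simp add: space_restrict_space)
  then have "\<phi> -` A \<inter> U \<in> sets borel" using U by (subst (asm) sets_restrict_space_iff) auto
  moreover have "\<phi> -` A \<inter> U = {u \<in> U. \<phi> u \<in> A}" by auto
  ultimately show "{u \<in> U. \<phi> u \<in> A} \<in> sets borel" by simp
qed

context linear_similarity
begin

text \<open>A local parametrization of the image pulls back to one of \<open>M\<close>, and its area density changes by the
factor \<open>c\<^sup>2\<close>.\<close>

lemma area_measure:
  assumes \<mu>: "is_area_measure M \<mu>"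
  shows "is_area_measure (f ` M) (density (distr \<mu> borel f) (\<lambda>_. ennreal (c\<^sup>2)))" (is "is_area_measure _ ?\<nu>")
  unfolding is_area_measure_def
proof (intro conjI allI impI ballI)
  interpret i: linear_similarity "inv f" "1 / c" by (rule inverse)
  have s: "sets \<mu> = sets borel" "space \<mu> = UNIV"
    using \<mu> sets_eq_imp_space_eq[of \<mu> borel] by (auto simp: is_area_measure_def)
  have fm: "f \<in> measurable \<mu> borel"
    using continuous borel_measurable_continuous_onI measurable_cong_sets[OF s(1) refl] by blast
  have em: "emeasure ?\<nu> A = ennreal (c\<^sup>2) * emeasure \<mu> (f -` A)" if "A \<in> sets borel" for A
    using that fm s by (simp add: emeasure_density_const emeasure_distr)
  show "sets ?\<nu> = sets borel" by simp
  show "emeasure ?\<nu> (- (f ` M)) = 0"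
  proof (cases "f ` M \<in> sets borel")
    case True
    then have "emeasure ?\<nu> (- (f ` M)) = ennreal (c\<^sup>2) * emeasure \<mu> (- (f -` (f ` M)))"
      by (subst em) (auto simp: vimage_Compl)
    then show ?thesis using \<mu> by (simp add: inj_vimage_image_eq[OF inj] is_area_measure_def)
  next
    case False
    have "- (- (f ` M)) \<in> sets borel" if "- (f ` M) \<in> sets borel"
      using borel_comp[OF that] .
    with False show ?thesis by (intro emeasure_notin_sets) auto
  qed
  fix U \<phi> A assume \<phi>: "local_parametrization (f ` M) U \<phi>" and A: "A \<in> sets borel" "A \<subseteq> \<phi> ` U"
  define \<zeta> where "\<zeta> = inv f \<circ> \<phi>"
  have \<zeta>: "local_parametrization M U \<zeta>" "\<And>u. u \<in> U \<Longrightarrow> area_density \<zeta> u = (1 / c)\<^sup>2 * area_density \<phi> u"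
    using i.local_parametrization[OF \<phi>] by (auto simp: \<zeta>_def image_comp inv_o_cancel[OF inj])
  have fA: "f -` A \<in> sets borel" using measurable_sets[OF fm A(1)] s by simp
  have f\<zeta>: "f (\<zeta> u) = \<phi> u" for u by (simp add: \<zeta>_def surj_f_inv_f[OF surj])
  have "f -` A \<subseteq> \<zeta> ` U"
  proof
    fix x assume "x \<in> f -` A"
    then obtain u where "u \<in> U" "f x = \<phi> u" using A(2) by auto
    then show "x \<in> \<zeta> ` U" by (metis \<zeta>_def comp_apply imageI inj inv_f_f)
  qed
  then have "emeasure \<mu> (f -` A) = (\<integral>\<^sup>+u\<in>{u\<in>U. \<phi> u \<in> A}. ennreal (area_density \<zeta> u) \<partial>lborel)"
    using \<mu> \<zeta>(1) fA unfolding is_area_measure_def by (simp add: f\<zeta>)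
  then have "emeasure ?\<nu> A = ennreal (c\<^sup>2) * (\<integral>\<^sup>+u\<in>{u\<in>U. \<phi> u \<in> A}. ennreal (area_density \<zeta> u) \<partial>lborel)"
    using em[OF A(1)] by simp
  also have "\<dots> = (\<integral>\<^sup>+u. ennreal (c\<^sup>2) * (ennreal (area_density \<zeta> u) * indicator {u\<in>U. \<phi> u \<in> A} u) \<partial>lborel)"
  proof (rule nn_integral_cmult[symmetric])
    have "(\<lambda>u. (ennreal (area_density \<zeta> u) * indicator U u) * indicator {u\<in>U. \<phi> u \<in> A} u) \<in> borel_measurable borel"
      by (rule borel_measurable_times_ennreal[OF local_parametrization_area_measurable(1)[OF \<zeta>(1)]
            borel_measurable_indicator[OF local_parametrization_area_measurable(2)[OF \<phi> A(1)]]])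
    also have "(\<lambda>u. (ennreal (area_density \<zeta> u) * indicator U u) * indicator {u\<in>U. \<phi> u \<in> A} u)
       = (\<lambda>u. ennreal (area_density \<zeta> u) * indicator {u\<in>U. \<phi> u \<in> A} u)"
      by (auto simp: fun_eq_iff split: split_indicator)
    finally show "(\<lambda>u. ennreal (area_density \<zeta> u) * indicator {u\<in>U. \<phi> u \<in> A} u) \<in> borel_measurable lborel"
      by simp
  qed
  also have "\<dots> = (\<integral>\<^sup>+u\<in>{u\<in>U. \<phi> u \<in> A}. ennreal (area_density \<phi> u) \<partial>lborel)"
    using pos \<zeta>(2)
    by (intro nn_integral_cong)
       (auto split: split_indicator simp: ennreal_mult''[symmetric] power_one_over area_density_def)
  finally show "emeasure ?\<nu> A = (\<integral>\<^sup>+u\<in>{u\<in>U. \<phi> u \<in> A}. ennreal (area_density \<phi> u) \<partial>lborel)" .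
qed

end

lemma linear_similarity_scaling: "c > 0 \<Longrightarrow> linear_similarity (\<lambda>x. c *\<^sub>R x) c"
  by (rule linear_similarity.intro) (auto simp: linear_iff scaleR_right_distrib)

lemma linear_similarity_orthogonal: "orthogonal_transformation f \<Longrightarrow> linear_similarity f 1"
  by (rule linear_similarity.intro) (auto simp: orthogonal_transformation)

section \<open>The two surfaces are closed\<close>

lemma Re_Im_axial [simp]: "Re (axial x) = x $ 1" "Im (axial x) = x $ 2"
  by (simp_all add: axial_def)

lemma rev_surface_0: "rev_surface 0 = sphere 0 1"
  by (auto simp: rev_surface_def meridional_def norm_axial cmod_def norm_eq_sqrt_inner inner_vec_def
      sum_3 power2_eq_square)

lemma compact_rev_surface: "compact (rev_surface R)"
proof -
  have "closed (rev_surface R)" unfolding rev_surface_def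
    by (intro closed_Collect_eq continuous_intros continuous_on_meridional)
  moreover have "norm x \<le> \<bar>R\<bar> + 2" if "x \<in> rev_surface R" for x
  proof -
    have "\<bar>Re (meridional R x)\<bar> \<le> 1" "\<bar>Im (meridional R x)\<bar> \<le> 1"
      using that abs_Re_le_cmod[of "meridional R x"] abs_Im_le_cmod[of "meridional R x"]
      by (auto simp: rev_surface_def)
    then have *: "norm (axial x) \<le> \<bar>R\<bar> + 1" "\<bar>x $ 3\<bar> \<le> 1" by (auto simp: meridional_def)
    have "norm x = sqrt ((norm (axial x))\<^sup>2 + (x $ 3)\<^sup>2)"
      by (simp add: norm_axial norm_eq_sqrt_inner[of x] inner_vec_def sum_3 power2_eq_square)
    also have "\<dots> \<le> norm (axial x) + \<bar>x $ 3\<bar>" using sqrt_sum_squares_le_sum_abs[of "norm (axial x)"] by simp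
    finally show ?thesis using * by linarith
  qed
  then have "bounded (rev_surface R)" by (rule boundedI)
  ultimately show ?thesis by (simp add: compact_eq_bounded_closed)
qed

lemma orthogonal_image_sphere:
  assumes f: "orthogonal_transformation f"
  shows "f ` rev_surface 0 = rev_surface 0"
proof -
  interpret linear_similarity f 1 using f by (rule linear_similarity_orthogonal)
  have "x \<in> f ` sphere 0 1" if "x \<in> sphere 0 1" for x
    using surj that norm by (metis (no_types) dist_0_norm imageI mem_sphere mult_1 surjD)
  then show ?thesis using norm by (auto simp: rev_surface_0)
qed

text \<open>The chart omits the poles. A rotation moves its centre to an arbitrary point.\<close>

lemma closed_surface_sphere: "closed_surface (rev_surface 0)"
  unfolding closed_surface_def
proof (intro conjI ballI compact_rev_surface)
  fix p assume p: "p \<in> rev_surface 0"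
  let ?e = "chart 0 0" and ?U = "chart_domain 0 0 0"
  have u: "0 \<in> ?U" by (simp add: chart_domain_def)
  have "?e \<in> rev_surface 0" using chart_in_surface(1)[OF u] .
  then have "norm ?e = norm p" using p by (simp add: rev_surface_0)
  then obtain f where f: "orthogonal_transformation f" "f ?e = p"
    using orthogonal_transformation_exists by blast
  interpret linear_similarity f 1 using f(1) by (rule linear_similarity_orthogonal)
  from orthogonal_image_sphere[OF f(1)] show "\<exists>U \<phi>. local_parametrization (rev_surface 0) U \<phi> \<and> p \<in> \<phi> ` U"
    using local_parametrization(1)[OF local_parametrization_chart[of 0 0 0]] u f(2)
    by (intro exI[of _ ?U] exI[of _ "f \<circ> chart 0"]) auto
qed

lemma torus_window:
  assumes "R > 1" "x \<in> rev_surface R"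
  shows "axial x \<noteq> 0" "meridional R x \<noteq> 0"
proof -
  have 1: "norm (meridional R x) = 1" using assms(2) by (simp add: rev_surface_def)
  then show "meridional R x \<noteq> 0" by auto
  have "\<bar>norm (axial x) - R\<bar> \<le> 1"
    using abs_Re_le_cmod[of "meridional R x"] 1 by (simp add: meridional_def)
  then show "axial x \<noteq> 0" using assms(1) by auto
qed

lemma closed_surface_torus: "R > 1 \<Longrightarrow> closed_surface (rev_surface R)"
  unfolding closed_surface_def
proof (intro conjI ballI compact_rev_surface)
  fix p assume R: "R > 1" and p: "p \<in> rev_surface R"
  have "p \<in> window R (Arg (axial p)) (Arg (meridional R p))"
    using torus_window[OF R p] slit_planeI by (simp add: window_def)
  then show "\<exists>U \<phi>. local_parametrization (rev_surface R) U \<phi> \<and> p \<in> \<phi> ` U"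
    using local_parametrization_chart p chart_image by blast
qed

section \<open>The area measure of a surface of revolution\<close>

lemma area_measure_eq: "closed_surface M \<Longrightarrow> is_area_measure M \<mu> \<Longrightarrow> area_measure M = \<mu>"
  unfolding area_measure_def using is_area_measure_unique by blast

lemma nn_integral_absolutely_integrable:
  fixes h :: "'a::euclidean_space \<Rightarrow> real"
  assumes "h absolutely_integrable_on S" "\<And>x. x \<in> S \<Longrightarrow> h x \<ge> 0"
  shows "(\<integral>\<^sup>+x\<in>S. ennreal (h x) \<partial>lborel) = ennreal (integral S h)"
proof -
  have "(\<integral>\<^sup>+x\<in>S. ennreal (h x) \<partial>lborel) = (\<integral>\<^sup>+x\<in>S. ennreal (h x) \<partial>lebesgue)"
    by (simp add: nn_integral_completion)
  also have "\<dots> = (\<integral>\<^sup>+x. ennreal (indicator S x *\<^sub>R h x) \<partial>lebesgue)"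
    by (intro nn_integral_cong) (auto split: split_indicator)
  also have "\<dots> = ennreal (LINT x:S|lebesgue. h x)"
    unfolding set_lebesgue_integral_def using assms
    by (intro nn_integral_eq_integral) (auto simp: set_integrable_def split: split_indicator)
  finally show ?thesis using set_lebesgue_integral_eq_integral(2)[OF assms(1)] by simp
qed

text \<open>The change of variables theorem for vector-valued integrands, applied in dimension one and
rewritten for nonnegative integrals.\<close>

lemma nn_integral_change_of_variables:
  fixes h :: "real^2 \<Rightarrow> real" and g :: "real^2 \<Rightarrow> real^2"
  assumes S: "S \<in> sets borel"
    and der: "\<And>x. x \<in> S \<Longrightarrow> (g has_derivative g' x) (at x)" and inj: "inj_on g S"
    and h: "h absolutely_integrable_on (g ` S)" "\<And>x. x \<in> g ` S \<Longrightarrow> h x \<ge> 0"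
  shows "(\<integral>\<^sup>+x\<in>S. ennreal (\<bar>det (matrix (g' x))\<bar> * h (g x)) \<partial>lborel) = (\<integral>\<^sup>+y\<in>g ` S. ennreal (h y) \<partial>lborel)"
proof -
  define H where "H = (\<lambda>x. h x *\<^sub>R (axis 1 1 :: real^1))"
  have "((\<lambda>t. t *\<^sub>R (axis 1 1 :: real^1)) \<circ> h) absolutely_integrable_on (g ` S)"
    by (rule absolutely_integrable_linear[OF h(1) bounded_linear_scaleR_left])
  then have H: "H absolutely_integrable_on (g ` S)" by (simp add: H_def o_def)
  have nth: "bounded_linear (\<lambda>v::real^1. v $ 1)" by (rule bounded_linear_vec_nth)
  have int: "integral A (\<lambda>x. f x $ 1) = integral A f $ 1 \<and> (\<lambda>x. f x $ 1) absolutely_integrable_on A"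
    if f: "f absolutely_integrable_on A" for f :: "real^2 \<Rightarrow> real^1" and A
    using integral_linear[OF set_lebesgue_integral_eq_integral(1)[OF f] nth] absolutely_integrable_linear[OF f nth]
    by (simp add: o_def)
  let ?D = "\<lambda>x. \<bar>det (matrix (g' x))\<bar> *\<^sub>R H (g x)"
  have *: "?D absolutely_integrable_on S" "integral S ?D = integral (g ` S) H"
    using has_absolute_integral_change_of_variables[of S g g' H "integral (g ` S) H"] S inj H
      has_derivative_at_withinI[OF der] by auto
  have D: "?D x $ 1 = \<bar>det (matrix (g' x))\<bar> * h (g x)" "H x $ 1 = h x" for x
    by (simp_all add: H_def)
  have "(\<integral>\<^sup>+x\<in>S. ennreal (\<bar>det (matrix (g' x))\<bar> * h (g x)) \<partial>lborel)
      = ennreal (integral S (\<lambda>x. ?D x $ 1))"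
    using int[OF *(1)] h(2) unfolding D by (intro nn_integral_absolutely_integrable) auto
  also have "\<dots> = ennreal (integral (g ` S) (\<lambda>x. H x $ 1))"
    using int[OF *(1)] int[OF H] *(2) by simp
  also have "\<dots> = (\<integral>\<^sup>+y\<in>g ` S. ennreal (h y) \<partial>lborel)"
    unfolding D by (rule nn_integral_absolutely_integrable[symmetric]) (use h in auto)
  finally show ?thesis .
qed

lemma norm_cross_linear_comp:
  fixes L :: "real^2 \<Rightarrow> real^3" and T :: "real^2 \<Rightarrow> real^2"
  assumes "linear L" "linear T"
  shows "norm (cross3 (L (T (axis 1 1))) (L (T (axis 2 1))))
    = \<bar>det (matrix T)\<bar> * norm (cross3 (L (axis 1 1)) (L (axis 2 1)))"
proof -
  have exp: "L v = v $ 1 *\<^sub>R L (axis 1 1) + v $ 2 *\<^sub>R L (axis 2 1)" for v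
  proof -
    have "v = v $ 1 *\<^sub>R axis 1 1 + v $ 2 *\<^sub>R axis 2 1"
      by (simp add: vec_eq_iff forall_2 axis_def)
    then have "L v = L (v $ 1 *\<^sub>R axis 1 1 + v $ 2 *\<^sub>R axis 2 1)" by simp
    then show ?thesis using assms(1) by (simp add: linear_add linear_scale)
  qed
  have "cross3 (L (T (axis 1 1))) (L (T (axis 2 1))) = det (matrix T) *\<^sub>R cross3 (L (axis 1 1)) (L (axis 2 1))"
    unfolding exp[of "T _"] det_2 matrix_def
    by (simp add: cross3_def vec_eq_iff forall_3 algebra_simps)
  then show ?thesis by simp
qed

text \<open>Independence of the parametrization: since \<open>chart_inverse\<close> is differentiable in space, the transition
map from an arbitrary parametrization to the chart is differentiable, and the area densities differ by
its Jacobian determinant. The density of the parametrization may be unbounded; that its integral is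
finite is inherited from the chart.\<close>

lemma chart_change:
  assumes \<phi>: "local_parametrization (rev_surface R) U \<phi>" and A: "A \<in> sets borel" "A \<subseteq> \<phi> ` U \<inter> window R \<alpha> \<beta>"
  shows "(\<integral>\<^sup>+u\<in>{u\<in>U. \<phi> u \<in> A}. ennreal (area_density \<phi> u) \<partial>lborel)
    = (\<integral>\<^sup>+v\<in>{v\<in>chart_domain R \<alpha> \<beta>. chart R v \<in> A}. ennreal (R + cos (v $ 2)) \<partial>lborel)"
proof -
  let ?G = "chart_inverse R \<alpha> \<beta>" and ?V = "chart_domain R \<alpha> \<beta>"
  define S where "S = {u\<in>U. \<phi> u \<in> A}"
  define \<tau> where "\<tau> = ?G \<circ> \<phi>"
  have U: "open U" "smooth_on U \<phi>" using \<phi> by (auto simp: local_parametrization_def)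
  then have "higher_differentiable_on (Suc 0) U \<phi>" unfolding smooth_on_def by blast
  then have d: "\<phi> differentiable (at u)" if "u \<in> U" for u using that by simp
  then have c: "continuous_on U \<phi>"
    by (meson continuous_at_imp_continuous_on differentiable_imp_continuous_within)
  have M: "\<phi> u \<in> rev_surface R" if "u \<in> U" for u
    using \<phi> that by (auto simp: local_parametrization_def openin_open)
  have W: "open (U \<inter> \<phi> -` window R \<alpha> \<beta>)"
    using continuous_open_preimage[OF c U(1) open_window] .
  have SW: "u \<in> U" "\<phi> u \<in> window R \<alpha> \<beta>" if "u \<in> S" for u using that A(2) by (auto simp: S_def)
  have ch: "chart R (\<tau> u) = \<phi> u" "\<tau> u \<in> ?V" if "u \<in> U" "\<phi> u \<in> window R \<alpha> \<beta>" for u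
    using chart_chart_inverse[OF M] that by (auto simp: \<tau>_def)
  have inj\<phi>: "inj_on \<phi> U"
    using \<phi> by (auto simp: local_parametrization_def homeomorphism_def intro: inj_on_inverseI)
  have inj: "inj_on \<tau> S"
    by (rule inj_onI) (metis SW ch(1) inj\<phi> inj_onD)
  have im: "\<tau> ` S = {v\<in>?V. chart R v \<in> A}"
  proof (intro equalityI subsetI)
    fix v assume "v \<in> \<tau> ` S"
    then obtain u where u: "u \<in> S" "v = \<tau> u" by blast
    then show "v \<in> {v\<in>?V. chart R v \<in> A}" using ch[OF SW[OF u(1)]] by (simp add: S_def)
  next
    fix v assume v: "v \<in> {v\<in>?V. chart R v \<in> A}"
    then obtain u where u: "u \<in> U" "\<phi> u = chart R v" using A(2) by (auto simp: image_iff)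
    then have "\<tau> u = v" using v by (simp add: \<tau>_def chart_in_surface(3))
    moreover have "u \<in> S" using u v by (simp add: S_def)
    ultimately show "v \<in> \<tau> ` S" by blast
  qed
  have S: "S \<in> sets borel" using local_parametrization_area_measurable(2)[OF \<phi> A(1)] by (simp add: S_def)
  define \<tau>' where "\<tau>' u = frechet_derivative \<tau> (at u)" for u
  have der: "(\<tau> has_derivative \<tau>' u) (at u)" if "u \<in> S" for u
    unfolding \<tau>'_def \<tau>_def using d SW[OF that] chart_inverse_differentiable
    by (intro iffD1[OF frechet_derivative_works] differentiable_chain_at) auto
  have dens: "area_density \<phi> u = \<bar>det (matrix (\<tau>' u))\<bar> * (R + cos (\<tau> u $ 2))" if u: "u \<in> S" for u
  proof -
    obtain L where L: "(chart R has_derivative L) (at (\<tau> u))" using has_derivative_chart by blast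
    have "((chart R \<circ> \<tau>) has_derivative L \<circ> \<tau>' u) (at u)" by (rule diff_chain_at[OF der[OF u] L])
    then have "(\<phi> has_derivative L \<circ> \<tau>' u) (at u)"
      by (rule has_derivative_transform_within_open[OF _ W]) (use SW[OF u] ch in auto)
    from frechet_derivative_at[OF this] have f: "frechet_derivative \<phi> (at u) = L \<circ> \<tau>' u" ..
    have "area_density \<phi> u = \<bar>det (matrix (\<tau>' u))\<bar> * norm (cross3 (L (axis 1 1)) (L (axis 2 1)))"
      unfolding area_density_def f comp_apply
      by (rule norm_cross_linear_comp[OF has_derivative_linear[OF L] has_derivative_linear[OF der[OF u]]])
    also have "norm (cross3 (L (axis 1 1)) (L (axis 2 1))) = area_density (chart R) (\<tau> u)"
      unfolding area_density_def frechet_derivative_at[OF L, symmetric] ..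
    also have "\<dots> = R + cos (\<tau> u $ 2)"
      using ch(2)[OF SW[OF u]] by (intro area_density_chart) (simp add: chart_domain_def)
    finally show ?thesis .
  qed
  have Vm: "\<tau> ` S \<in> sets borel"
    unfolding im using local_parametrization_area_measurable(2)[OF local_parametrization_chart A(1)] .
  have "(\<lambda>v. R + cos (v $ 2)) absolutely_integrable_on (\<tau> ` S)"
  proof (rule set_integrable_subset)
    let ?B = "cbox (vector [\<alpha> - pi, \<beta> - pi]) (vector [\<alpha> + pi, \<beta> + pi]) :: (real^2) set"
    show "(\<lambda>v. R + cos (v $ 2)) absolutely_integrable_on ?B"
      by (intro absolutely_integrable_continuous continuous_intros)
    show "\<tau> ` S \<subseteq> ?B"
      unfolding im by (auto simp: chart_domain_def mem_box_cart forall_2 abs_less_iff)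
  qed (use Vm in auto)
  then have "(\<integral>\<^sup>+u\<in>S. ennreal (\<bar>det (matrix (\<tau>' u))\<bar> * (R + cos (\<tau> u $ 2))) \<partial>lborel)
     = (\<integral>\<^sup>+v\<in>\<tau> ` S. ennreal (R + cos (v $ 2)) \<partial>lborel)"
    by (intro nn_integral_change_of_variables S der inj) (auto simp: im chart_domain_def)
  moreover have "(\<integral>\<^sup>+u\<in>S. ennreal (area_density \<phi> u) \<partial>lborel)
     = (\<integral>\<^sup>+u\<in>S. ennreal (\<bar>det (matrix (\<tau>' u))\<bar> * (R + cos (\<tau> u $ 2))) \<partial>lborel)"
    by (intro nn_integral_cong) (auto simp: dens split: split_indicator)
  ultimately show ?thesis by (simp add: im flip: S_def)
qed

definition rev_area :: "real \<Rightarrow> (real^3) measure" where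
  "rev_area R = distr (density lborel (\<lambda>u. ennreal (R + cos (u $ 2)) * indicator (chart_domain R 0 0) u)) borel (chart R)"

lemma borel_measurable_chart [measurable]: "chart R \<in> borel_measurable borel"
  by (rule borel_measurable_continuous_onI[OF has_derivative_continuous_on[OF
          has_derivative_at_withinI[OF has_derivative_chart]]])

lemma borel_chart_domain [measurable]: "chart_domain R \<alpha> \<beta> \<in> sets borel"
  by (rule borel_open[OF open_chart_domain])

lemma emeasure_rev_area:
  assumes "A \<in> sets borel"
  shows "emeasure (rev_area R) A = (\<integral>\<^sup>+u\<in>{u\<in>chart_domain R 0 0. chart R u \<in> A}. ennreal (R + cos (u $ 2)) \<partial>lborel)"
proof -
  have [measurable]: "A \<in> sets borel" "chart R -` A \<in> sets borel"
    using assms measurable_sets_borel[OF borel_measurable_chart assms] by simp_all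
  have "emeasure (rev_area R) A = (\<integral>\<^sup>+u. ennreal (R + cos (u $ 2)) * indicator (chart_domain R 0 0) u * indicator (chart R -` A) u \<partial>lborel)"
    unfolding rev_area_def by (subst emeasure_distr; simp) (subst emeasure_density; simp)
  also have "\<dots> = (\<integral>\<^sup>+u\<in>{u\<in>chart_domain R 0 0. chart R u \<in> A}. ennreal (R + cos (u $ 2)) \<partial>lborel)"
    by (intro nn_integral_cong) (auto split: split_indicator)
  finally show ?thesis .
qed

lemma slit_plane_cases: "w \<noteq> 0 \<Longrightarrow> w \<in> slit_plane 0 \<or> w \<in> slit_plane pi"
  by (auto simp: slit_plane_def complex_nonpos_Reals_iff complex_eq_iff)

lemma slit_plane_pi_0:
  assumes "r > 0" "\<bar>a - pi\<bar> < pi" "a \<noteq> pi"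
  shows "of_real r * cis a \<in> slit_plane 0"
proof (cases "a < pi")
  case True
  then show ?thesis using assms by (intro angle_of_polar) auto
next
  case False
  then have "of_real r * cis (a - 2 * pi) \<in> slit_plane 0"
    using assms by (intro angle_of_polar) auto
  moreover have "cis (a - 2 * pi) = cis a" by (simp add: complex_eq_iff cos_diff sin_diff)
  ultimately show ?thesis by simp
qed

text \<open>The area measure is the push-forward under a single chart. What this chart omits is null for every
  parametrization: it consists of at most two poles on the axis and of points that a chart rotated by
  \<open>\<pi>\<close> sees on the lines where a coordinate equals \<open>\<pi>\<close>.\<close>

lemma is_area_measure_rev_area: "is_area_measure (rev_surface R) (rev_area R)"
  unfolding is_area_measure_def
proof (intro conjI allI impI ballI)
  have clM: "closed (rev_surface R)" using compact_rev_surface compact_imp_closed by blast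
  show "sets (rev_area R) = sets borel" by (simp add: rev_area_def)
  have "{u\<in>chart_domain R 0 0. chart R u \<in> - rev_surface R} = {}" using chart_in_surface by auto
  then show "emeasure (rev_area R) (- rev_surface R) = 0"
    using clM by (subst emeasure_rev_area) auto
  fix U \<phi> A
  assume \<phi>: "local_parametrization (rev_surface R) U \<phi>" and A: "A \<in> sets borel" "A \<subseteq> \<phi> ` U"
  define \<nu> where "\<nu> = density lborel (\<lambda>u. ennreal (area_density \<phi> u) * indicator U u)"
  have meas: "{u\<in>U. \<phi> u \<in> B} \<in> sets borel" if "B \<in> sets borel" for B
    using local_parametrization_area_measurable(2)[OF \<phi> that] .
  have \<nu>: "emeasure \<nu> {u\<in>U. \<phi> u \<in> B} = (\<integral>\<^sup>+u\<in>{u\<in>U. \<phi> u \<in> B}. ennreal (area_density \<phi> u) \<partial>lborel)"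
    if "B \<in> sets borel" for B
  proof -
    have "emeasure \<nu> {u\<in>U. \<phi> u \<in> B}
      = (\<integral>\<^sup>+u. ennreal (area_density \<phi> u) * indicator U u * indicator {u\<in>U. \<phi> u \<in> B} u \<partial>lborel)"
      unfolding \<nu>_def using local_parametrization_area_measurable(1)[OF \<phi>] meas[OF that]
      by (intro emeasure_density) auto
    also have "\<dots> = (\<integral>\<^sup>+u\<in>{u\<in>U. \<phi> u \<in> B}. ennreal (area_density \<phi> u) \<partial>lborel)"
      by (intro nn_integral_cong) (auto split: split_indicator)
    finally show ?thesis .
  qed
  have s\<nu>: "sets \<nu> = sets borel" by (simp add: \<nu>_def)
  let ?W = "window R 0 0" and ?P = "{x \<in> rev_surface R. axial x = 0}"
  have bW: "window R \<alpha> \<beta> \<in> sets borel" for \<alpha> \<beta> by (rule borel_open[OF open_window])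
  have sub: "\<phi> u \<in> rev_surface R" if "u \<in> U" for u
    using \<phi> that by (auto simp: local_parametrization_def openin_open)
  have inj\<phi>: "inj_on \<phi> U"
    using \<phi> by (auto simp: local_parametrization_def homeomorphism_def intro: inj_on_inverseI)
  have "?P \<subseteq> {vector [0, 0, sqrt (1 - R\<^sup>2)], vector [0, 0, - sqrt (1 - R\<^sup>2)]}"
  proof
    fix x assume "x \<in> ?P"
    then have a: "axial x = 0" and n: "cmod (meridional R x) = 1" by (auto simp: rev_surface_def)
    have x: "x $ 1 = 0" "x $ 2 = 0" using a Re_Im_axial[of x] by simp_all
    have "meridional R x = Complex (- R) (x $ 3)"
      using a by (simp add: meridional_def complex_eq_iff)
    then have "1 - R\<^sup>2 = (x $ 3)\<^sup>2" using n by (simp add: cmod_def)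
    then have "sqrt (1 - R\<^sup>2) = \<bar>x $ 3\<bar>" by simp
    then have "x $ 3 = sqrt (1 - R\<^sup>2) \<or> x $ 3 = - sqrt (1 - R\<^sup>2)" by linarith
    then show "x \<in> {vector [0, 0, sqrt (1 - R\<^sup>2)], vector [0, 0, - sqrt (1 - R\<^sup>2)]}"
      using x by (auto simp: vec_eq_iff forall_3)
  qed
  then have finP: "finite ?P" using finite_subset by blast
  have "finite {u\<in>U. \<phi> u \<in> ?P}"
    using finite_vimage_IntI[OF finP inj\<phi>] by (auto elim: rev_finite_subset)
  then have "{u\<in>U. \<phi> u \<in> ?P} \<in> null_sets lborel" by (rule finite_imp_null_set_lborel)
  moreover have "absolutely_continuous lborel \<nu>"
    unfolding \<nu>_def using local_parametrization_area_measurable(1)[OF \<phi>]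
    by (intro absolutely_continuousI_density) simp
  ultimately have nP: "{u\<in>U. \<phi> u \<in> ?P} \<in> null_sets \<nu>" by (auto simp: absolutely_continuous_def)
  \<comment> \<open>What the main chart omits, as seen by the rotated charts.\<close>
  let ?N = "\<lambda>\<alpha> \<beta>. A \<inter> window R \<alpha> \<beta> - ?W"
  have nN: "{u\<in>U. \<phi> u \<in> ?N \<alpha> \<beta>} \<in> null_sets \<nu>" if \<alpha>\<beta>: "\<alpha> \<in> {0, pi}" "\<beta> \<in> {0, pi}" for \<alpha> \<beta>
  proof (rule null_setsI)
    have B: "?N \<alpha> \<beta> \<in> sets borel" using A(1) bW by auto
    then show "{u\<in>U. \<phi> u \<in> ?N \<alpha> \<beta>} \<in> sets \<nu>" unfolding s\<nu> by (rule meas)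
    have "emeasure \<nu> {u\<in>U. \<phi> u \<in> ?N \<alpha> \<beta>}
       = (\<integral>\<^sup>+v\<in>{v\<in>chart_domain R \<alpha> \<beta>. chart R v \<in> ?N \<alpha> \<beta>}. ennreal (R + cos (v $ 2)) \<partial>lborel)"
      unfolding \<nu>[OF B] using A(2) by (intro chart_change[OF \<phi> B]) auto
    also have "\<dots> = (\<integral>\<^sup>+v. 0 \<partial>(lborel :: (real^2) measure))"
    proof (rule nn_integral_cong_AE)
      have "AE v::real^2 in lborel. v \<bullet> axis 1 1 \<noteq> pi" "AE v::real^2 in lborel. v \<bullet> axis 2 1 \<noteq> pi"
        by (intro AE_lborel_inner_neq; simp add: axis_in_Basis_iff)+
      then have "AE v::real^2 in lborel. v $ 1 \<noteq> pi \<and> v $ 2 \<noteq> pi"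
        by eventually_elim (simp add: inner_axis)
      then show "AE v in lborel. ennreal (R + cos (v $ 2)) *
           indicator {v\<in>chart_domain R \<alpha> \<beta>. chart R v \<in> ?N \<alpha> \<beta>} v = 0"
      proof eventually_elim
        case (elim v)
        have "v \<notin> {v\<in>chart_domain R \<alpha> \<beta>. chart R v \<in> ?N \<alpha> \<beta>}"
        proof
          assume v: "v \<in> {v\<in>chart_domain R \<alpha> \<beta>. chart R v \<in> ?N \<alpha> \<beta>}"
          then have d: "R + cos (v $ 2) > 0" "\<bar>v $ 1 - \<alpha>\<bar> < pi" "\<bar>v $ 2 - \<beta>\<bar> < pi"
            by (auto simp: chart_domain_def)
          have "of_real (R + cos (v $ 2)) * cis (v $ 1) \<in> slit_plane 0"
            using slit_plane_pi_0[OF d(1)] angle_of_polar(2)[OF d(1)] d(2) elim \<alpha>\<beta> by auto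
          moreover have "of_real 1 * cis (v $ 2) \<in> slit_plane 0"
            using slit_plane_pi_0[OF zero_less_one] angle_of_polar(2)[OF zero_less_one] d(3) elim \<alpha>\<beta> by blast
          ultimately have "chart R v \<in> ?W"
            unfolding window_def by (simp add: axial_chart meridional_chart[OF d(1)])
          then show False using v by simp
        qed
        then show ?case by simp
      qed
    qed
    finally show "emeasure \<nu> {u\<in>U. \<phi> u \<in> ?N \<alpha> \<beta>} = 0" by simp
  qed
  have A0: "A \<inter> ?W \<in> sets borel" "A - ?W \<in> sets borel" using A(1) bW by auto
  have "{u\<in>U. \<phi> u \<in> A - ?W} \<in> null_sets \<nu>"
  proof (rule null_sets_subset)
    show "{u\<in>U. \<phi> u \<in> ?P} \<union> ({u\<in>U. \<phi> u \<in> ?N 0 0} \<union> {u\<in>U. \<phi> u \<in> ?N 0 pi} \<union> {u\<in>U. \<phi> u \<in> ?N pi 0}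
        \<union> {u\<in>U. \<phi> u \<in> ?N pi pi}) \<in> null_sets \<nu>"
      by (intro null_sets.Un nP nN) auto
    show "{u\<in>U. \<phi> u \<in> A - ?W} \<in> sets \<nu>" unfolding s\<nu> by (rule meas[OF A0(2)])
    have *: "\<phi> u \<in> ?P \<or> (\<exists>\<alpha>\<in>{0,pi}. \<exists>\<beta>\<in>{0,pi}. \<phi> u \<in> window R \<alpha> \<beta>)" if "u \<in> U" for u
    proof -
      have "meridional R (\<phi> u) \<noteq> 0" using sub[OF that] by (auto simp: rev_surface_def)
      then show ?thesis using slit_plane_cases[of "axial (\<phi> u)"] slit_plane_cases[of "meridional R (\<phi> u)"] sub[OF that]
        by (auto simp: window_def)
    qed
    show "{u\<in>U. \<phi> u \<in> A - ?W} \<subseteq> {u\<in>U. \<phi> u \<in> ?P} \<union> ({u\<in>U. \<phi> u \<in> ?N 0 0} \<union> {u\<in>U. \<phi> u \<in> ?N 0 pi} \<union> {u\<in>U. \<phi> u \<in> ?N pi 0}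
        \<union> {u\<in>U. \<phi> u \<in> ?N pi pi})"
      using * by blast
  qed
  then have "emeasure \<nu> ({u\<in>U. \<phi> u \<in> A \<inter> ?W} \<union> {u\<in>U. \<phi> u \<in> A - ?W}) = emeasure \<nu> {u\<in>U. \<phi> u \<in> A \<inter> ?W}"
    using meas[OF A0(1)] s\<nu> by (intro emeasure_Un_null_set) auto
  moreover have "{u\<in>U. \<phi> u \<in> A \<inter> ?W} \<union> {u\<in>U. \<phi> u \<in> A - ?W} = {u\<in>U. \<phi> u \<in> A}" by auto
  ultimately have "emeasure \<nu> {u\<in>U. \<phi> u \<in> A} = emeasure \<nu> {u\<in>U. \<phi> u \<in> A \<inter> ?W}" by simp
  also have "\<dots> = (\<integral>\<^sup>+v\<in>{v\<in>chart_domain R 0 0. chart R v \<in> A \<inter> ?W}. ennreal (R + cos (v $ 2)) \<partial>lborel)"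
    unfolding \<nu>[OF A0(1)] using A(2) by (intro chart_change[OF \<phi> A0(1)]) auto
  also have "{v\<in>chart_domain R 0 0. chart R v \<in> A \<inter> ?W} = {v\<in>chart_domain R 0 0. chart R v \<in> A}"
    using chart_in_surface(2) by auto
  also have "(\<integral>\<^sup>+v\<in>\<dots>. ennreal (R + cos (v $ 2)) \<partial>lborel) = emeasure (rev_area R) A"
    using emeasure_rev_area[OF A(1)] by simp
  finally show "emeasure (rev_area R) A = (\<integral>\<^sup>+u\<in>{u\<in>U. \<phi> u \<in> A}. ennreal (area_density \<phi> u) \<partial>lborel)"
    using \<nu>[OF A(1)] by simp
qed

section \<open>The energy in terms of the distance distribution\<close>

text \<open>The area measure as a definite description is inconvenient; here it is a parameter, and its defining
property is an assumption.\<close>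

locale measured_surface =
  fixes M :: "(real^3) set" and \<mu> :: "(real^3) measure"
  assumes closed_surface: "closed_surface M" and area: "is_area_measure M \<mu>" and finite: "finite_measure \<mu>"
begin

sublocale finite_measure \<mu> by (rule finite)

sublocale pair: pair_sigma_finite \<mu> \<mu> ..

lemma area_measure: "area_measure M = \<mu>"
  using closed_surface area by (rule area_measure_eq)

lemma compact: "compact M" using closed_surface by (simp add: closed_surface_def)

lemma M_borel [measurable]: "M \<in> sets borel"
  using compact by (intro borel_closed compact_imp_closed)

lemma sets_\<mu> [measurable_cong]: "sets \<mu> = sets borel"
  using area by (simp add: is_area_measure_def)

lemma space_\<mu>: "space \<mu> = UNIV"
  using sets_eq_imp_space_eq[OF sets_\<mu>] by simp

lemma M_sets [measurable]: "M \<in> sets \<mu>" using M_borel sets_\<mu> by simp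

lemma finite_pair: "finite_measure (\<mu> \<Otimes>\<^sub>M \<mu>)"
proof
  show "emeasure (\<mu> \<Otimes>\<^sub>M \<mu>) (space (\<mu> \<Otimes>\<^sub>M \<mu>)) \<noteq> \<infinity>"
    using emeasure_pair_measure_Times[of "space \<mu>" \<mu> "space \<mu>"]
    by (simp add: space_pair_measure ennreal_mult_eq_top_iff)
qed

text \<open>The distribution of the distance of two points. Its distribution function is \<open>\<psi>\<close>, and the truncated
energy is a tail integral of \<open>t\<^sup>z\<close> with respect to it.\<close>

definition dist_measure :: "real measure" where
  "dist_measure = distr (density (\<mu> \<Otimes>\<^sub>M \<mu>) (indicator (M \<times> M))) borel (\<lambda>(x, y). dist x y)"

lemma sets_dist_measure [simp]: "sets dist_measure = sets borel" "space dist_measure = UNIV"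
  by (simp_all add: dist_measure_def)

lemma emeasure_dist_measure:
  assumes [measurable]: "A \<in> sets borel"
  shows "emeasure dist_measure A = emeasure (\<mu> \<Otimes>\<^sub>M \<mu>) {(x, y). x \<in> M \<and> y \<in> M \<and> dist x y \<in> A}"
proof -
  have eq: "{(x, y). x \<in> M \<and> y \<in> M \<and> dist x y \<in> A} = (M \<times> M) \<inter> ((\<lambda>(x, y). dist x y) -` A \<inter> space (\<mu> \<Otimes>\<^sub>M \<mu>))"
    by (auto simp: space_pair_measure space_\<mu>)
  have m: "(\<lambda>(x, y). dist x y) -` A \<inter> space (\<mu> \<Otimes>\<^sub>M \<mu>) \<in> sets (\<mu> \<Otimes>\<^sub>M \<mu>)" by measurable
  have "emeasure dist_measure A
    = emeasure (density (\<mu> \<Otimes>\<^sub>M \<mu>) (indicator (M \<times> M))) ((\<lambda>(x, y). dist x y) -` A \<inter> space (\<mu> \<Otimes>\<^sub>M \<mu>))"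
    unfolding dist_measure_def by (subst emeasure_distr) auto
  also have "\<dots> = emeasure (\<mu> \<Otimes>\<^sub>M \<mu>) ((M \<times> M) \<inter> ((\<lambda>(x, y). dist x y) -` A \<inter> space (\<mu> \<Otimes>\<^sub>M \<mu>)))"
    using m by (intro emeasure_restricted) auto
  finally show ?thesis unfolding eq .
qed

lemma finite_dist_measure: "finite_measure dist_measure"
proof
  interpret p: finite_measure "\<mu> \<Otimes>\<^sub>M \<mu>" by (rule finite_pair)
  show "emeasure dist_measure (space dist_measure) \<noteq> \<infinity>"
    using p.emeasure_finite by (simp add: emeasure_dist_measure)
qed

lemma \<psi>_dist_measure: "\<psi> M t = measure dist_measure {..t}"
  unfolding \<psi>_def area_measure measure_def by (simp add: emeasure_dist_measure)

lemma dist_measure_bounded: obtains B where "emeasure dist_measure {B<..} = 0" "B > 0"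
proof -
  obtain B where B: "\<And>x. x \<in> M \<Longrightarrow> norm x \<le> B" "B > 0"
    using compact_imp_bounded[OF compact] bounded_pos by blast
  have "dist x y \<le> 2 * B" if "x \<in> M" "y \<in> M" for x y
    using norm_triangle_ineq4[of x y] B(1)[OF that(1)] B(1)[OF that(2)] by (simp add: dist_norm)
  then have "{(x, y). x \<in> M \<and> y \<in> M \<and> dist x y \<in> {2 * B<..}} = {}" by force
  then have "emeasure dist_measure {2 * B<..} = 0" by (simp only: emeasure_dist_measure[OF borel_open[OF open_greaterThan]] emeasure_empty)
  then show thesis using B(2) that[of "2 * B"] by simp
qed

lemma powr_measurable [measurable]: "(\<lambda>t. complex_of_real t powr z) \<in> borel_measurable borel"
proof -
  have "(\<lambda>t. complex_of_real t powr z) = (\<lambda>t. if t = 0 then 0 else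
      if t < 0 then exp (z * (of_real (ln (- t)) + \<i> * of_real pi)) else exp (z * of_real (ln t)))"
    by (auto simp: powr_def Ln_of_real' fun_eq_iff algebra_simps)
  then show ?thesis by simp
qed

lemma truncated_energy_dist_measure:
  "truncated_energy M z \<epsilon> = (LINT t:{\<epsilon><..}|dist_measure. complex_of_real t powr z)"
proof -
  let ?d = "\<lambda>(x :: real^3, y). dist x y" and ?g = "\<lambda>t. indicator {\<epsilon><..} t *\<^sub>R (complex_of_real t powr z)"
  have "(LINT t:{\<epsilon><..}|dist_measure. complex_of_real t powr z)
      = (LINT p|density (\<mu> \<Otimes>\<^sub>M \<mu>) (indicator (M \<times> M)). ?g (?d p))"
    unfolding dist_measure_def set_lebesgue_integral_def by (subst integral_distr) auto
  also have "\<dots> = (LINT p|density (\<mu> \<Otimes>\<^sub>M \<mu>) (\<lambda>p. ennreal (indicator (M \<times> M) p)). ?g (?d p))"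
    by (simp only: ennreal_indicator)
  also have "\<dots> = (LINT p|(\<mu> \<Otimes>\<^sub>M \<mu>). indicator (M \<times> M) p *\<^sub>R ?g (?d p))"
    by (rule integral_density) auto
  also have "\<dots> = truncated_energy M z \<epsilon>"
    unfolding truncated_energy_def area_measure set_lebesgue_integral_def
    by (intro Bochner_Integration.integral_cong) (auto split: split_indicator)
  finally show ?thesis ..
qed

lemma norm_powr_bound:
  assumes "0 < \<epsilon>" "\<epsilon> \<le> t" "t \<le> B"
  shows "norm (complex_of_real t powr z) \<le> \<epsilon> powr Re z + B powr Re z"
proof -
  have "norm (complex_of_real t powr z) = t powr Re z"
    using assms by (simp add: norm_powr_real_powr)
  moreover have "t powr Re z \<le> B powr Re z" if "Re z \<ge> 0"
    using assms that by (intro powr_mono2) auto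
  moreover have "t powr Re z \<le> \<epsilon> powr Re z" if "Re z \<le> 0"
    using assms that by (intro powr_mono2') auto
  moreover have "\<epsilon> powr Re z \<ge> 0" "B powr Re z \<ge> 0" by auto
  ultimately show ?thesis by linarith
qed

lemma powr_integrable:
  assumes "\<epsilon> > 0"
  shows "set_integrable dist_measure {\<epsilon><..} (\<lambda>t. complex_of_real t powr z)"
proof -
  interpret d: finite_measure dist_measure by (rule finite_dist_measure)
  obtain B where B: "emeasure dist_measure {B<..} = 0" "B > 0" by (rule dist_measure_bounded)
  have "AE t in dist_measure. t \<notin> {B<..}"
    using B(1) by (intro AE_not_in) (auto simp: null_sets_def)
  then have ae: "AE t in dist_measure. norm (indicator {\<epsilon><..} t *\<^sub>R complex_of_real t powr z) \<le> \<epsilon> powr Re z + B powr Re z"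
  proof eventually_elim
    case (elim t)
    then show ?case using norm_powr_bound[of \<epsilon> t B z] assms by (auto split: split_indicator)
  qed
  show ?thesis unfolding set_integrable_def
    by (rule d.integrable_const_bound[OF ae]) (simp add: measurable_cong_sets[OF sets_dist_measure(1) refl])
qed

text \<open>Where \<open>\<psi>\<close> is continuously differentiable, the distance distribution has the density \<open>\<psi>'\<close>: both
measures agree on all half-lines.\<close>

lemma truncated_energy_split:
  assumes \<epsilon>: "0 < \<epsilon>" "\<epsilon> \<le> d"
    and D: "\<And>t. t \<in> {0..d} \<Longrightarrow> (\<psi> M has_real_derivative D t) (at t within {0..d})"
    and cont: "continuous_on {0..d} D" and nonneg: "\<And>t. t \<in> {0<..d} \<Longrightarrow> D t \<ge> 0"
  shows "truncated_energy M z \<epsilon>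
    = truncated_energy M z d + integral {\<epsilon>..d} (\<lambda>t. complex_of_real t powr z * of_real (D t))"
proof -
  interpret d: finite_measure dist_measure by (rule finite_dist_measure)
  have cD: "continuous_on {\<epsilon>..d} D" using cont \<epsilon> by (auto intro: continuous_on_subset)
  have FTC: "(\<integral>\<^sup>+t\<in>{a..d}. ennreal (D t) \<partial>lborel) = ennreal (\<psi> M d - \<psi> M a)" if "\<epsilon> \<le> a" "a \<le> d" for a
  proof -
    have "(D has_integral (\<psi> M d - \<psi> M a)) {a..d}"
      using that \<epsilon> by (intro fundamental_theorem_of_calculus)
        (auto intro!: DERIV_subset[OF D] simp flip: has_real_derivative_iff_has_vector_derivative)
    moreover have "D absolutely_integrable_on {a..d}"
      using that by (intro absolutely_integrable_continuous_real continuous_on_subset[OF cD]) auto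
    ultimately show ?thesis using nn_integral_absolutely_integrable[where h = D and S = "{a..d}"] nonneg that \<epsilon>
      by (auto simp: integral_unique)
  qed
  \<comment> \<open>The closed interval in the first measure and the half-open one in the second differ by a null set of the first.\<close>
  define \<kappa>\<^sub>1 where "\<kappa>\<^sub>1 = density lborel (\<lambda>t. ennreal (indicator {\<epsilon>..d} t * D t))"
  define \<kappa>\<^sub>2 where "\<kappa>\<^sub>2 = density dist_measure (\<lambda>t. ennreal (indicator {\<epsilon><..d} t))"
  have [measurable]: "(\<lambda>t. indicator {\<epsilon>..d} t * D t) \<in> borel_measurable borel"
    using borel_measurable_continuous_on_indicator[OF _ cD] by simp
  have nn: "indicator {\<epsilon>..d} t * D t \<ge> 0" for t using nonneg \<epsilon> by (auto split: split_indicator)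
  have \<psi>m: "emeasure dist_measure {a<..d} = ennreal (\<psi> M d - \<psi> M a)" if "a \<le> d" for a
  proof -
    have "measure dist_measure ({..d} - {..a}) = \<psi> M d - \<psi> M a"
      unfolding \<psi>_dist_measure using that by (intro d.finite_measure_Diff) auto
    moreover have "{..d} - {..a} = {a<..d}" by auto
    ultimately show ?thesis by (simp add: d.emeasure_eq_measure)
  qed
  have e: "emeasure \<kappa>\<^sub>1 {x<..} = ennreal (\<psi> M d - \<psi> M (max x \<epsilon>))" "emeasure \<kappa>\<^sub>2 {x<..} = ennreal (\<psi> M d - \<psi> M (max x \<epsilon>))"
    if "x \<le> d" for x
  proof -
    have "emeasure \<kappa>\<^sub>1 {x<..} = (\<integral>\<^sup>+t. ennreal (indicator {\<epsilon>..d} t * D t) * indicator {x<..} t \<partial>lborel)"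
      unfolding \<kappa>\<^sub>1_def by (subst emeasure_density) auto
    also have "\<dots> = (\<integral>\<^sup>+t\<in>{max x \<epsilon>..d}. ennreal (D t) \<partial>lborel)"
      by (intro nn_integral_cong_AE, use AE_lborel_singleton[of x] in eventually_elim)
        (auto split: split_indicator)
    finally show "emeasure \<kappa>\<^sub>1 {x<..} = ennreal (\<psi> M d - \<psi> M (max x \<epsilon>))"
      using FTC[of "max x \<epsilon>"] that \<epsilon> by simp
    have "emeasure \<kappa>\<^sub>2 {x<..} = emeasure dist_measure ({\<epsilon><..d} \<inter> {x<..})"
      unfolding \<kappa>\<^sub>2_def ennreal_indicator by (intro emeasure_restricted) auto
    also have "{\<epsilon><..d} \<inter> {x<..} = {max x \<epsilon><..d}" by auto
    finally show "emeasure \<kappa>\<^sub>2 {x<..} = ennreal (\<psi> M d - \<psi> M (max x \<epsilon>))"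
      using \<psi>m[of "max x \<epsilon>"] that \<epsilon> by simp
  qed
  have e0: "emeasure \<kappa>\<^sub>1 {x<..} = 0" "emeasure \<kappa>\<^sub>2 {x<..} = 0" if "\<not> x \<le> d" for x
  proof -
    have "emeasure \<kappa>\<^sub>1 {x<..} = (\<integral>\<^sup>+t. ennreal (indicator {\<epsilon>..d} t * D t) * indicator {x<..} t \<partial>lborel)"
      unfolding \<kappa>\<^sub>1_def by (subst emeasure_density) auto
    also have "\<dots> = (\<integral>\<^sup>+t. 0 \<partial>(lborel :: real measure))"
      using that by (intro nn_integral_cong) (auto split: split_indicator)
    finally show "emeasure \<kappa>\<^sub>1 {x<..} = 0" by simp
    have "emeasure \<kappa>\<^sub>2 {x<..} = emeasure dist_measure ({\<epsilon><..d} \<inter> {x<..})"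
      unfolding \<kappa>\<^sub>2_def ennreal_indicator by (intro emeasure_restricted) auto
    also have "{\<epsilon><..d} \<inter> {x<..} = {}" using that by auto
    finally show "emeasure \<kappa>\<^sub>2 {x<..} = 0" by simp
  qed
  have eq: "\<kappa>\<^sub>1 = \<kappa>\<^sub>2"
  proof (rule measure_eqI_lessThan)
    show "sets \<kappa>\<^sub>1 = sets borel" "sets \<kappa>\<^sub>2 = sets borel" by (simp_all add: \<kappa>\<^sub>1_def \<kappa>\<^sub>2_def)
    show "emeasure \<kappa>\<^sub>1 {x<..} < \<infinity>" "emeasure \<kappa>\<^sub>1 {x<..} = emeasure \<kappa>\<^sub>2 {x<..}" for x
      using e[of x] e0[of x] by (cases "x \<le> d"; simp)+
  qed
  let ?f = "\<lambda>t. complex_of_real t powr z"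
  have "(LINT t:{\<epsilon><..d}|dist_measure. ?f t) = integral\<^sup>L \<kappa>\<^sub>2 ?f"
    unfolding \<kappa>\<^sub>2_def set_lebesgue_integral_def
    by (subst integral_density) (auto simp: measurable_cong_sets[OF sets_dist_measure(1) refl])
  also have "\<dots> = (LINT t|lborel. (indicator {\<epsilon>..d} t * D t) *\<^sub>R ?f t)"
    unfolding eq[symmetric] \<kappa>\<^sub>1_def using nn by (subst integral_density) auto
  also have "\<dots> = (LINT t:{\<epsilon>..d}|lborel. ?f t * of_real (D t))"
    unfolding set_lebesgue_integral_def
    by (intro Bochner_Integration.integral_cong) (auto simp: scaleR_conv_of_real split: split_indicator)
  also have "\<dots> = integral {\<epsilon>..d} (\<lambda>t. ?f t * of_real (D t))"
  proof (rule set_borel_integral_eq_integral(2), rule borel_integrable_atLeastAtMost')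
    show "continuous_on {\<epsilon>..d} (\<lambda>t. ?f t * of_real (D t))"
      using \<epsilon> by (intro continuous_intros cD continuous_on_powr_complex) (auto simp: complex_nonpos_Reals_iff)
  qed
  finally have 1: "(LINT t:{\<epsilon><..d}|dist_measure. ?f t) = integral {\<epsilon>..d} (\<lambda>t. ?f t * of_real (D t))" .
  have "(LINT t:{\<epsilon><..d} \<union> {d<..}|dist_measure. ?f t)
    = (LINT t:{\<epsilon><..d}|dist_measure. ?f t) + (LINT t:{d<..}|dist_measure. ?f t)"
    using powr_integrable[of d z] \<epsilon>
    by (intro set_integral_Un set_integrable_subset[OF powr_integrable[OF \<epsilon>(1)]]) auto
  moreover have "{\<epsilon><..d} \<union> {d<..} = {\<epsilon><..}" using \<epsilon> by auto
  ultimately show ?thesis using 1 by (simp add: truncated_energy_dist_measure)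
qed

lemma null_complement: "- M \<in> null_sets \<mu>"
  using area M_sets space_\<mu> by (intro null_setsI) (auto simp: is_area_measure_def)

lemma dist_le_borel [measurable]:
  "M' \<in> sets borel \<Longrightarrow> {(x, y). x \<in> M' \<and> y \<in> M' \<and> dist x y \<le> t} \<in> sets (borel \<Otimes>\<^sub>M (borel :: (real^3) measure))"
proof -
  assume [measurable]: "M' \<in> sets borel"
  have "{p \<in> space (borel \<Otimes>\<^sub>M (borel :: (real^3) measure)). fst p \<in> M' \<and> snd p \<in> M' \<and> dist (fst p) (snd p) \<le> t}
      \<in> sets (borel \<Otimes>\<^sub>M borel)" by measurable
  then show ?thesis by (simp add: space_pair_measure case_prod_unfold)
qed

lemma emeasure_close_pairs:
  "emeasure (\<mu> \<Otimes>\<^sub>M \<mu>) {(x, y). x \<in> M \<and> y \<in> M \<and> dist x y \<le> t}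
    = (\<integral>\<^sup>+x. emeasure \<mu> {y. dist x y \<le> t} \<partial>\<mu>)"
proof -
  let ?A = "{(x, y). x \<in> M \<and> y \<in> M \<and> dist x y \<le> t}"
  have "emeasure (\<mu> \<Otimes>\<^sub>M \<mu>) ?A = (\<integral>\<^sup>+x. emeasure \<mu> (Pair x -` ?A) \<partial>\<mu>)"
    using dist_le_borel[OF M_borel] by (intro emeasure_pair_measure_alt) (simp cong: sets_pair_measure_cong)
  also have "\<dots> = (\<integral>\<^sup>+x. emeasure \<mu> {y. dist x y \<le> t} \<partial>\<mu>)"
  proof (rule nn_integral_cong_AE)
    have "AE x in \<mu>. x \<notin> - M" using null_complement by (rule AE_not_in)
    then show "AE x in \<mu>. emeasure \<mu> (Pair x -` ?A) = emeasure \<mu> {y. dist x y \<le> t}"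
    proof eventually_elim
      case (elim x)
      then have "Pair x -` ?A = {y. dist x y \<le> t} - (- M)" by auto
      then show ?case
        using emeasure_Diff_null_set[OF null_complement, of "{y. dist x y \<le> t}"] by (simp add: sets_\<mu>)
    qed
  qed
  finally show ?thesis .
qed

end

text \<open>Each counterterm is a primitive of \<open>t\<^sup>z t\<^sup>j\<^sup>-\<^sup>1\<close>, including the logarithmic case \<open>z + j = 0\<close>. This is what
makes it cancel a Taylor coefficient of \<open>\<psi>'\<close>.\<close>

lemma counterterm_derivative:
  assumes "t > 0"
  shows "(counterterm w has_vector_derivative complex_of_real t powr (w - 1)) (at t within S)"
proof (cases "w = 0")
  case True
  have "(ln has_real_derivative (1 / t)) (at t)" using assms by (auto intro!: derivative_eq_intros)
  then have "(ln has_vector_derivative (1 / t)) (at t within S)"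
    by (simp add: has_real_derivative_iff_has_vector_derivative has_vector_derivative_at_within)
  then have "((\<lambda>t. complex_of_real (ln t)) has_vector_derivative complex_of_real (1 / t)) (at t within S)"
    by (rule bounded_linear.has_vector_derivative[OF bounded_linear_of_real])
  moreover have "complex_of_real t powr (w - 1) = complex_of_real (1 / t)"
    using True assms by (simp add: powr_minus_divide)
  ultimately show ?thesis using True by (simp add: counterterm_def[abs_def])
next
  case False
  have "((\<lambda>x. x powr w / w) has_field_derivative (complex_of_real t powr (w - 1))) (at (of_real t))"
    using DERIV_cdivide[OF has_field_derivative_powr, of "of_real t" w w] assms False
    by (simp add: complex_nonpos_Reals_iff)
  from has_vector_derivative_real_field[OF this, of S] show ?thesis
    using False by (simp add: counterterm_def[abs_def])
qed

context measured_surface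
begin

text \<open>Subtracting the Taylor polynomial of \<open>\<psi>'\<close>, of which the counterterms take care, leaves the integral of
the remainder \<open>h\<close>; the existence of the finite part is reduced to its convergence at \<open>0\<close>.\<close>

lemma regularized_energy_tendsto:
  fixes D :: "nat \<Rightarrow> real \<Rightarrow> real"
  assumes k: "k \<ge> 1" and d: "d > 0"
    and D0: "\<And>t. t \<in> {0..d} \<Longrightarrow> D 0 t = \<psi> M t"
    and D: "\<And>j t. j < k \<Longrightarrow> t \<in> {0..d} \<Longrightarrow> (D j has_real_derivative D (Suc j) t) (at t within {0..d})"
    and cont: "continuous_on {0..d} (D 1)" and nonneg: "\<And>t. t \<in> {0<..d} \<Longrightarrow> D 1 t \<ge> 0"
    and h: "\<And>t. t \<in> {0..d} \<Longrightarrow> D 1 t = (\<Sum>j=1..k. D j 0 / fact (j - 1) * t ^ (j - 1)) + h t"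
    and L: "((\<lambda>\<epsilon>. integral {\<epsilon>..d} (\<lambda>t. complex_of_real t powr z * of_real (h t))) \<longlongrightarrow> L) (at_right 0)"
  shows "((\<lambda>\<epsilon>. truncated_energy M z \<epsilon> +
        (\<Sum>j=1..k. complex_of_real (D j 0 / fact (j - 1)) * counterterm (z + of_nat j) \<epsilon>)) \<longlongrightarrow>
      truncated_energy M z d + (\<Sum>j=1..k. complex_of_real (D j 0 / fact (j - 1)) * counterterm (z + of_nat j) d) + L)
    (at_right 0)"
proof -
  define c where "c j = D j 0 / fact (j - 1)" for j
  let ?f = "\<lambda>t. complex_of_real t powr z"
  have D\<psi>: "(\<psi> M has_real_derivative D 1 t) (at t within {0..d})" if "t \<in> {0..d}" for t
  proof -
    have "(D 0 has_real_derivative D 1 t) (at t within {0..d})" using D[of 0 t] k that by simp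
    then show ?thesis
      by (rule has_field_derivative_transform_within[OF _ zero_less_one that]) (rule D0)
  qed
  have conth: "continuous_on {0..d} h"
  proof -
    have "continuous_on {0..d} (\<lambda>t. D 1 t - (\<Sum>j=1..k. D j 0 / fact (j - 1) * t ^ (j - 1)))"
      by (intro continuous_intros cont)
    then show ?thesis by (rule continuous_on_eq) (use h in auto)
  qed
  have main: "truncated_energy M z \<epsilon> + (\<Sum>j=1..k. complex_of_real (c j) * counterterm (z + of_nat j) \<epsilon>)
    = truncated_energy M z d + (\<Sum>j=1..k. complex_of_real (c j) * counterterm (z + of_nat j) d)
      + integral {\<epsilon>..d} (\<lambda>t. ?f t * of_real (h t))" if \<epsilon>: "0 < \<epsilon>" "\<epsilon> < d" for \<epsilon>
  proof -
    have cf: "continuous_on {\<epsilon>..d} ?f"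
      using \<epsilon> by (intro continuous_intros continuous_on_powr_complex) (auto simp: complex_nonpos_Reals_iff)
    have hi: "((\<lambda>t. ?f t * of_real (h t)) has_integral integral {\<epsilon>..d} (\<lambda>t. ?f t * of_real (h t))) {\<epsilon>..d}"
      using \<epsilon> by (intro integrable_integral integrable_continuous_real continuous_intros cf
          continuous_on_subset[OF conth]) auto
    have ci: "((\<lambda>t. ?f t * complex_of_real t ^ (j - 1)) has_integral
        (counterterm (z + of_nat j) d - counterterm (z + of_nat j) \<epsilon>)) {\<epsilon>..d}" if j: "j \<in> {1..k}" for j
    proof (rule has_integral_eq[rotated])
      show "((\<lambda>t. complex_of_real t powr (z + of_nat j - 1)) has_integral
        (counterterm (z + of_nat j) d - counterterm (z + of_nat j) \<epsilon>)) {\<epsilon>..d}"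
        using \<epsilon> by (intro fundamental_theorem_of_calculus counterterm_derivative) auto
      fix t assume "t \<in> {\<epsilon>..d}"
      then have "t \<noteq> 0" using \<epsilon> by auto
      obtain i where i: "j = Suc i" using j by (cases j) auto
      have "z + of_nat j - 1 = z + of_nat i" unfolding i by simp
      moreover have "complex_of_real t powr (z + of_nat i) = ?f t * complex_of_real t ^ i"
        using \<open>t \<noteq> 0\<close> by (simp add: powr_add powr_nat')
      ultimately show "complex_of_real t powr (z + of_nat j - 1) = ?f t * complex_of_real t ^ (j - 1)"
        by (simp add: i)
    qed
    have "((\<lambda>t. (\<Sum>j=1..k. complex_of_real (c j) * (?f t * complex_of_real t ^ (j - 1))) + ?f t * of_real (h t))
       has_integral ((\<Sum>j=1..k. complex_of_real (c j) * (counterterm (z + of_nat j) d - counterterm (z + of_nat j) \<epsilon>))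
         + integral {\<epsilon>..d} (\<lambda>t. ?f t * of_real (h t)))) {\<epsilon>..d}"
      by (intro has_integral_add has_integral_sum has_integral_mult_right ci hi) auto
    then have "((\<lambda>t. ?f t * of_real (D 1 t)) has_integral
       ((\<Sum>j=1..k. complex_of_real (c j) * (counterterm (z + of_nat j) d - counterterm (z + of_nat j) \<epsilon>))
         + integral {\<epsilon>..d} (\<lambda>t. ?f t * of_real (h t)))) {\<epsilon>..d}"
    proof (rule has_integral_eq[rotated])
      fix t assume "t \<in> {\<epsilon>..d}"
      then have "D 1 t = (\<Sum>j=1..k. c j * t ^ (j - 1)) + h t" unfolding c_def using h \<epsilon> by auto
      then show "(\<Sum>j=1..k. complex_of_real (c j) * (?f t * complex_of_real t ^ (j - 1))) + ?f t * of_real (h t)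
         = ?f t * of_real (D 1 t)"
        by (simp add: algebra_simps sum_distrib_left)
    qed
    then have "integral {\<epsilon>..d} (\<lambda>t. ?f t * of_real (D 1 t)) =
       (\<Sum>j=1..k. complex_of_real (c j) * (counterterm (z + of_nat j) d - counterterm (z + of_nat j) \<epsilon>))
         + integral {\<epsilon>..d} (\<lambda>t. ?f t * of_real (h t))" by (rule integral_unique)
    then show ?thesis
      using truncated_energy_split[OF \<epsilon>(1) less_imp_le[OF \<epsilon>(2)] D\<psi> cont nonneg, of z]
      by (simp add: algebra_simps sum_subtractf)
  qed
  have "((\<lambda>\<epsilon>. truncated_energy M z d + (\<Sum>j=1..k. complex_of_real (c j) * counterterm (z + of_nat j) d)
      + integral {\<epsilon>..d} (\<lambda>t. ?f t * of_real (h t))) \<longlongrightarrow>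
      truncated_energy M z d + (\<Sum>j=1..k. complex_of_real (c j) * counterterm (z + of_nat j) d) + L) (at_right 0)"
    by (intro tendsto_intros L)
  moreover have "\<forall>\<^sub>F \<epsilon> in at_right 0. truncated_energy M z d + (\<Sum>j=1..k. complex_of_real (c j) * counterterm (z + of_nat j) d)
      + integral {\<epsilon>..d} (\<lambda>t. ?f t * of_real (h t))
    = truncated_energy M z \<epsilon> + (\<Sum>j=1..k. complex_of_real (c j) * counterterm (z + of_nat j) \<epsilon>)"
    unfolding eventually_at_right_field using main[symmetric] d by blast
  ultimately have "((\<lambda>\<epsilon>. truncated_energy M z \<epsilon> + (\<Sum>j=1..k. complex_of_real (c j) * counterterm (z + of_nat j) \<epsilon>))
     \<longlongrightarrow> truncated_energy M z d + (\<Sum>j=1..k. complex_of_real (c j) * counterterm (z + of_nat j) d) + L) (at_right 0)"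
    by (rule Lim_transform_eventually)
  then show ?thesis by (simp only: c_def)
qed

section \<open>Scaling\<close>

abbreviation "scaled_measure c \<equiv> density (distr \<mu> borel (\<lambda>x. c *\<^sub>R x)) (\<lambda>_. ennreal (c\<^sup>2))"

lemma measured_surface_scaled:
  assumes c: "c > 0"
  shows "measured_surface ((\<lambda>x. c *\<^sub>R x) ` M) (scaled_measure c)"
proof -
  interpret f: linear_similarity "\<lambda>x. c *\<^sub>R x" c by (rule linear_similarity_scaling[OF c])
  have "emeasure (scaled_measure c) (space (scaled_measure c)) = ennreal (c\<^sup>2) * emeasure \<mu> (space \<mu>)"
    by (simp add: emeasure_density_const emeasure_distr space_\<mu>)
  then have "finite_measure (scaled_measure c)"
    by (intro finite_measureI) (simp add: ennreal_mult_eq_top_iff)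
  then show ?thesis
    by (intro measured_surface.intro f.closed_surface[OF closed_surface] f.area_measure[OF area])
qed

lemma pair_scaled_measure:
  "scaled_measure c \<Otimes>\<^sub>M scaled_measure c =
     density (distr (\<mu> \<Otimes>\<^sub>M \<mu>) (borel \<Otimes>\<^sub>M borel) (\<lambda>(x, y). (c *\<^sub>R x, c *\<^sub>R y))) (\<lambda>_. ennreal (c ^ 4))"
proof -
  have fd: "finite_measure (distr \<mu> borel (\<lambda>x. c *\<^sub>R x))" by (rule finite_measure_distr) simp
  have "emeasure (scaled_measure c) (space (scaled_measure c)) = ennreal (c\<^sup>2) * emeasure \<mu> (space \<mu>)"
    by (simp add: emeasure_density_const emeasure_distr space_\<mu>)
  then have "finite_measure (scaled_measure c)"
    by (intro finite_measureI) (simp add: ennreal_mult_eq_top_iff)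
  then have "scaled_measure c \<Otimes>\<^sub>M scaled_measure c = density (distr \<mu> borel (\<lambda>x. c *\<^sub>R x) \<Otimes>\<^sub>M distr \<mu> borel (\<lambda>x. c *\<^sub>R x))
      (\<lambda>(x, y). ennreal (c\<^sup>2) * ennreal (c\<^sup>2))"
    using fd by (intro pair_measure_density) (auto simp: finite_measure_def)
  also have "distr \<mu> borel (\<lambda>x. c *\<^sub>R x) \<Otimes>\<^sub>M distr \<mu> borel (\<lambda>x. c *\<^sub>R x)
     = distr (\<mu> \<Otimes>\<^sub>M \<mu>) (borel \<Otimes>\<^sub>M borel) (\<lambda>(x, y). (c *\<^sub>R x, c *\<^sub>R y))"
    using fd by (intro pair_measure_distr) (auto simp: finite_measure_def)
  finally show ?thesis by (simp add: ennreal_mult''[symmetric] split_def flip: power_add)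
qed

lemma dist_gt_borel [measurable]:
  "M' \<in> sets borel \<Longrightarrow> {(x, y). x \<in> M' \<and> y \<in> M' \<and> dist x y > t} \<in> sets (borel \<Otimes>\<^sub>M (borel :: (real^3) measure))"
proof -
  assume [measurable]: "M' \<in> sets borel"
  have "{p \<in> space (borel \<Otimes>\<^sub>M (borel :: (real^3) measure)). fst p \<in> M' \<and> snd p \<in> M' \<and> dist (fst p) (snd p) > t}
      \<in> sets (borel \<Otimes>\<^sub>M borel)" by measurable
  then show ?thesis by (simp add: space_pair_measure case_prod_unfold)
qed

lemma \<psi>_scaled:
  assumes c: "c > 0"
  shows "\<psi> ((\<lambda>x. c *\<^sub>R x) ` M) t = c ^ 4 * \<psi> M (t / c)"
proof -
  interpret s: measured_surface "(\<lambda>x. c *\<^sub>R x) ` M" "scaled_measure c" by (rule measured_surface_scaled[OF c])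
  let ?A = "{(x, y). x \<in> (\<lambda>x. c *\<^sub>R x) ` M \<and> y \<in> (\<lambda>x. c *\<^sub>R x) ` M \<and> dist x y \<le> t}"
  have A: "?A \<in> sets (borel \<Otimes>\<^sub>M borel)" by measurable
  note ds = linear_similarity.dist[OF linear_similarity_scaling[OF c]]
  have pre: "(\<lambda>(x, y). (c *\<^sub>R x, c *\<^sub>R y)) -` ?A = {(x, y). x \<in> M \<and> y \<in> M \<and> dist x y \<le> t / c}"
    using c by (auto simp: ds pos_le_divide_eq mult.commute)
  have "emeasure (scaled_measure c \<Otimes>\<^sub>M scaled_measure c) ?A
      = ennreal (c ^ 4) * emeasure (\<mu> \<Otimes>\<^sub>M \<mu>) {(x, y). x \<in> M \<and> y \<in> M \<and> dist x y \<le> t / c}"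
  proof -
    have "emeasure (distr (\<mu> \<Otimes>\<^sub>M \<mu>) (borel \<Otimes>\<^sub>M borel) (\<lambda>(x, y). (c *\<^sub>R x, c *\<^sub>R y))) ?A
      = emeasure (\<mu> \<Otimes>\<^sub>M \<mu>) ((\<lambda>(x, y). (c *\<^sub>R x, c *\<^sub>R y)) -` ?A \<inter> space (\<mu> \<Otimes>\<^sub>M \<mu>))"
      using A by (intro emeasure_distr) auto
    moreover have "space (\<mu> \<Otimes>\<^sub>M \<mu>) = UNIV" by (simp add: space_pair_measure space_\<mu>)
    ultimately have "emeasure (distr (\<mu> \<Otimes>\<^sub>M \<mu>) (borel \<Otimes>\<^sub>M borel) (\<lambda>(x, y). (c *\<^sub>R x, c *\<^sub>R y))) ?A
      = emeasure (\<mu> \<Otimes>\<^sub>M \<mu>) {(x, y). x \<in> M \<and> y \<in> M \<and> dist x y \<le> t / c}"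
      unfolding pre by simp
    then show ?thesis
      unfolding pair_scaled_measure using A by (subst emeasure_density_const) auto
  qed
  then show ?thesis
    using c unfolding \<psi>_def area_measure s.area_measure measure_def by (simp add: enn2real_mult)
qed

lemma truncated_energy_scaled:
  assumes c: "c > 0"
  shows "truncated_energy ((\<lambda>x. c *\<^sub>R x) ` M) z \<epsilon> = complex_of_real c powr (4 + z) * truncated_energy M z (\<epsilon> / c)"
proof -
  interpret s: measured_surface "(\<lambda>x. c *\<^sub>R x) ` M" "scaled_measure c" by (rule measured_surface_scaled[OF c])
  let ?A = "{(x, y). x \<in> (\<lambda>x. c *\<^sub>R x) ` M \<and> y \<in> (\<lambda>x. c *\<^sub>R x) ` M \<and> dist x y > \<epsilon>}"
  have A: "?A \<in> sets (borel \<Otimes>\<^sub>M borel)" by measurable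
  let ?f = "\<lambda>p. indicator ?A p *\<^sub>R (case p of (x, y) \<Rightarrow> complex_of_real (dist x y) powr z)"
  have f: "?f \<in> borel_measurable (borel \<Otimes>\<^sub>M borel)" using A by measurable
  have "truncated_energy ((\<lambda>x. c *\<^sub>R x) ` M) z \<epsilon>
     = integral\<^sup>L (distr (\<mu> \<Otimes>\<^sub>M \<mu>) (borel \<Otimes>\<^sub>M borel) (\<lambda>(x, y). (c *\<^sub>R x, c *\<^sub>R y))) (\<lambda>p. c ^ 4 *\<^sub>R ?f p)"
    unfolding truncated_energy_def s.area_measure set_lebesgue_integral_def pair_scaled_measure
    using f c by (intro integral_density) auto
  also have "\<dots> = integral\<^sup>L (\<mu> \<Otimes>\<^sub>M \<mu>) (\<lambda>p. c ^ 4 *\<^sub>R ?f (case p of (x, y) \<Rightarrow> (c *\<^sub>R x, c *\<^sub>R y)))"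
    using f by (intro integral_distr) auto
  also have "\<dots> = integral\<^sup>L (\<mu> \<Otimes>\<^sub>M \<mu>) (\<lambda>p. complex_of_real c powr (4 + z) *
      (indicator {(x, y). x \<in> M \<and> y \<in> M \<and> dist x y > \<epsilon> / c} p *\<^sub>R (case p of (x, y) \<Rightarrow> complex_of_real (dist x y) powr z)))"
  proof (rule Bochner_Integration.integral_cong[OF refl])
    fix p :: "(real^3) \<times> (real^3)"
    obtain x y where p: "p = (x, y)" by (cases p)
    note ds = linear_similarity.dist[OF linear_similarity_scaling[OF c]]
    have "complex_of_real (c * dist x y) powr z = complex_of_real c powr z * complex_of_real (dist x y) powr z"
      unfolding of_real_mult using c by (intro powr_times_real) auto
    moreover have "complex_of_real c powr (4 + z) = of_real (c ^ 4) * complex_of_real c powr z"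
      using c powr_nat'[of "complex_of_real c" 4] by (simp add: powr_add)
    moreover have in_iff: "(c *\<^sub>R x, c *\<^sub>R y) \<in> ?A \<longleftrightarrow> (x, y) \<in> {(x, y). x \<in> M \<and> y \<in> M \<and> dist x y > \<epsilon> / c}"
      using c by (simp add: ds pos_divide_less_eq mult.commute
          inj_image_mem_iff[OF linear_similarity.inj[OF linear_similarity_scaling[OF c]]])
    ultimately show "c ^ 4 *\<^sub>R ?f (case p of (x, y) \<Rightarrow> (c *\<^sub>R x, c *\<^sub>R y)) = complex_of_real c powr (4 + z) *
      (indicator {(x, y). x \<in> M \<and> y \<in> M \<and> dist x y > \<epsilon> / c} p *\<^sub>R (case p of (x, y) \<Rightarrow> complex_of_real (dist x y) powr z))"
      using c in_iff unfolding p by (auto simp: scaleR_conv_of_real[where 'a = complex] indicator_def ds)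
  qed
  also have "\<dots> = complex_of_real c powr (4 + z) * truncated_energy M z (\<epsilon> / c)"
    unfolding truncated_energy_def area_measure set_lebesgue_integral_def
    by (rule integral_mult_right_zero)
  finally show ?thesis .
qed

lemma counterterm_scaled:
  assumes "c > 0" "\<epsilon> > 0"
  shows "counterterm w \<epsilon> = complex_of_real c powr w * (counterterm w (\<epsilon> / c) + (if w = 0 then of_real (ln c) else 0))"
proof (cases "w = 0")
  case True
  then show ?thesis using assms by (simp add: counterterm_def ln_div)
next
  case False
  have "complex_of_real c powr w * complex_of_real (\<epsilon> / c) powr w = complex_of_real (c * (\<epsilon> / c)) powr w"
    unfolding of_real_mult using assms by (intro powr_times_real[symmetric]) auto
  then show ?thesis using False assms by (simp add: counterterm_def)
qed

text \<open>Truncated energy and counterterms are homogeneous of degree \<open>4 + z\<close>, with one exception: the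
  logarithmic counterterm picks up \<open>ln c\<close>. At \<open>z = -4\<close> this anomaly is all that remains.\<close>

lemma has_regularized_energy_scaled:
  fixes D :: "nat \<Rightarrow> real \<Rightarrow> real"
  assumes c: "c > 0" and k: "Re z > - real k - 1" and d: "d > 0"
    and D0: "\<forall>t\<in>{0..d}. D 0 t = \<psi> M t"
    and D: "\<forall>j<k. \<forall>t\<in>{0..d}. (D j has_real_derivative D (Suc j) t) (at t within {0..d})"
    and E: "((\<lambda>\<epsilon>. truncated_energy M z \<epsilon> +
               (\<Sum>j=1..k. complex_of_real (D j 0 / fact (j - 1)) * counterterm (z + of_nat j) \<epsilon>))
           \<longlongrightarrow> E) (at_right 0)"
  shows "has_regularized_energy ((\<lambda>x. c *\<^sub>R x) ` M) z
    (complex_of_real c powr (4 + z) * (E + (\<Sum>j=1..k. complex_of_real (D j 0 / fact (j - 1)) *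
        (if z + of_nat j = 0 then of_real (ln c) else 0))))"
proof -
  define D' where "D' j t = c ^ 4 / c ^ j * D j (t / c)" for j t
  have D'0: "\<forall>t\<in>{0..c * d}. D' 0 t = \<psi> ((\<lambda>x. c *\<^sub>R x) ` M) t"
    using D0 c by (auto simp: D'_def \<psi>_scaled pos_divide_le_eq mult.commute)
  have D': "(D' j has_real_derivative D' (Suc j) t) (at t within {0..c * d})" if j: "j < k" "t \<in> {0..c * d}" for j t
  proof -
    have im: "(\<lambda>t. t / c) ` {0..c * d} = {0..d}"
    proof (intro equalityI subsetI)
      fix x assume "x \<in> {0..d}"
      then show "x \<in> (\<lambda>t. t / c) ` {0..c * d}" using c by (intro image_eqI[of _ _ "c * x"]) auto
    qed (use c in \<open>auto simp: pos_divide_le_eq mult.commute\<close>)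
    have "t / c \<in> {0..d}" using im j(2) by blast
    then have "(D j has_real_derivative D (Suc j) (t / c)) (at (t / c) within (\<lambda>t. t / c) ` {0..c * d})"
      unfolding im using D j by blast
    moreover have "((\<lambda>t. t / c) has_real_derivative 1 / c) (at t within {0..c * d})"
      by (rule DERIV_cdivide[OF DERIV_ident])
    ultimately have "((\<lambda>t. D j (t / c)) has_real_derivative D (Suc j) (t / c) * (1 / c)) (at t within {0..c * d})"
      by (rule DERIV_image_chain[where f = "D j" and g = "\<lambda>t. t / c", unfolded o_def])
    from DERIV_cmult[OF this, of "c ^ 4 / c ^ j"] show ?thesis by (simp add: D'_def[abs_def] ac_simps)
  qed
  let ?r = "complex_of_real c powr (4 + z)"
  let ?a = "\<lambda>j. complex_of_real (D j 0 / fact (j - 1))"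
  let ?l = "\<lambda>j. if z + of_nat j = 0 then complex_of_real (ln c) else 0"
  have coeff: "complex_of_real (D' j 0 / fact (j - 1)) * counterterm (z + of_nat j) \<epsilon>
     = ?r * (?a j * counterterm (z + of_nat j) (\<epsilon> / c) + ?a j * ?l j)" if "\<epsilon> > 0" for j \<epsilon>
  proof -
    have "complex_of_real (c ^ 4 / c ^ j) * complex_of_real c powr (z + of_nat j) = ?r"
      using c powr_nat'[of "complex_of_real c" 4] powr_nat'[of "complex_of_real c" j] by (simp add: powr_add)
    then have "complex_of_real (c ^ 4 / c ^ j) * counterterm (z + of_nat j) \<epsilon>
        = ?r * (counterterm (z + of_nat j) (\<epsilon> / c) + ?l j)"
      unfolding counterterm_scaled[OF c that] by (simp only: mult.assoc[symmetric])
    moreover have "complex_of_real (D' j 0 / fact (j - 1)) = ?a j * complex_of_real (c ^ 4 / c ^ j)"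
      by (simp add: D'_def mult.commute)
    ultimately show ?thesis by (simp only: mult.assoc) (simp add: algebra_simps)
  qed
  have "filterlim (\<lambda>\<epsilon>. \<epsilon> / c) (at_right 0) (at_right 0)"
  proof (rule filterlim_at_withinI)
    show "((\<lambda>\<epsilon>. \<epsilon> / c) \<longlongrightarrow> 0) (at_right 0)" by (auto intro!: tendsto_eq_intros simp: c less_imp_neq[symmetric])
    show "\<forall>\<^sub>F \<epsilon> in at_right 0. \<epsilon> / c \<in> {0<..} - {0}"
      using c by (auto simp: eventually_at_filter)
  qed
  from filterlim_compose[OF E this]
  have "((\<lambda>\<epsilon>. ?r * ((truncated_energy M z (\<epsilon> / c) + (\<Sum>j=1..k. ?a j * counterterm (z + of_nat j) (\<epsilon> / c)))
       + (\<Sum>j=1..k. ?a j * ?l j))) \<longlongrightarrow> ?r * (E + (\<Sum>j=1..k. ?a j * ?l j))) (at_right 0)"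
    by (intro tendsto_intros)
  moreover have "\<forall>\<^sub>F \<epsilon> in at_right 0. ?r * ((truncated_energy M z (\<epsilon> / c) + (\<Sum>j=1..k. ?a j * counterterm (z + of_nat j) (\<epsilon> / c)))
       + (\<Sum>j=1..k. ?a j * ?l j)) = truncated_energy ((\<lambda>x. c *\<^sub>R x) ` M) z \<epsilon> +
          (\<Sum>j=1..k. complex_of_real (D' j 0 / fact (j - 1)) * counterterm (z + of_nat j) \<epsilon>)"
  proof -
    have "?r * ((truncated_energy M z (\<epsilon> / c) + (\<Sum>j=1..k. ?a j * counterterm (z + of_nat j) (\<epsilon> / c)))
       + (\<Sum>j=1..k. ?a j * ?l j)) = truncated_energy ((\<lambda>x. c *\<^sub>R x) ` M) z \<epsilon> +
          (\<Sum>j=1..k. complex_of_real (D' j 0 / fact (j - 1)) * counterterm (z + of_nat j) \<epsilon>)" if "\<epsilon> > 0" for \<epsilon>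
      unfolding coeff[OF that] truncated_energy_scaled[OF c]
      by (simp only: distrib_left sum.distrib sum_distrib_left add.assoc)
    then show ?thesis unfolding eventually_at_right_field using zero_less_one by blast
  qed
  ultimately have "((\<lambda>\<epsilon>. truncated_energy ((\<lambda>x. c *\<^sub>R x) ` M) z \<epsilon> +
          (\<Sum>j=1..k. complex_of_real (D' j 0 / fact (j - 1)) * counterterm (z + of_nat j) \<epsilon>))
      \<longlongrightarrow> ?r * (E + (\<Sum>j=1..k. ?a j * ?l j))) (at_right 0)"
    by (rule Lim_transform_eventually)
  then show ?thesis unfolding has_regularized_energy_def
    using k D'0 D' mult_pos_pos[OF c d] by blast
qed

end

section \<open>Integration over a surface of revolution\<close>

lemma nn_integral_real_2:
  fixes f :: "real^2 \<Rightarrow> ennreal"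
  assumes [measurable]: "f \<in> borel_measurable borel"
  shows "(\<integral>\<^sup>+u. f u \<partial>lborel) = (\<integral>\<^sup>+a. \<integral>\<^sup>+v. f (vector [a, v]) \<partial>lborel \<partial>lborel)"
proof -
  let ?V = "\<lambda>(a, v). vector [a, v] :: real^2"
  have "?V = (\<lambda>p. fst p *\<^sub>R axis 1 1 + snd p *\<^sub>R axis 2 1)"
    by (auto simp: fun_eq_iff vec_eq_iff forall_2 axis_def)
  then have V [measurable]: "?V \<in> borel_measurable (lborel \<Otimes>\<^sub>M lborel)" by simp
  have B: "(Basis :: (real^2) set) = {axis 1 1, axis 2 1}"
    by (auto simp: Basis_vec_def UNIV_2)
  have "lborel = distr (lborel \<Otimes>\<^sub>M lborel) borel ?V"
  proof (rule lborel_eqI)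
    fix l u :: "real^2" assume lu: "\<And>b. b \<in> Basis \<Longrightarrow> l \<bullet> b \<le> u \<bullet> b"
    have le: "l $ 1 \<le> u $ 1" "l $ 2 \<le> u $ 2"
      using lu[of "axis 1 1"] lu[of "axis 2 1"] by (auto simp: B inner_axis)
    have "?V -` box l u \<inter> space (lborel \<Otimes>\<^sub>M lborel) = {l $ 1<..<u $ 1} \<times> {l $ 2<..<u $ 2}"
      by (auto simp: mem_box_cart forall_2 space_pair_measure)
    then have "emeasure (distr (lborel \<Otimes>\<^sub>M lborel) borel ?V) (box l u)
       = emeasure (lborel \<Otimes>\<^sub>M lborel) ({l $ 1<..<u $ 1} \<times> {l $ 2<..<u $ 2})"
      by (subst emeasure_distr) auto
    also have "\<dots> = ennreal (u $ 1 - l $ 1) * ennreal (u $ 2 - l $ 2)"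
      using le by (subst lborel.emeasure_pair_measure_Times) auto
    also have "\<dots> = ennreal (\<Prod>b\<in>Basis. (u - l) \<bullet> b)"
      using le by (simp add: B inner_axis axis_eq_axis ennreal_mult)
    finally show "emeasure (distr (lborel \<Otimes>\<^sub>M lborel) borel ?V) (box l u) = ennreal (\<Prod>b\<in>Basis. (u - l) \<bullet> b)" .
  qed simp
  then have "(\<integral>\<^sup>+u. f u \<partial>lborel) = (\<integral>\<^sup>+u. f u \<partial>distr (lborel \<Otimes>\<^sub>M lborel) borel ?V)" by simp
  also have "\<dots> = (\<integral>\<^sup>+p. f (?V p) \<partial>(lborel \<Otimes>\<^sub>M lborel))" by (rule nn_integral_distr) auto
  also have "\<dots> = (\<integral>\<^sup>+a. \<integral>\<^sup>+v. f (?V (a, v)) \<partial>lborel \<partial>lborel)"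
    by (rule lborel.nn_integral_fst[symmetric]) measurable
  finally show ?thesis by simp
qed

definition rev_point :: "real \<Rightarrow> real \<Rightarrow> real \<Rightarrow> real^3" where
  "rev_point R a v = chart R (vector [a, v])"

lemma rev_point_nth [simp]:
  "rev_point R a v $ 1 = (R + cos v) * cos a"
  "rev_point R a v $ 2 = (R + cos v) * sin a"
  "rev_point R a v $ 3 = sin v"
  by (simp_all add: rev_point_def)

lemma rev_point_measurable [measurable (raw)]:
  assumes [measurable]: "f \<in> borel_measurable N" "g \<in> borel_measurable N"
  shows "(\<lambda>x. rev_point R (f x) (g x)) \<in> borel_measurable N"
proof -
  have "(\<lambda>x. rev_point R (f x) (g x)) = (\<lambda>x. ((R + cos (g x)) * cos (f x)) *\<^sub>R axis 1 1 +
      ((R + cos (g x)) * sin (f x)) *\<^sub>R axis 2 1 + sin (g x) *\<^sub>R axis 3 1)"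
    by (auto simp: fun_eq_iff vec_eq_iff forall_3 axis_def)
  then show ?thesis by simp
qed

text \<open>For \<open>R = 0\<close> the second angle runs beyond the poles; there the cosine is negative and is truncated to
zero by \<open>ennreal\<close>, so one formula serves both surfaces.\<close>

lemma nn_integral_rev_area:
  assumes [measurable]: "g \<in> borel_measurable borel"
  shows "(\<integral>\<^sup>+x. g x \<partial>rev_area R)
    = (\<integral>\<^sup>+a\<in>{-pi..pi}. (\<integral>\<^sup>+v\<in>{-pi..pi}. ennreal (R + cos v) * g (rev_point R a v) \<partial>lborel) \<partial>lborel)"
proof -
  have "(\<integral>\<^sup>+x. g x \<partial>rev_area R)
     = (\<integral>\<^sup>+u. g (chart R u) \<partial>density lborel (\<lambda>u. ennreal (R + cos (u $ 2)) * indicator (chart_domain R 0 0) u))"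
    unfolding rev_area_def by (rule nn_integral_distr) auto
  also have "\<dots> = (\<integral>\<^sup>+u. ennreal (R + cos (u $ 2)) * indicator (chart_domain R 0 0) u * g (chart R u) \<partial>lborel)"
    by (rule nn_integral_density) auto
  also have "\<dots> = (\<integral>\<^sup>+a. \<integral>\<^sup>+v. ennreal (R + cos v) * indicator (chart_domain R 0 0) (vector [a, v]) * g (rev_point R a v) \<partial>lborel \<partial>lborel)"
    by (subst nn_integral_real_2) (auto simp: rev_point_def)
  also have "\<dots> = (\<integral>\<^sup>+a. (\<integral>\<^sup>+v. ennreal (R + cos v) * g (rev_point R a v) * indicator {-pi..pi} v * indicator {-pi..pi} a \<partial>lborel) \<partial>lborel)"
  proof (intro nn_integral_cong_AE)
    have "AE a in lborel. a \<noteq> - pi" "AE a in lborel. a \<noteq> pi" by (auto intro: AE_lborel_singleton)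
    then show "AE a in lborel. (\<integral>\<^sup>+v. ennreal (R + cos v) * indicator (chart_domain R 0 0) (vector [a, v]) * g (rev_point R a v) \<partial>lborel)
        = (\<integral>\<^sup>+v. ennreal (R + cos v) * g (rev_point R a v) * indicator {-pi..pi} v * indicator {-pi..pi} a \<partial>lborel)"
    proof eventually_elim
      case a: (elim a)
      have "AE v in lborel. v \<noteq> - pi" "AE v in lborel. v \<noteq> pi" by (auto intro: AE_lborel_singleton)
      then have "AE v in lborel. ennreal (R + cos v) * indicator (chart_domain R 0 0) (vector [a, v]) * g (rev_point R a v)
        = ennreal (R + cos v) * g (rev_point R a v) * indicator {-pi..pi} v * indicator {-pi..pi} a"
      proof eventually_elim
        case (elim v)
        then show ?case using a
          by (cases "R + cos v > 0") (auto simp: indicator_def chart_domain_def ennreal_neg abs_less_iff)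
      qed
      then show ?case by (rule nn_integral_cong_AE)
    qed
  qed
  also have "\<dots> = (\<integral>\<^sup>+a\<in>{-pi..pi}. (\<integral>\<^sup>+v\<in>{-pi..pi}. ennreal (R + cos v) * g (rev_point R a v) \<partial>lborel) \<partial>lborel)"
    by (intro nn_integral_cong nn_integral_multc) measurable
  finally show ?thesis .
qed

lemma emeasure_rev_area_iterated:
  assumes [measurable]: "A \<in> sets borel"
  shows "emeasure (rev_area R) A
    = (\<integral>\<^sup>+a\<in>{-pi..pi}. (\<integral>\<^sup>+v\<in>{-pi..pi}. ennreal (R + cos v) * indicator A (rev_point R a v) \<partial>lborel) \<partial>lborel)"
proof -
  have "emeasure (rev_area R) A = (\<integral>\<^sup>+x. indicator A x \<partial>rev_area R)"
    by (rule nn_integral_indicator[symmetric]) (simp add: rev_area_def)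
  then show ?thesis by (simp add: nn_integral_rev_area)
qed

lemma finite_rev_area: "finite_measure (rev_area R)"
proof
  have le: "ennreal (R + cos v) \<le> ennreal (\<bar>R\<bar> + 1)" for v
    by (rule ennreal_leI) (use cos_le_one[of v] in linarith)
  have "emeasure (rev_area R) UNIV
    = (\<integral>\<^sup>+a\<in>{-pi..pi}. (\<integral>\<^sup>+v\<in>{-pi..pi}. ennreal (R + cos v) * indicator UNIV (rev_point R a v) \<partial>lborel) \<partial>lborel)"
    by (rule emeasure_rev_area_iterated) simp
  also have "\<dots> \<le> (\<integral>\<^sup>+a\<in>{-pi..pi}. (\<integral>\<^sup>+v\<in>{-pi..pi}. ennreal (\<bar>R\<bar> + 1) \<partial>lborel) \<partial>lborel)"
    by (intro nn_integral_mono mult_right_mono) (simp_all add: le del: ennreal_plus)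
  also have "\<dots> = ennreal (\<bar>R\<bar> + 1) * ennreal (2 * pi) * ennreal (2 * pi)"
    by (simp add: nn_integral_cmult_indicator del: ennreal_plus)
  also have "\<dots> < \<infinity>" by (simp add: ennreal_mult_less_top)
  finally show "emeasure (rev_area R) (space (rev_area R)) \<noteq> \<infinity>" by (simp add: rev_area_def)
qed

section \<open>The energies of the round sphere\<close>

abbreviation "S2 \<equiv> rev_surface 0"

interpretation sphere: measured_surface S2 "rev_area 0"
  by (intro measured_surface.intro closed_surface_sphere is_area_measure_rev_area finite_rev_area)

lemma dist_square_3: "(dist x y)\<^sup>2 = (x $ 1 - y $ 1)\<^sup>2 + (x $ 2 - y $ 2)\<^sup>2 + (x $ 3 - y $ 3)\<^sup>2"
  for x y :: "real^3"
  unfolding dist_norm power2_norm_eq_inner by (simp add: inner_vec_def sum_3 power2_eq_square)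

lemma dist_pole: "(dist (axis 3 1) (rev_point 0 a v))\<^sup>2 = 2 - 2 * sin v"
proof -
  have "(dist (axis 3 1) (rev_point 0 a v))\<^sup>2 = (cos v)\<^sup>2 * ((cos a)\<^sup>2 + (sin a)\<^sup>2) + (1 - sin v)\<^sup>2"
    unfolding dist_square_3 by (simp add: axis_def power_mult_distrib flip: distrib_left)
  then show ?thesis by (simp add: cos_squared_eq power2_eq_square algebra_simps)
qed

text \<open>Archimedes: the area of a cap is proportional to its height, which is \<open>t\<^sup>2 / 2\<close> for the chord \<open>t\<close>.
  Caps around other points have the same area by rotation invariance, so that \<open>\<psi>\<close> is exactly quadratic.\<close>

lemma area_polar_cap:
  assumes t: "0 \<le> t" "t \<le> 2"
  shows "emeasure (rev_area 0) {y. dist (axis 3 1) y \<le> t} = ennreal (pi * t\<^sup>2)"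
proof -
  define s where "s = 1 - t\<^sup>2 / 2"
  have "t\<^sup>2 \<le> 2\<^sup>2" using t by (intro power_mono) auto
  then have s: "-1 \<le> s" "s \<le> 1" by (auto simp: s_def)
  have "(\<integral>\<^sup>+v\<in>{-pi..pi}. ennreal (0 + cos v) * indicator {y. dist (axis 3 1) y \<le> t} (rev_point 0 a v) \<partial>lborel)
     = ennreal (t\<^sup>2 / 2)" for a
  proof -
    have iff: "dist (axis 3 1) (rev_point 0 a v) \<le> t \<longleftrightarrow> s \<le> sin v" for v
    proof -
      have "dist (axis 3 1) (rev_point 0 a v) \<le> t \<longleftrightarrow> (dist (axis 3 1) (rev_point 0 a v))\<^sup>2 \<le> t\<^sup>2"
        using t by (simp add: power2_le_iff_abs_le)
      then show ?thesis by (auto simp: dist_pole s_def)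
    qed
    have "(\<integral>\<^sup>+v\<in>{-pi..pi}. ennreal (0 + cos v) * indicator {y. dist (axis 3 1) y \<le> t} (rev_point 0 a v) \<partial>lborel)
       = (\<integral>\<^sup>+v. ennreal (cos v) * indicator {arcsin s..pi/2} v \<partial>lborel)"
    proof (intro nn_integral_cong)
      fix v :: real
      consider "\<bar>v\<bar> > pi" | "\<bar>v\<bar> \<le> pi" "\<bar>v\<bar> > pi / 2" | "\<bar>v\<bar> \<le> pi / 2" by linarith
      then show "ennreal (0 + cos v) * indicator {y. dist (axis 3 1) y \<le> t} (rev_point 0 a v) * indicator {-pi..pi} v
         = ennreal (cos v) * indicator {arcsin s..pi/2} v"
      proof cases
        case 1
        then show ?thesis using arcsin_bounded[OF s] by (auto simp: indicator_def)
      next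
        case 2
        have "cos \<bar>v\<bar> \<le> 0"
        proof -
          have "cos (pi - \<bar>v\<bar>) \<ge> 0" using 2 by (intro cos_ge_zero) auto
          then show ?thesis by (simp add: cos_diff)
        qed
        then have "ennreal (cos v) = 0" by (simp add: ennreal_neg)
        then show ?thesis by simp
      next
        case 3
        then have "s \<le> sin v \<longleftrightarrow> arcsin s \<le> v"
          using arcsin_le_iff[OF s, of v] by (auto simp: abs_le_iff)
        then show ?thesis using 3 by (auto simp: indicator_def iff abs_le_iff)
      qed
    qed
    also have "\<dots> = ennreal (sin (pi / 2) - sin (arcsin s))"
    proof (rule nn_integral_FTC_Icc)
      fix v assume "v \<in> {arcsin s..pi / 2}"
      then show "0 \<le> cos v" using arcsin_bounded[OF s] by (intro cos_ge_zero) auto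
    qed (use arcsin_bounded[OF s] in \<open>auto intro!: derivative_eq_intros\<close>)
    also have "sin (pi / 2) - sin (arcsin s) = t\<^sup>2 / 2" using s by (simp add: s_def)
    finally show ?thesis .
  qed
  then have "emeasure (rev_area 0) {y. dist (axis 3 1) y \<le> t} = (\<integral>\<^sup>+a\<in>{-pi..pi}. ennreal (t\<^sup>2 / 2) \<partial>lborel)"
    by (subst emeasure_rev_area_iterated) simp_all
  also have "\<dots> = ennreal (pi * t\<^sup>2)"
    by (simp add: nn_integral_cmult_indicator flip: ennreal_mult)
  finally show ?thesis .
qed

lemma area_cap:
  assumes x: "x \<in> S2" and t: "0 \<le> t" "t \<le> 2"
  shows "emeasure (rev_area 0) {y. dist x y \<le> t} = ennreal (pi * t\<^sup>2)"
proof -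
  have "norm (axis 3 1 :: real^3) = norm x" using x by (simp add: rev_surface_0)
  then obtain f :: "real^3 \<Rightarrow> real^3" where f: "orthogonal_transformation f" "f (axis 3 1) = x"
    by (rule orthogonal_transformation_exists)
  interpret linear_similarity f 1 using f(1) by (rule linear_similarity_orthogonal)
  have "f ` S2 = S2" by (rule orthogonal_image_sphere[OF f(1)])
  then have "is_area_measure S2 (density (distr (rev_area 0) borel f) (\<lambda>_. ennreal (1\<^sup>2)))"
    using area_measure[OF sphere.area] by simp
  moreover have "density (distr (rev_area 0) borel f) (\<lambda>_. ennreal (1\<^sup>2)) = distr (rev_area 0) borel f"
    by (simp add: density_1)
  ultimately have "is_area_measure S2 (distr (rev_area 0) borel f)" by simp
  then have eq: "distr (rev_area 0) borel f = rev_area 0"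
    by (rule is_area_measure_unique[OF closed_surface_sphere _ sphere.area])
  have "f \<in> measurable (rev_area 0) borel"
    using borel_measurable_continuous_onI[OF continuous] by (simp add: rev_area_def)
  then have "emeasure (distr (rev_area 0) borel f) {y. dist x y \<le> t}
      = emeasure (rev_area 0) (f -` {y. dist x y \<le> t} \<inter> space (rev_area 0))"
    by (rule emeasure_distr) simp
  also have "f -` {y. dist x y \<le> t} \<inter> space (rev_area 0) = {y. dist (axis 3 1) y \<le> t}"
    using dist[of "axis 3 1"] f(2) by (auto simp: rev_area_def)
  finally show ?thesis using area_polar_cap[OF t] eq by simp
qed

lemma \<psi>_sphere:
  assumes t: "0 \<le> t" "t \<le> 2"
  shows "\<psi> S2 t = 4 * pi\<^sup>2 * t\<^sup>2"
proof -
  have ae: "AE y in rev_area 0. y \<in> S2" using AE_not_in[OF sphere.null_complement] by simp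
  have "dist (axis 3 1) y \<le> 2" if "y \<in> S2" for y :: "real^3"
    using that dist_triangle[of "axis 3 1" y 0] by (simp add: rev_surface_0)
  then have "emeasure (rev_area 0) {y. dist (axis 3 1) y \<le> 2} = emeasure (rev_area 0) UNIV"
    by (intro emeasure_eq_AE) (use ae in \<open>auto simp: rev_area_def\<close>)
  then have total: "emeasure (rev_area 0) (space (rev_area 0)) = ennreal (4 * pi)"
    using area_polar_cap[of 2] by (simp add: mult.commute sphere.space_\<mu>)
  let ?A = "{(x, y). x \<in> S2 \<and> y \<in> S2 \<and> dist x y \<le> t}"
  have "emeasure (rev_area 0 \<Otimes>\<^sub>M rev_area 0) ?A = (\<integral>\<^sup>+x. ennreal (pi * t\<^sup>2) \<partial>rev_area 0)"
    unfolding sphere.emeasure_close_pairs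
    by (rule nn_integral_cong_AE) (use ae in eventually_elim, rule area_cap[OF _ t])
  also have "\<dots> = ennreal (pi * t\<^sup>2) * ennreal (4 * pi)" by (simp only: nn_integral_const total)
  also have "\<dots> = ennreal (4 * pi\<^sup>2 * t\<^sup>2)"
    by (simp add: power2_eq_square algebra_simps flip: ennreal_mult)
  finally show ?thesis by (simp add: \<psi>_def sphere.area_measure measure_def)
qed

definition sphere_D :: "nat \<Rightarrow> real \<Rightarrow> real" where
  "sphere_D j t = (if j = 0 then 4 * pi\<^sup>2 * t\<^sup>2 else if j = 1 then 8 * pi\<^sup>2 * t else if j = 2 then 8 * pi\<^sup>2 else 0)"

lemma sphere_D:
  "(sphere_D j has_real_derivative sphere_D (Suc j) t) (at t within S)"
proof -
  consider "j = 0" | "j = 1" | "j = 2" | "j > 2" by linarith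
  then show ?thesis
  proof cases
    case 1
    have "((\<lambda>t. 4 * pi\<^sup>2 * t\<^sup>2) has_real_derivative 8 * pi\<^sup>2 * t) (at t within S)"
      by (rule derivative_eq_intros refl | simp)+
    then show ?thesis by (simp add: 1 sphere_D_def[abs_def])
  next
    case 2
    have "((\<lambda>t. 8 * pi\<^sup>2 * t) has_real_derivative 8 * pi\<^sup>2) (at t within S)"
      by (rule derivative_eq_intros refl | simp)+
    then show ?thesis by (simp add: 2 sphere_D_def[abs_def])
  qed (simp_all add: sphere_D_def[abs_def])
qed

text \<open>On \<open>[0, 2]\<close> there is no remainder, and no two points have distance greater than \<open>2\<close>. The energy is
therefore the value of the only nonzero counterterm at \<open>2\<close>.\<close>

lemma sphere_energy_limit:
  assumes k: "k \<ge> 2"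
  shows "((\<lambda>\<epsilon>. truncated_energy S2 z \<epsilon> +
        (\<Sum>j=1..k. complex_of_real (sphere_D j 0 / fact (j - 1)) * counterterm (z + of_nat j) \<epsilon>)) \<longlongrightarrow>
      8 * of_real pi ^ 2 * counterterm (z + 2) 2) (at_right 0)"
proof -
  have sum: "(\<Sum>j=1..k. g j (sphere_D j 0 / fact (j - 1))) = g 2 (8 * pi\<^sup>2)"
    if "\<And>j. g j 0 = 0" for g :: "nat \<Rightarrow> real \<Rightarrow> 'a::comm_monoid_add"
  proof -
    have "(\<Sum>j=1..k. g j (sphere_D j 0 / fact (j - 1))) = (\<Sum>j\<in>{2}. g j (sphere_D j 0 / fact (j - 1)))"
      using k that by (intro sum.mono_neutral_right) (auto simp: sphere_D_def)
    then show ?thesis by (simp add: sphere_D_def)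
  qed
  have E: "{(x, y). x \<in> S2 \<and> y \<in> S2 \<and> 2 < dist x y} = {}"
  proof -
    have "dist x y \<le> 2" if "x \<in> S2" "y \<in> S2" for x y
      using that dist_triangle[of x y 0] by (simp add: rev_surface_0 dist_commute)
    then show ?thesis by force
  qed
  have 0: "truncated_energy S2 z 2 = 0"
    unfolding truncated_energy_def E set_lebesgue_integral_def by simp
  have "((\<lambda>\<epsilon>. truncated_energy S2 z \<epsilon> +
        (\<Sum>j=1..k. complex_of_real (sphere_D j 0 / fact (j - 1)) * counterterm (z + of_nat j) \<epsilon>)) \<longlongrightarrow>
      truncated_energy S2 z 2 + (\<Sum>j=1..k. complex_of_real (sphere_D j 0 / fact (j - 1)) * counterterm (z + of_nat j) 2) + 0)
    (at_right 0)"
  proof (rule sphere.regularized_energy_tendsto[where h = "\<lambda>_. 0"])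
    show "sphere_D 0 t = \<psi> S2 t" if "t \<in> {0..2}" for t
      using that by (simp add: sphere_D_def \<psi>_sphere)
    show "continuous_on {0..2} (sphere_D 1)" unfolding sphere_D_def[abs_def] by (auto intro!: continuous_intros)
    show "sphere_D 1 t = (\<Sum>j=1..k. sphere_D j 0 / fact (j - 1) * t ^ (j - 1)) + 0" for t
      using sum[of "\<lambda>j x. x * t ^ (j - 1)"] by (simp add: sphere_D_def)
    show "0 \<le> sphere_D 1 t" if "t \<in> {0<..2}" for t
      using that by (simp add: sphere_D_def)
  qed (use k sphere_D in auto)
  then show ?thesis
    using sum[of "\<lambda>j x. complex_of_real x * counterterm (z + of_nat j) 2"] by (simp add: 0)
qed

section \<open>The distance distribution of the torus as a parametric integral\<close>

text \<open>For two points of the torus with meridional angles \<open>s + w\<close> and \<open>s - w\<close> and longitudes differing by \<open>m\<close>, the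
squared chord is \<open>4 sin\<^sup>2 w + 4 P sin\<^sup>2 (m / 2)\<close>, where \<open>P\<close> is the product of their distances from the axis. The
chord is at most \<open>t\<close> for an interval of \<open>m\<close> whose length is an arcsine; the substitution
\<open>sin w = t sin \<theta> / 2\<close> turns the square root of \<open>t\<^sup>2 - 4 sin\<^sup>2 w\<close> in its argument into \<open>t cos \<theta>\<close>. The definitions below are \<open>sin\<^sup>2 w\<close>, \<open>P\<close> and
the resulting integrand in these variables. It is even and smooth in \<open>t\<close>, also at \<open>0\<close>.\<close>

definition gap_sin_sq :: "real \<Rightarrow> real \<Rightarrow> real" where
  "gap_sin_sq t \<theta> = (t * sin \<theta> / 2)\<^sup>2"

definition radius_prod :: "real \<Rightarrow> real \<Rightarrow> real \<Rightarrow> real" where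
  "radius_prod t s \<theta> = 4 + 4 * cos s * sqrt (1 - gap_sin_sq t \<theta>) + (cos s)\<^sup>2 - gap_sin_sq t \<theta>"

definition torus_density :: "real \<Rightarrow> real \<Rightarrow> real \<Rightarrow> real" where
  "torus_density t s \<theta> = 8 * pi * (t * cos \<theta>) * radius_prod t s \<theta>
     * arcsin (t * cos \<theta> / (2 * sqrt (radius_prod t s \<theta>))) / sqrt (1 - gap_sin_sq t \<theta>)"

lemma gap_sin_sq_bounds: "0 \<le> gap_sin_sq t \<theta>" "gap_sin_sq t \<theta> \<le> t\<^sup>2 / 4"
proof -
  have "(sin \<theta>)\<^sup>2 \<le> 1" by (simp add: abs_square_le_1)
  then have "t\<^sup>2 * (sin \<theta>)\<^sup>2 \<le> t\<^sup>2 * 1" by (intro mult_left_mono) auto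
  then show "gap_sin_sq t \<theta> \<le> t\<^sup>2 / 4" by (simp add: gap_sin_sq_def power_mult_distrib power_divide)
qed (simp add: gap_sin_sq_def)

lemma gap_sin_sq_less:
  assumes "\<bar>t\<bar> < 1"
  shows "gap_sin_sq t \<theta> < 1 / 4" "sqrt (1 - gap_sin_sq t \<theta>) > 3 / 4"
proof -
  have "t\<^sup>2 < 1" using assms by (simp add: abs_square_less_1)
  then show *: "gap_sin_sq t \<theta> < 1 / 4" using gap_sin_sq_bounds(2)[of t \<theta>] by linarith
  have "sqrt ((3 / 4)\<^sup>2) < sqrt (1 - gap_sin_sq t \<theta>)"
    using * by (intro real_sqrt_less_mono) (auto simp: power2_eq_square)
  then show "sqrt (1 - gap_sin_sq t \<theta>) > 3 / 4" by simp
qed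

text \<open>With \<open>k = cos w\<close> one has \<open>P = (2k + cos s)\<^sup>2 + 3 sin\<^sup>2 w\<close>, and \<open>k > 3/4\<close>.\<close>

lemma radius_prod_lower:
  assumes "\<bar>t\<bar> < 1"
  shows "radius_prod t s \<theta> > 1 / 4"
proof -
  let ?X = "gap_sin_sq t \<theta>" and ?k = "sqrt (1 - gap_sin_sq t \<theta>)"
  have k: "?k\<^sup>2 = 1 - ?X" using gap_sin_sq_less(1)[OF assms, of \<theta>] by simp
  have "2 * ?k + cos s > 1 / 2" using gap_sin_sq_less(2)[OF assms, of \<theta>] cos_ge_minus_one[of s] by linarith
  then have "(1 / 2)\<^sup>2 < (2 * ?k + cos s)\<^sup>2" by (intro power_strict_mono) auto
  also have "(2 * ?k + cos s)\<^sup>2 = 4 * ?k\<^sup>2 + 4 * cos s * ?k + (cos s)\<^sup>2"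
    by (simp add: power2_eq_square algebra_simps)
  finally show ?thesis using gap_sin_sq_bounds(1)[of t \<theta>] k by (simp add: radius_prod_def power2_eq_square)
qed

lemma arcsin_argument:
  assumes "\<bar>t\<bar> < 1"
  shows "\<bar>t * cos \<theta> / (2 * sqrt (radius_prod t s \<theta>))\<bar> < 1"
proof -
  have "sqrt ((1 / 2)\<^sup>2) < sqrt (radius_prod t s \<theta>)"
    using radius_prod_lower[OF assms, of s \<theta>] by (intro real_sqrt_less_mono) (auto simp: power2_eq_square)
  then have *: "1 < 2 * sqrt (radius_prod t s \<theta>)" by simp
  have "\<bar>t * cos \<theta>\<bar> \<le> \<bar>t\<bar> * 1" unfolding abs_mult by (intro mult_left_mono) auto
  then have "\<bar>t * cos \<theta>\<bar> < 2 * sqrt (radius_prod t s \<theta>)" using assms * by linarith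
  moreover have pos: "0 < 2 * sqrt (radius_prod t s \<theta>)" using * by linarith
  ultimately show ?thesis unfolding abs_divide abs_of_pos[OF pos] pos_divide_less_eq[OF pos] by simp
qed

lemma elementary_torus_density:
  "elementary {p. \<bar>fst p\<bar> < 1} (\<lambda>p. torus_density (fst p) (fst (snd p)) (snd (snd p)))"
proof -
  let ?S = "{p :: real \<times> real \<times> real. \<bar>fst p\<bar> < 1}"
  have v: "elementary ?S fst" "elementary ?S (\<lambda>p. fst (snd p))" "elementary ?S (\<lambda>p. snd (snd p))"
    by (intro elementary.linear bounded_linear_fst bounded_linear_fst_comp bounded_linear_snd_comp bounded_linear_snd)+
  have X: "elementary ?S (\<lambda>p. gap_sin_sq (fst p) (snd (snd p)))"
    unfolding gap_sin_sq_def by (intro elementary_intros v) auto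
  have k: "elementary ?S (\<lambda>p. sqrt (1 - gap_sin_sq (fst p) (snd (snd p))))"
  proof (intro elementary_intros X)
    fix p assume "p \<in> ?S"
    then show "1 - gap_sin_sq (fst p) (snd (snd p)) > 0"
      using gap_sin_sq_less(1)[of "fst p" "snd (snd p)"] by simp
  qed
  have P: "elementary ?S (\<lambda>p. radius_prod (fst p) (fst (snd p)) (snd (snd p)))"
    unfolding radius_prod_def
    by (intro elementary.add elementary_diff elementary.mult elementary.const elementary.cos elementary_power v X k)
  have rP: "elementary ?S (\<lambda>p. sqrt (radius_prod (fst p) (fst (snd p)) (snd (snd p))))"
  proof (intro elementary.sqrt P)
    fix p assume "p \<in> ?S"
    then show "radius_prod (fst p) (fst (snd p)) (snd (snd p)) > 0"
      using radius_prod_lower[of "fst p" "fst (snd p)" "snd (snd p)"] by simp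
  qed
  have arc: "elementary ?S (\<lambda>p. arcsin (fst p * cos (snd (snd p)) / (2 * sqrt (radius_prod (fst p) (fst (snd p)) (snd (snd p))))))"
  proof (intro elementary.arcsin elementary_divide elementary.mult elementary.const elementary.cos v rP)
    fix p assume p: "p \<in> ?S"
    then show "2 * sqrt (radius_prod (fst p) (fst (snd p)) (snd (snd p))) \<noteq> 0"
      using radius_prod_lower[of "fst p" "fst (snd p)" "snd (snd p)"] by simp
    show "\<bar>fst p * cos (snd (snd p)) / (2 * sqrt (radius_prod (fst p) (fst (snd p)) (snd (snd p))))\<bar> < 1"
      using arcsin_argument[of "fst p"] p by blast
  qed
  show ?thesis unfolding torus_density_def
  proof (intro elementary_divide elementary.mult elementary.const elementary.cos v P arc k)
    fix p assume p: "p \<in> ?S"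
    then show "sqrt (1 - gap_sin_sq (fst p) (snd (snd p))) \<noteq> 0"
      using gap_sin_sq_less[of "fst p" "snd (snd p)"] by simp
  qed
qed

lemma torus_density_even: "torus_density (- t) s \<theta> = torus_density t s \<theta>" if "\<bar>t\<bar> < 1"
proof -
  have X: "gap_sin_sq (- t) \<theta> = gap_sin_sq t \<theta>" by (simp add: gap_sin_sq_def)
  then have P: "radius_prod (- t) s \<theta> = radius_prod t s \<theta>" by (simp add: radius_prod_def)
  have "arcsin (- (t * cos \<theta> / (2 * sqrt (radius_prod t s \<theta>)))) = - arcsin (t * cos \<theta> / (2 * sqrt (radius_prod t s \<theta>)))"
    using arcsin_argument[OF that, of \<theta> s] by (intro arcsin_minus; linarith)
  then show ?thesis by (simp add: torus_density_def X P)
qed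

text \<open>The leading coefficient in \<open>t\<^sup>2\<close> is exact and the correction of order \<open>t\<^sup>4\<close> is nonnegative for every
\<open>s\<close> and \<open>\<theta>\<close>. By \<open>arcsin x \<ge> x\<close> it suffices to bound \<open>P / k\<^sup>2\<close> from below by \<open>r\<^sup>2 + 2 X\<close>, with \<open>r = 2 + cos s\<close>, \<open>X = sin\<^sup>2 w\<close>
and \<open>k\<^sup>2 = 1 - X\<close>. The two signs of \<open>cos s\<close> need different bounds for \<open>k\<close>.\<close>

lemma torus_density_lower:
  assumes t: "0 \<le> t" "t < 1" and c: "cos \<theta> \<ge> 0"
  shows "4 * pi * (cos \<theta>)\<^sup>2 * (2 + cos s) * t\<^sup>2 + pi * (cos \<theta>)\<^sup>2 * (sin \<theta>)\<^sup>2 / 4 * t ^ 4 \<le> torus_density t s \<theta>"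
proof -
  define X P k r where "X = gap_sin_sq t \<theta>" and "P = radius_prod t s \<theta>" and "k = sqrt (1 - X)" and "r = 2 + cos s"
  have t1: "\<bar>t\<bar> < 1" using t by simp
  have X: "0 \<le> X" "X < 1 / 4" using gap_sin_sq_bounds gap_sin_sq_less[OF t1] by (auto simp: X_def)
  have k: "k > 3 / 4" "k\<^sup>2 = 1 - X" using gap_sin_sq_less[OF t1, of \<theta>] X by (auto simp: k_def X_def)
  have P: "P > 1 / 4" using radius_prod_lower[OF t1] by (simp add: P_def)
  have Pk: "P = 4 + 4 * cos s * k + (cos s)\<^sup>2 - X" by (simp add: P_def radius_prod_def X_def k_def)
  have r: "1 \<le> r" "r \<le> 3" unfolding r_def using cos_ge_minus_one[of s] cos_le_one[of s] by linarith+
  have k1: "1 - X \<le> k" "k \<le> 1 - X / 2"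
  proof -
    have "X * X \<le> 1 * X" using X by (intro mult_right_mono) auto
    then have "(1 - X)\<^sup>2 \<le> k\<^sup>2" using k by (simp add: power2_eq_square algebra_simps)
    then show "1 - X \<le> k" by (rule power2_le_imp_le) (use k in simp)
    have "k\<^sup>2 \<le> (1 - X / 2)\<^sup>2" using k by (simp add: power2_eq_square algebra_simps)
    then show "k \<le> 1 - X / 2" by (rule power2_le_imp_le) (use X in simp)
  qed
  have "(r\<^sup>2 + 2 * X) * (1 - X) \<le> P"
  proof (cases "cos s \<ge> 0")
    case True
    then have "cos s * (1 - X) \<le> cos s * k" using k1 by (intro mult_left_mono) auto
    then have "0 \<le> 4 * (cos s * k - cos s * (1 - X)) + X + X * (cos s)\<^sup>2 + 2 * (X * X)"
      using X(1) by (intro add_nonneg_nonneg) auto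
    also have "\<dots> = P - (r\<^sup>2 + 2 * X) * (1 - X)"
      by (simp add: Pk r_def power2_eq_square algebra_simps)
    finally show ?thesis by simp
  next
    case False
    then have "cos s * (1 - X / 2) \<le> cos s * k" using k1 by (intro mult_left_mono_neg) auto
    then have "0 \<le> 4 * (cos s * k - cos s * (1 - X / 2)) + X * (1 + cos s)\<^sup>2 + 2 * (X * X)"
      using X(1) by (intro add_nonneg_nonneg) auto
    also have "\<dots> = P - (r\<^sup>2 + 2 * X) * (1 - X)"
      by (simp add: Pk r_def power2_eq_square algebra_simps)
    finally show ?thesis by simp
  qed
  then have "r\<^sup>2 + 2 * X \<le> P / k\<^sup>2" using k X by (simp add: pos_le_divide_eq)
  moreover have "(r + X / 4)\<^sup>2 \<le> r\<^sup>2 + 2 * X"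
  proof -
    have "r * X \<le> 3 * X" "X * X \<le> 1 * X" using r X by (intro mult_right_mono; simp)+
    then show ?thesis using X(1) by (simp add: power2_eq_square algebra_simps)
  qed
  ultimately have "(r + X / 4)\<^sup>2 \<le> (sqrt P / k)\<^sup>2" using P by (simp add: power_divide)
  then have A: "r + X / 4 \<le> sqrt P / k" by (rule power2_le_imp_le) (use P k in simp)
  define x where "x = t * cos \<theta> / (2 * sqrt P)"
  have x: "0 \<le> x" "x < 1"
    using arcsin_argument[OF t1, of \<theta> s] t c P by (auto simp: x_def P_def)
  have "x \<le> arcsin x"
  proof -
    have "sin (arcsin x) \<le> arcsin x" using x arcsin_le_arcsin[of 0 x] by (intro sin_x_le_x) auto
    then show ?thesis using x by simp
  qed
  then have "8 * pi * (t * cos \<theta>) * P * x / k \<le> 8 * pi * (t * cos \<theta>) * P * arcsin x / k"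
    using t c P k by (intro divide_right_mono mult_left_mono) auto
  also have "\<dots> = torus_density t s \<theta>" by (simp add: torus_density_def x_def P_def k_def X_def)
  also have "8 * pi * (t * cos \<theta>) * P * x / k = 4 * pi * (t * cos \<theta>)\<^sup>2 * (sqrt P / k)"
  proof -
    have "8 * pi * (t * cos \<theta>) * P * x / k = 4 * pi * (t * cos \<theta>)\<^sup>2 * ((P / sqrt P) / k)"
      by (simp add: x_def power2_eq_square)
    then show ?thesis using P by (simp add: real_div_sqrt)
  qed
  finally have "4 * pi * (t * cos \<theta>)\<^sup>2 * (sqrt P / k) \<le> torus_density t s \<theta>" .
  moreover have "4 * pi * (t * cos \<theta>)\<^sup>2 * (r + X / 4) \<le> 4 * pi * (t * cos \<theta>)\<^sup>2 * (sqrt P / k)"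
    by (intro mult_left_mono A) auto
  ultimately show ?thesis
    by (simp add: X_def gap_sin_sq_def r_def power2_eq_square algebra_simps power4_eq_xxxx)
qed

text \<open>This bound only serves to identify the quadratic coefficient, so its constant is crude. It uses
\<open>arcsin x \<le> tan (arcsin x)\<close>.\<close>

lemma torus_density_upper:
  assumes t: "0 \<le> t" "t \<le> 1 / 2" and c: "cos \<theta> \<ge> 0"
  shows "torus_density t s \<theta> \<le> 4 * pi * (cos \<theta>)\<^sup>2 * (2 + cos s) * t\<^sup>2 + 28 * pi * t ^ 4"
proof -
  define X P k r where "X = gap_sin_sq t \<theta>" and "P = radius_prod t s \<theta>" and "k = sqrt (1 - X)" and "r = 2 + cos s"
  define Y where "Y = (t * cos \<theta>)\<^sup>2 / 4"
  have t1: "\<bar>t\<bar> < 1" using t by simp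
  have tt: "t\<^sup>2 \<le> (1 / 2)\<^sup>2" using t by (intro power_mono) auto
  have "(cos \<theta>)\<^sup>2 \<le> 1" by (simp add: abs_square_le_1)
  then have "t\<^sup>2 * (cos \<theta>)\<^sup>2 \<le> t\<^sup>2 * 1" by (intro mult_left_mono) auto
  then have Y: "0 \<le> Y" "Y \<le> t\<^sup>2 / 4" "Y \<le> 1 / 16"
    using tt by (auto simp: Y_def power_mult_distrib power_divide)
  have X: "0 \<le> X" "X \<le> t\<^sup>2 / 4" "X \<le> 1 / 16"
    using gap_sin_sq_bounds[of t \<theta>] tt by (auto simp: X_def power_divide)
  have k: "k > 3 / 4" "k\<^sup>2 = 1 - X" using gap_sin_sq_less[OF t1, of \<theta>] X by (auto simp: k_def X_def)
  have P: "P > 1 / 4" using radius_prod_lower[OF t1] by (simp add: P_def)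
  have Pk: "P = 4 + 4 * cos s * k + (cos s)\<^sup>2 - X" by (simp add: P_def radius_prod_def X_def k_def)
  have r: "1 \<le> r" "r \<le> 3" unfolding r_def using cos_ge_minus_one[of s] cos_le_one[of s] by linarith+
  have k1: "1 - X \<le> k" "k \<le> 1"
  proof -
    have "X * X \<le> 1 * X" using X by (intro mult_right_mono) auto
    then have "(1 - X)\<^sup>2 \<le> k\<^sup>2" using k by (simp add: power2_eq_square algebra_simps)
    then show "1 - X \<le> k" by (rule power2_le_imp_le) (use k in simp)
    have "k\<^sup>2 \<le> 1\<^sup>2" using k X by simp
    then show "k \<le> 1" by (rule power2_le_imp_le) simp
  qed
  have Pu: "P \<le> r\<^sup>2 + 3 * X"
  proof (cases "cos s \<ge> 0")
    case True
    then have "cos s * k \<le> cos s * 1" using k1 by (intro mult_left_mono) auto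
    then show ?thesis using X(1) by (simp add: Pk r_def power2_eq_square algebra_simps)
  next
    case False
    then have "cos s * k \<le> cos s * (1 - X)" using k1 by (intro mult_left_mono_neg) auto
    moreover have "(-1) * X \<le> cos s * X" using X cos_ge_minus_one[of s] by (intro mult_right_mono)
    ultimately show ?thesis by (simp add: Pk r_def power2_eq_square algebra_simps)
  qed
  define x where "x = t * cos \<theta> / (2 * sqrt P)"
  have x: "0 \<le> x" "x < 1"
    using arcsin_argument[OF t1, of \<theta> s] t c P by (auto simp: x_def P_def)
  have xx: "x\<^sup>2 = Y / P" using P by (simp add: x_def Y_def power_divide power_mult_distrib)
  have x2: "1 - x\<^sup>2 > 0" using x by (simp add: abs_square_less_1)
  have "arcsin x \<le> x / sqrt (1 - x\<^sup>2)"
  proof -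
    have a: "0 \<le> arcsin x" "arcsin x < pi / 2"
      using x arcsin_le_arcsin[of 0 x] arcsin_lt_bounded[of x] by auto
    have "\<bar>arcsin x\<bar> \<le> \<bar>tan (arcsin x)\<bar>" using a by (intro abs_tan_ge) auto
    also have "tan (arcsin x) = x / sqrt (1 - x\<^sup>2)" using x by (simp add: tan_def cos_arcsin)
    also have "\<bar>\<dots>\<bar> = x / sqrt (1 - x\<^sup>2)" using x x2 by simp
    also have "\<bar>arcsin x\<bar> = arcsin x" using a by simp
    finally show ?thesis .
  qed
  then have "8 * pi * (t * cos \<theta>) * P * arcsin x / k \<le> 8 * pi * (t * cos \<theta>) * P * (x / sqrt (1 - x\<^sup>2)) / k"
    using t c P k by (intro divide_right_mono mult_left_mono) auto
  also have "8 * pi * (t * cos \<theta>) * P * (x / sqrt (1 - x\<^sup>2)) / k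
     = 4 * pi * (t * cos \<theta>)\<^sup>2 * (sqrt P / (k * sqrt (1 - x\<^sup>2)))"
  proof -
    have "8 * pi * (t * cos \<theta>) * P * (x / w) / k = 4 * pi * (t * cos \<theta>)\<^sup>2 * ((P / sqrt P) / (k * w))" for w
      by (simp add: x_def power2_eq_square mult_ac)
    then show ?thesis using P by (simp add: real_div_sqrt)
  qed
  finally have 1: "torus_density t s \<theta> \<le> 4 * pi * (t * cos \<theta>)\<^sup>2 * (sqrt P / (k * sqrt (1 - x\<^sup>2)))"
    by (simp add: torus_density_def x_def P_def k_def X_def)
  have 2: "sqrt P / (k * sqrt (1 - x\<^sup>2)) \<le> r + 7 * t\<^sup>2"
  proof (rule power2_le_imp_le)
    have PY: "P - Y > 0" using P Y by linarith
    have "(sqrt P / (k * sqrt (1 - x\<^sup>2)))\<^sup>2 = P / (1 - X) / (1 - Y / P)"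
      using P x2 k by (simp add: power_divide power_mult_distrib xx)
    also have "\<dots> = P\<^sup>2 / (P - Y) / (1 - X)"
      using P PY X by (simp add: field_simps power2_eq_square)
    also have "\<dots> \<le> (P + 2 * Y) / (1 - X)"
    proof (intro divide_right_mono)
      have "Y * (P - 2 * Y) \<ge> 0" using P Y by auto
      then have "P\<^sup>2 \<le> (P + 2 * Y) * (P - Y)" by (simp add: power2_eq_square algebra_simps)
      then show "P\<^sup>2 / (P - Y) \<le> P + 2 * Y" using PY by (simp add: pos_divide_le_eq)
    qed (use X in simp)
    also have "\<dots> \<le> (P + 2 * Y) * (1 + 2 * X)"
    proof -
      have "X * (1 - 2 * X) \<ge> 0" using X by simp
      then have "1 \<le> (1 + 2 * X) * (1 - X)" by (simp add: algebra_simps)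
      then have "(P + 2 * Y) * 1 \<le> (P + 2 * Y) * ((1 + 2 * X) * (1 - X))"
        using P Y by (intro mult_left_mono) auto
      then show ?thesis using X by (simp add: pos_divide_le_eq mult.assoc)
    qed
    also have "\<dots> \<le> (r\<^sup>2 + 3 * X + 2 * Y) * (1 + 2 * X)"
      using Pu X by (intro mult_right_mono) auto
    also have "\<dots> = r\<^sup>2 + 3 * X + 2 * Y + (r\<^sup>2 + 3 * X + 2 * Y) * (2 * X)" by (simp add: algebra_simps)
    also have "\<dots> \<le> r\<^sup>2 + 3 * X + 2 * Y + 10 * (2 * X)"
    proof -
      have "r\<^sup>2 \<le> 3\<^sup>2" using r by (intro power_mono) auto
      then have "(r\<^sup>2 + 3 * X + 2 * Y) * (2 * X) \<le> 10 * (2 * X)"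
        using X Y by (intro mult_right_mono) auto
      then show ?thesis by simp
    qed
    also have "\<dots> \<le> r\<^sup>2 + 2 * 1 * (7 * t\<^sup>2)" using X Y by simp
    also have "\<dots> \<le> r\<^sup>2 + 2 * r * (7 * t\<^sup>2) + (7 * t\<^sup>2)\<^sup>2"
    proof -
      have "2 * 1 * (7 * t\<^sup>2) \<le> 2 * r * (7 * t\<^sup>2)" using r by (intro mult_right_mono) auto
      moreover have "0 \<le> (7 * t\<^sup>2)\<^sup>2" by (rule zero_le_power2)
      ultimately show ?thesis by linarith
    qed
    also have "\<dots> = (r + 7 * t\<^sup>2)\<^sup>2" by (simp add: power2_sum)
    finally show "(sqrt P / (k * sqrt (1 - x\<^sup>2)))\<^sup>2 \<le> (r + 7 * t\<^sup>2)\<^sup>2" .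
  qed (use r in simp)
  have "4 * pi * (t * cos \<theta>)\<^sup>2 * (sqrt P / (k * sqrt (1 - x\<^sup>2))) \<le> 4 * pi * (t * cos \<theta>)\<^sup>2 * (r + 7 * t\<^sup>2)"
    by (intro mult_left_mono 2) auto
  also have "\<dots> = 4 * pi * (cos \<theta>)\<^sup>2 * r * t\<^sup>2 + 28 * pi * (t\<^sup>2 * (cos \<theta>)\<^sup>2) * t\<^sup>2"
    by (simp add: power_mult_distrib algebra_simps)
  also have "\<dots> \<le> 4 * pi * (cos \<theta>)\<^sup>2 * r * t\<^sup>2 + 28 * pi * (t\<^sup>2 * 1) * t\<^sup>2"
    by (intro add_left_mono mult_right_mono mult_left_mono \<open>(cos \<theta>)\<^sup>2 \<le> 1\<close>) auto
  also have "28 * pi * (t\<^sup>2 * 1) * t\<^sup>2 = 28 * pi * t ^ 4" by (simp add: power2_eq_square power4_eq_xxxx)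
  finally show ?thesis using 1 by (simp add: r_def)
qed

section \<open>Smoothness and the fourth derivative at zero\<close>

lemma taylor_bound:
  fixes D :: "nat \<Rightarrow> real \<Rightarrow> real"
  assumes D: "\<And>j t. \<bar>t\<bar> < 1 \<Longrightarrow> (D j has_real_derivative D (Suc j) t) (at t)" and n: "n > 0"
  obtains B where "\<And>t. t \<in> {0..1/2} \<Longrightarrow> \<bar>D i t - (\<Sum>m<n. D (i + m) 0 / fact m * t ^ m)\<bar> \<le> B * t ^ n" "B > 0"
proof -
  have "continuous_on {0..1/2} (D (i + n))"
    by (intro continuous_at_imp_continuous_on ballI DERIV_isCont[OF D]) auto
  then have "bounded (D (i + n) ` {0..1/2})"
    by (intro compact_imp_bounded compact_continuous_image) auto
  then obtain B where B: "B > 0" "\<And>t. t \<in> {0..1/2} \<Longrightarrow> \<bar>D (i + n) t\<bar> \<le> B"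
    unfolding bounded_pos by auto
  show thesis
  proof (rule that[of B])
    fix t :: real assume t: "t \<in> {0..1/2}"
    show "\<bar>D i t - (\<Sum>m<n. D (i + m) 0 / fact m * t ^ m)\<bar> \<le> B * t ^ n"
    proof (cases "t = 0")
      case True
      obtain k where "n = Suc k" using n by (cases n) auto
      then show ?thesis using True by (simp add: sum.lessThan_Suc_shift del: sum.lessThan_Suc)
    next
      case False
      then have t0: "0 < t" using t by simp
      have "\<exists>\<tau>>0. \<tau> < t \<and> D i t = (\<Sum>m<n. D (i + m) 0 / fact m * t ^ m) + D (i + n) \<tau> / fact n * t ^ n"
        using t D by (intro Maclaurin[OF t0 n]) auto
      then obtain \<tau> where \<tau>: "0 < \<tau>" "\<tau> < t"
        "D i t = (\<Sum>m<n. D (i + m) 0 / fact m * t ^ m) + D (i + n) \<tau> / fact n * t ^ n" by blast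
      have "\<bar>D (i + n) \<tau>\<bar> / fact n \<le> B / 1"
        using B(2)[of \<tau>] B(1) \<tau> t fact_ge_1[of n, where 'a = real] by (intro frac_le) auto
      then have "\<bar>D (i + n) \<tau> / fact n\<bar> * t ^ n \<le> B * t ^ n"
        using t0 by (intro mult_right_mono) (auto simp: abs_divide)
      then show ?thesis using \<tau>(3) t0 by (simp add: abs_mult)
    qed
  qed (rule B(1))
qed

lemma even_derivatives:
  fixes D :: "nat \<Rightarrow> real \<Rightarrow> real"
  assumes D: "\<And>j t. \<bar>t\<bar> < 1 \<Longrightarrow> (D j has_real_derivative D (Suc j) t) (at t)"
    and even: "\<And>t. \<bar>t\<bar> < 1 \<Longrightarrow> D 0 (- t) = D 0 t" and t: "\<bar>t\<bar> < 1"
  shows "D j (- t) = (-1) ^ j * D j t"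
  using t
proof (induction j arbitrary: t)
  case 0
  then show ?case using even by simp
next
  case (Suc j)
  have "(D j has_real_derivative D (Suc j) (- t)) (at (- t))" using Suc.prems by (intro D) simp
  from DERIV_chain2[OF this DERIV_minus[OF DERIV_ident]]
  have "((\<lambda>t. D j (- t)) has_real_derivative - D (Suc j) (- t)) (at t)" by simp
  moreover have "((\<lambda>t. (-1) ^ j * D j t) has_real_derivative (-1) ^ j * D (Suc j) t) (at t)"
    by (intro DERIV_cmult D Suc.prems)
  then have "((\<lambda>t. D j (- t)) has_real_derivative (-1) ^ j * D (Suc j) t) (at t)"
  proof (rule has_field_derivative_transform_within_open)
    show "open {-1<..<1::real}" "t \<in> {-1<..<1}" using Suc.prems by auto
  qed (use Suc.IH in auto)
  ultimately have "- D (Suc j) (- t) = (-1) ^ j * D (Suc j) t" by (rule DERIV_unique)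
  then show ?case by simp
qed

text \<open>The upper bound forces \<open>D 2 0 / 2 \<le> A\<close>. The lower bound then exceeds the quadratic Taylor
polynomial by at least \<open>C t\<^sup>4\<close>; evenness excludes a cubic term that could make up for it.\<close>

lemma fourth_derivative_positive:
  fixes D :: "nat \<Rightarrow> real \<Rightarrow> real"
  assumes D: "\<And>j t. \<bar>t\<bar> < 1 \<Longrightarrow> (D j has_real_derivative D (Suc j) t) (at t)"
    and even: "\<And>t. \<bar>t\<bar> < 1 \<Longrightarrow> D 0 (- t) = D 0 t"
    and lower: "\<And>t. t \<in> {0..1/2} \<Longrightarrow> A * t\<^sup>2 + C * t ^ 4 \<le> D 0 t"
    and upper: "\<And>t. t \<in> {0..1/2} \<Longrightarrow> D 0 t \<le> A * t\<^sup>2 + C' * t ^ 4" and C: "C > 0"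
  shows "D 4 0 > 0"
proof -
  have odd: "D 1 0 = 0" "D 3 0 = 0"
    using even_derivatives[where D = D, OF D even, of 0 1] even_derivatives[where D = D, OF D even, of 0 3] by auto
  have zero: "D 0 0 = 0" using lower[of 0] upper[of 0] by simp
  obtain B where B: "\<And>t. t \<in> {0..1/2} \<Longrightarrow> \<bar>D 0 t - (\<Sum>m<4. D (0 + m) 0 / fact m * t ^ m)\<bar> \<le> B * t ^ 4" "B > 0"
    using taylor_bound[where D = D, OF D, of 4 0] by auto
  obtain B' where B': "\<And>t. t \<in> {0..1/2} \<Longrightarrow> \<bar>D 0 t - (\<Sum>m<5. D (0 + m) 0 / fact m * t ^ m)\<bar> \<le> B' * t ^ 5" "B' > 0"
    using taylor_bound[where D = D, OF D, of 5 0] by auto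
  have B4: "\<bar>D 0 t - D 2 0 / 2 * t\<^sup>2\<bar> \<le> B * t ^ 4" if "t \<in> {0..1/2}" for t
    using B(1)[OF that] odd zero by (simp add: eval_nat_numeral)
  have B5: "\<bar>D 0 t - D 2 0 / 2 * t\<^sup>2 - D 4 0 / 24 * t ^ 4\<bar> \<le> B' * t ^ 5" if "t \<in> {0..1/2}" for t
    using B'(1)[OF that] odd zero by (simp add: eval_nat_numeral algebra_simps)
  have "D 2 0 / 2 \<le> A"
  proof (rule tendsto_le[of "at_right (0::real)"])
    show "((\<lambda>t. A + (C' + B) * t\<^sup>2) \<longlongrightarrow> A) (at_right 0)" by (auto intro!: tendsto_eq_intros)
    show "\<forall>\<^sub>F t in at_right 0. D 2 0 / 2 \<le> A + (C' + B) * t\<^sup>2"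
    proof -
      have "D 2 0 / 2 \<le> A + (C' + B) * t\<^sup>2" if t: "0 < t" "t < 1 / 2" for t
      proof -
        have "D 2 0 / 2 * t\<^sup>2 \<le> A * t\<^sup>2 + C' * t ^ 4 + B * t ^ 4"
          using upper[of t] B4[of t] t by auto
        also have "\<dots> = (A + (C' + B) * t\<^sup>2) * t\<^sup>2" by (simp add: algebra_simps flip: power_add)
        finally show ?thesis using t by simp
      qed
      then show ?thesis unfolding eventually_at_right_field by (intro exI[of _ "1/2"]) auto
    qed
  qed auto
  have "C \<le> D 4 0 / 24"
  proof (rule tendsto_le[of "at_right (0::real)"])
    show "((\<lambda>t. D 4 0 / 24 + B' * t) \<longlongrightarrow> D 4 0 / 24) (at_right 0)" by (auto intro!: tendsto_eq_intros)
    show "\<forall>\<^sub>F t in at_right 0. C \<le> D 4 0 / 24 + B' * t"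
    proof -
      have "C \<le> D 4 0 / 24 + B' * t" if t: "0 < t" "t < 1 / 2" for t
      proof -
        have "D 2 0 / 2 * t\<^sup>2 \<le> A * t\<^sup>2" using \<open>D 2 0 / 2 \<le> A\<close> by (rule mult_right_mono) simp
        moreover have "A * t\<^sup>2 + C * t ^ 4 \<le> D 0 t" using t by (intro lower) auto
        moreover have "D 0 t - D 2 0 / 2 * t\<^sup>2 - D 4 0 / 24 * t ^ 4 \<le> B' * t ^ 5"
          using t by (intro abs_le_D1[OF B5]) auto
        ultimately have "C * t ^ 4 \<le> D 4 0 / 24 * t ^ 4 + B' * t ^ 5" by linarith
        also have "\<dots> = (D 4 0 / 24 + B' * t) * t ^ 4" by (simp add: algebra_simps eval_nat_numeral)
        finally show ?thesis using t by simp
      qed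
      then show ?thesis unfolding eventually_at_right_field by (intro exI[of _ "1/2"]) auto
    qed
  qed auto
  then show ?thesis using C by simp
qed

definition torus_box :: "(real \<times> real) set" where
  "torus_box = cbox (- pi, - pi / 2) (pi, pi / 2)"

lemma mem_torus_box: "(s, \<theta>) \<in> torus_box \<longleftrightarrow> s \<in> {- pi..pi} \<and> \<theta> \<in> {- pi / 2..pi / 2}"
  by (auto simp: torus_box_def cbox_Pair_eq)

lemma continuous_torus_density:
  assumes t: "\<bar>t\<bar> < 1"
  shows "continuous_on S (\<lambda>(s, \<theta>). torus_density t s \<theta>)"
proof -
  have op: "open {p :: real \<times> real \<times> real. \<bar>fst p\<bar> < 1}" by (intro open_Collect_less continuous_intros)
  have "continuous_on S (\<lambda>q. (\<lambda>p. torus_density (fst p) (fst (snd p)) (snd (snd p))) (t, q))"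
    by (rule continuous_on_compose2[OF elementary_continuous_on[OF op elementary_torus_density]])
      (use t in \<open>auto intro!: continuous_intros\<close>)
  then show ?thesis by (simp add: case_prod_unfold)
qed

lemma torus_distribution:
  obtains D :: "nat \<Rightarrow> real \<Rightarrow> real" where
    "D 0 = (\<lambda>t. integral torus_box (\<lambda>(s, \<theta>). torus_density t s \<theta>))"
    "\<And>j t. \<bar>t\<bar> < 1 \<Longrightarrow> (D j has_real_derivative D (Suc j) t) (at t)" "D 4 0 > 0"
proof -
  have op: "open {p :: real \<times> real \<times> real. \<bar>fst p\<bar> < 1}" by (intro open_Collect_less continuous_intros)
  have sub: "{-1<..<1} \<times> torus_box \<subseteq> {p :: real \<times> real \<times> real. \<bar>fst p\<bar> < 1}" by auto
  obtain D :: "nat \<Rightarrow> real \<Rightarrow> real" where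
    D: "D 0 = (\<lambda>t. integral torus_box (\<lambda>q. torus_density (fst (t, q)) (fst (snd (t, q))) (snd (snd (t, q)))))"
    "\<And>j t. t \<in> {-1<..<1} \<Longrightarrow> (D j has_real_derivative D (Suc j) t) (at t)"
    using elementary_parametric_integral[OF op elementary_torus_density sub[unfolded torus_box_def]]
    unfolding torus_box_def by blast
  have D0: "D 0 = (\<lambda>t. integral torus_box (\<lambda>(s, \<theta>). torus_density t s \<theta>))"
    unfolding D(1) by (simp add: case_prod_unfold)
  have D': "(D j has_real_derivative D (Suc j) t) (at t)" if "\<bar>t\<bar> < 1" for j t
    using that by (intro D(2)) auto
  have int: "(\<lambda>(s, \<theta>). torus_density t s \<theta>) integrable_on torus_box" if "\<bar>t\<bar> < 1" for t
    unfolding torus_box_def by (intro integrable_continuous continuous_torus_density that)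
  define a where "a = (\<lambda>(s::real, \<theta>). 4 * pi * (cos \<theta>)\<^sup>2 * (2 + cos s))"
  define b where "b = (\<lambda>(s::real, \<theta>). pi * (cos \<theta>)\<^sup>2 * (sin \<theta>)\<^sup>2 / 4)"
  have ab: "a integrable_on torus_box" "b integrable_on torus_box"
    unfolding torus_box_def a_def b_def case_prod_unfold
    by (intro integrable_continuous continuous_intros; simp)+
  have int_ab: "integral torus_box a * t\<^sup>2 + integral torus_box b * t ^ 4 = integral torus_box (\<lambda>q. a q * t\<^sup>2 + b q * t ^ 4)" for t
    using ab by (simp add: integral_add integrable_on_mult_left)
  have int_a1: "integral torus_box a * t\<^sup>2 + integral torus_box (\<lambda>_. 28 * pi) * t ^ 4 = integral torus_box (\<lambda>q. a q * t\<^sup>2 + 28 * pi * t ^ 4)" for t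
  proof -
    have "(\<lambda>_. 28 * pi * t ^ 4) integrable_on torus_box" unfolding torus_box_def by (rule integrable_const)
    then have "integral torus_box (\<lambda>q. a q * t\<^sup>2 + 28 * pi * t ^ 4) = integral torus_box (\<lambda>q. a q * t\<^sup>2) + integral torus_box (\<lambda>q. 28 * pi * t ^ 4)"
      by (rule integral_add[OF integrable_on_mult_left[OF ab(1)]])
    then show ?thesis by (simp only: integral_mult_left)
  qed
  have cos: "cos \<theta> \<ge> 0" if "(s, \<theta>) \<in> torus_box" for s \<theta>
    using that by (intro cos_ge_zero) (auto simp: mem_torus_box)
  have "D 4 0 > 0"
  proof (rule fourth_derivative_positive[where D = D, OF D'])
    show "D 0 (- t) = D 0 t" if "\<bar>t\<bar> < 1" for t
    proof -
      have "(\<lambda>(s, \<theta>). torus_density (- t) s \<theta>) = (\<lambda>(s, \<theta>). torus_density t s \<theta>)"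
        using torus_density_even[OF that] by auto
      then show ?thesis by (simp only: D0)
    qed
    show "integral torus_box a * t\<^sup>2 + integral torus_box b * t ^ 4 \<le> D 0 t" if t: "t \<in> {0..1/2}" for t
      unfolding int_ab D0
    proof (rule integral_le)
      show "(\<lambda>q. a q * t\<^sup>2 + b q * t ^ 4) integrable_on torus_box"
        using ab by (intro integrable_add integrable_on_mult_left)
      show "(\<lambda>(s, \<theta>). torus_density t s \<theta>) integrable_on torus_box" using t by (intro int) auto
      fix q assume "q \<in> torus_box"
      then show "a q * t\<^sup>2 + b q * t ^ 4 \<le> (case q of (s, \<theta>) \<Rightarrow> torus_density t s \<theta>)"
        using t torus_density_lower[of t] cos by (cases q) (auto simp: a_def b_def)
    qed
    show "D 0 t \<le> integral torus_box a * t\<^sup>2 + integral torus_box (\<lambda>_. 28 * pi) * t ^ 4" if t: "t \<in> {0..1/2}" for t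
      unfolding int_a1 D0
    proof (rule integral_le)
      show "(\<lambda>q. a q * t\<^sup>2 + 28 * pi * t ^ 4) integrable_on torus_box"
        unfolding torus_box_def using ab by (intro integrable_add integrable_on_mult_left integrable_const) (simp_all add: torus_box_def)
      show "(\<lambda>(s, \<theta>). torus_density t s \<theta>) integrable_on torus_box" using t by (intro int) auto
      fix q assume "q \<in> torus_box"
      then show "(case q of (s, \<theta>) \<Rightarrow> torus_density t s \<theta>) \<le> a q * t\<^sup>2 + 28 * pi * t ^ 4"
        using t torus_density_upper[of t] cos by (cases q) (auto simp: a_def)
    qed
    show "integral torus_box b > 0"
    proof -
      \<comment> \<open>On this box both \<open>sin \<theta>\<close> and \<open>cos \<theta>\<close> are at least \<open>1/2\<close>.\<close>
      let ?K = "cbox (0, pi / 6) (1, pi / 3) :: (real \<times> real) set"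
      have K: "?K \<subseteq> torus_box" using pi_gt3 by (auto simp: torus_box_def cbox_Pair_eq)
      have "0 < integral ?K (\<lambda>_. pi * (1 / 2)\<^sup>2 * (1 / 2)\<^sup>2 / 4)"
        by (simp add: content_Pair)
      also have "\<dots> \<le> integral ?K b"
      proof (rule integral_le)
        show "b integrable_on ?K" using ab(2) K by (simp add: integrable_on_subcbox torus_box_def)
        fix q assume q: "q \<in> ?K"
        obtain s \<theta> where q': "q = (s, \<theta>)" by (cases q)
        have \<theta>: "pi / 6 \<le> \<theta>" "\<theta> \<le> pi / 3" using q by (auto simp: q' cbox_Pair_eq)
        have "cos (pi / 3) \<le> cos \<theta>" using \<theta> by (intro cos_monotone_0_pi_le) auto
        moreover have "sin (pi / 6) \<le> sin \<theta>" using \<theta> by (intro sin_monotone_2pi_le) auto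
        ultimately have "(1 / 2)\<^sup>2 \<le> (cos \<theta>)\<^sup>2" "(1 / 2)\<^sup>2 \<le> (sin \<theta>)\<^sup>2"
          by (auto simp: cos_60 sin_30 intro!: power_mono)
        then have "(1 / 2)\<^sup>2 * (1 / 2)\<^sup>2 \<le> (cos \<theta>)\<^sup>2 * (sin \<theta>)\<^sup>2" by (intro mult_mono) auto
        then have "pi * ((1 / 2)\<^sup>2 * (1 / 2)\<^sup>2) / 4 \<le> pi * ((cos \<theta>)\<^sup>2 * (sin \<theta>)\<^sup>2) / 4"
          by (intro divide_right_mono mult_left_mono) auto
        then show "pi * (1 / 2)\<^sup>2 * (1 / 2)\<^sup>2 / 4 \<le> b q" by (simp add: b_def q' mult.assoc)
      qed (rule integrable_const)
      also have "\<dots> \<le> integral torus_box b"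
        using K ab(2) by (intro integral_subset_le) (auto simp: b_def integrable_on_subcbox torus_box_def)
      finally show ?thesis .
    qed
  qed
  then show thesis using that D0 D' by blast
qed

section \<open>Integration over periods\<close>

definition centered_lebesgue :: "real \<Rightarrow> real measure" where
  "centered_lebesgue b = density lborel (indicator {-b..b})"

lemma sets_centered_lebesgue [measurable_cong, simp]: "sets (centered_lebesgue b) = sets borel"
  by (simp add: centered_lebesgue_def)

lemma nn_integral_centered_lebesgue:
  "f \<in> borel_measurable borel \<Longrightarrow> (\<integral>\<^sup>+x. f x \<partial>centered_lebesgue b) = (\<integral>\<^sup>+x\<in>{-b..b}. f x \<partial>lborel)"
  unfolding centered_lebesgue_def by (subst nn_integral_density) (auto simp: mult.commute)

lemma emeasure_centered_lebesgue: "b \<ge> 0 \<Longrightarrow> emeasure (centered_lebesgue b) UNIV = ennreal (2 * b)"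
  unfolding centered_lebesgue_def by (subst emeasure_density) auto

lemma finite_centered_lebesgue: "finite_measure (centered_lebesgue b)"
proof
  have "emeasure (centered_lebesgue b) UNIV = emeasure lborel {-b..b}"
    unfolding centered_lebesgue_def by (subst emeasure_density) auto
  then show "emeasure (centered_lebesgue b) (space (centered_lebesgue b)) \<noteq> \<infinity>"
    by (simp add: centered_lebesgue_def emeasure_lborel_Icc_eq)
qed

interpretation centered: finite_measure "centered_lebesgue b" for b by (rule finite_centered_lebesgue)

interpretation centered_pair: pair_sigma_finite "centered_lebesgue b" "centered_lebesgue b'" for b b' ..

lemma nn_integral_translate:
  fixes f :: "real \<Rightarrow> ennreal"
  assumes "f \<in> borel_measurable borel"
  shows "(\<integral>\<^sup>+x. f (x + c) \<partial>lborel) = (\<integral>\<^sup>+x. f x \<partial>lborel)"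
  using nn_integral_real_affine[OF assms, of 1 c] by (simp add: add.commute)

text \<open>Translation invariance over a period decouples the two longitudes and allows the passage to sums and
differences of the meridional angles.\<close>

lemma nn_integral_periodic_shift:
  fixes f :: "real \<Rightarrow> ennreal"
  assumes [measurable]: "f \<in> borel_measurable borel" and per: "\<And>x. f (x + 2 * pi) = f x"
  shows "(\<integral>\<^sup>+x. f (x + c) \<partial>centered_lebesgue pi) = (\<integral>\<^sup>+x. f x \<partial>centered_lebesgue pi)"
proof -
  have nat: "f (x + real n * (2 * pi)) = f x" for x n
  proof (induction n)
    case (Suc n)
    have "f (x + real (Suc n) * (2 * pi)) = f ((x + real n * (2 * pi)) + 2 * pi)" by (simp add: algebra_simps)
    then show ?case using per Suc by simp
  qed simp
  have int: "f (x + of_int k * (2 * pi)) = f x" for x k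
  proof (cases k)
    case (nonneg n)
    then show ?thesis using nat[of x n] by simp
  next
    case (neg n)
    have "f (x + of_int k * (2 * pi)) = f ((x + of_int k * (2 * pi)) + real (Suc n) * (2 * pi))"
      by (simp only: nat)
    also have "(x + of_int k * (2 * pi)) + real (Suc n) * (2 * pi) = x"
      unfolding neg by (simp add: algebra_simps)
    finally show ?thesis .
  qed
  have main: "(\<integral>\<^sup>+x\<in>{-pi..pi}. f (x + c) \<partial>lborel) = (\<integral>\<^sup>+x\<in>{-pi..pi}. f x \<partial>lborel)"
    if c: "0 \<le> c" "c \<le> 2 * pi" for c
  proof -
    have "(\<integral>\<^sup>+x\<in>{-pi..pi}. f (x + c) \<partial>lborel) = (\<integral>\<^sup>+x. f (x + c) * indicator {c-pi..c+pi} (x + c) \<partial>lborel)"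
      by (intro nn_integral_cong) (auto simp: indicator_def)
    also have "\<dots> = (\<integral>\<^sup>+x. f x * indicator {c-pi..c+pi} x \<partial>lborel)"
      by (rule nn_integral_translate[of "\<lambda>x. f x * indicator {c-pi..c+pi} x"]) measurable
    also have "\<dots> = (\<integral>\<^sup>+x. f x * indicator {c-pi..pi} x + f x * indicator {pi<..c+pi} x \<partial>lborel)"
      using c by (intro nn_integral_cong) (auto simp: indicator_def)
    also have "\<dots> = (\<integral>\<^sup>+x. f x * indicator {c-pi..pi} x \<partial>lborel) + (\<integral>\<^sup>+x. f x * indicator {pi<..c+pi} x \<partial>lborel)"
      by (rule nn_integral_add) auto
    also have "(\<integral>\<^sup>+x. f x * indicator {pi<..c+pi} x \<partial>lborel)
        = (\<integral>\<^sup>+x. f (x + 2 * pi) * indicator {pi<..c+pi} (x + 2 * pi) \<partial>lborel)"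
      by (rule nn_integral_translate[symmetric, of "\<lambda>x. f x * indicator {pi<..c+pi} x"]) measurable
    also have "\<dots> = (\<integral>\<^sup>+x. f x * indicator {-pi<..c-pi} x \<partial>lborel)"
      by (intro nn_integral_cong) (auto simp: indicator_def per)
    also have "(\<integral>\<^sup>+x. f x * indicator {c-pi..pi} x \<partial>lborel) + (\<integral>\<^sup>+x. f x * indicator {-pi<..c-pi} x \<partial>lborel)
        = (\<integral>\<^sup>+x. f x * indicator {c-pi..pi} x + f x * indicator {-pi<..c-pi} x \<partial>lborel)"
      by (rule nn_integral_add[symmetric]) auto
    also have "\<dots> = (\<integral>\<^sup>+x\<in>{-pi..pi}. f x \<partial>lborel)"
    proof (rule nn_integral_cong_AE)
      have "AE x in lborel. x \<noteq> c - pi" "AE x in lborel. x \<noteq> - pi" by (auto intro: AE_lborel_singleton)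
      then show "AE x in lborel. f x * indicator {c-pi..pi} x + f x * indicator {-pi<..c-pi} x = f x * indicator {-pi..pi} x"
        by eventually_elim (use c in \<open>auto simp: indicator_def\<close>)
    qed
    finally show ?thesis .
  qed
  define k where "k = \<lfloor>c / (2 * pi)\<rfloor>"
  have "of_int k \<le> c / (2 * pi)" "c / (2 * pi) < of_int k + 1"
    unfolding k_def by linarith+
  then have "of_int k * (2 * pi) \<le> c" "c < (of_int k + 1) * (2 * pi)"
    by (simp_all add: pos_le_divide_eq pos_divide_less_eq)
  then have c': "0 \<le> c - of_int k * (2 * pi)" "c - of_int k * (2 * pi) \<le> 2 * pi"
    by (simp_all add: algebra_simps)
  have "f (x + c) = f (x + (c - of_int k * (2 * pi)))" for x
    using int[of "x + (c - of_int k * (2 * pi))" k] by (simp add: algebra_simps)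
  then show ?thesis using main[OF c'] by (simp add: nn_integral_centered_lebesgue)
qed

lemma nn_integral_double:
  fixes f :: "real \<Rightarrow> ennreal"
  assumes [measurable]: "f \<in> borel_measurable borel"
  shows "(\<integral>\<^sup>+x. f x \<partial>centered_lebesgue pi) = 2 * (\<integral>\<^sup>+x. f (2 * x) \<partial>centered_lebesgue (pi / 2))"
proof -
  have "(\<integral>\<^sup>+x. f x * indicator {-pi..pi} x \<partial>lborel)
      = ennreal \<bar>2\<bar> * (\<integral>\<^sup>+x. f (0 + 2 * x) * indicator {-pi..pi} (0 + 2 * x) \<partial>lborel)"
    by (rule nn_integral_real_affine) auto
  also have "(\<integral>\<^sup>+x. f (0 + 2 * x) * indicator {-pi..pi} (0 + 2 * x) \<partial>lborel)
      = (\<integral>\<^sup>+x. f (2 * x) * indicator {-(pi/2)..pi/2} x \<partial>lborel)"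
    by (intro nn_integral_cong) (auto simp: indicator_def)
  finally show ?thesis by (simp add: nn_integral_centered_lebesgue)
qed

section \<open>The distance distribution of the torus\<close>

abbreviation "T2 \<equiv> rev_surface 2"

interpretation torus: measured_surface T2 "rev_area 2"
  by (intro measured_surface.intro closed_surface_torus is_area_measure_rev_area finite_rev_area) simp

definition torus_chord_sq :: "real \<Rightarrow> real \<Rightarrow> real \<Rightarrow> real" where
  "torus_chord_sq u v m = 2 * (1 - cos (u - v)) + 2 * ((2 + cos u) * (2 + cos v)) * (1 - cos m)"

text \<open>The squared chord separates the two angles up to the factor \<open>(2 + cos u) (2 + cos v)\<close>, which depends on
  the meridional angles only. The longitudes can therefore be integrated out first.\<close>

lemma dist_torus: "(dist (rev_point 2 a u) (rev_point 2 b v))\<^sup>2 = torus_chord_sq u v (b - a)"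
proof -
  define p q where "p = 2 + cos u" and "q = 2 + cos v"
  have expand: "(p * ca - q * cb)\<^sup>2 + (p * sa - q * sb)\<^sup>2
     = p\<^sup>2 * (sa\<^sup>2 + ca\<^sup>2) + q\<^sup>2 * (sb\<^sup>2 + cb\<^sup>2) - 2 * (p * q) * (cb * ca + sb * sa)" for p q ca cb sa sb :: real
    by (simp add: power2_eq_square algebra_simps)
  have c: "cos u = p - 2" "cos v = q - 2" by (simp_all add: p_def q_def)
  have "(p * cos a - q * cos b)\<^sup>2 + (p * sin a - q * sin b)\<^sup>2
     = p\<^sup>2 * ((sin a)\<^sup>2 + (cos a)\<^sup>2) + q\<^sup>2 * ((sin b)\<^sup>2 + (cos b)\<^sup>2) - 2 * (p * q) * cos (b - a)"
    unfolding cos_diff by (rule expand)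
  also have "\<dots> = (p - q)\<^sup>2 + 2 * (p * q) * (1 - cos (b - a))"
    by (simp add: power2_eq_square algebra_simps)
  also have "(p - q)\<^sup>2 = (cos u - cos v)\<^sup>2" by (simp add: c)
  finally have 1: "(p * cos a - q * cos b)\<^sup>2 + (p * sin a - q * sin b)\<^sup>2
     = (cos u - cos v)\<^sup>2 + 2 * (p * q) * (1 - cos (b - a))" .
  have "(cos u - cos v)\<^sup>2 + (sin u - sin v)\<^sup>2 = 2 * (1 - cos (u - v))"
    using expand[of 1 "cos v" 1 "cos u" "sin v" "sin u"] unfolding cos_diff
    by (simp add: power2_commute algebra_simps)
  then show ?thesis using 1 unfolding dist_square_3 by (simp add: torus_chord_sq_def p_def q_def)
qed

text \<open>The area densities of both points, restricted to the pairs of distance at most \<open>t\<close>; then the integral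
over the difference of the longitudes.\<close>

definition pair_density :: "real \<Rightarrow> real \<Rightarrow> real \<Rightarrow> real \<Rightarrow> ennreal" where
  "pair_density t u v m = (if torus_chord_sq u v m \<le> t\<^sup>2 then ennreal ((2 + cos u) * (2 + cos v)) else 0)"

definition circle_integral :: "real \<Rightarrow> real \<Rightarrow> real \<Rightarrow> ennreal" where
  "circle_integral t u v = (\<integral>\<^sup>+m. pair_density t u v m \<partial>centered_lebesgue pi)"

lemma pair_density_measurable [measurable (raw)]:
  assumes [measurable]: "f \<in> borel_measurable N" "g \<in> borel_measurable N" "h \<in> borel_measurable N"
  shows "(\<lambda>x. pair_density t (f x) (g x) (h x)) \<in> borel_measurable N"
  unfolding pair_density_def torus_chord_sq_def by measurable

lemma circle_integral_measurable [measurable (raw)]: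
  assumes [measurable]: "f \<in> borel_measurable N" "g \<in> borel_measurable N"
  shows "(\<lambda>x. circle_integral t (f x) (g x)) \<in> borel_measurable N"
  unfolding circle_integral_def by measurable

lemma circle_integral_periodic:
  "circle_integral t (u + 2 * pi) v = circle_integral t u v"
  "circle_integral t u (v + 2 * pi) = circle_integral t u v"
proof -
  have c: "cos (u + 2 * pi - v) = cos (u - v)" "cos (u - (v + 2 * pi)) = cos (u - v)"
    using cos_periodic[of "u - v"] cos_periodic[of "u - (v + 2 * pi)"] by (simp_all add: algebra_simps)
  show "circle_integral t (u + 2 * pi) v = circle_integral t u v"
    "circle_integral t u (v + 2 * pi) = circle_integral t u v"
    unfolding circle_integral_def pair_density_def torus_chord_sq_def c cos_periodic by (rule refl)+
qed

lemma circle_integral_shift: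
  "(\<integral>\<^sup>+b. pair_density t u v (b - a) \<partial>centered_lebesgue pi) = circle_integral t u v"
proof -
  have "(\<integral>\<^sup>+b. pair_density t u v (b + (- a)) \<partial>centered_lebesgue pi) = circle_integral t u v"
    unfolding circle_integral_def
    by (rule nn_integral_periodic_shift) (auto simp: pair_density_def torus_chord_sq_def)
  then show ?thesis by simp
qed

lemma nn_integral_rev_area_centered:
  assumes [measurable]: "g \<in> borel_measurable borel"
  shows "(\<integral>\<^sup>+x. g x \<partial>rev_area R)
    = (\<integral>\<^sup>+a. \<integral>\<^sup>+v. ennreal (R + cos v) * g (rev_point R a v) \<partial>centered_lebesgue pi \<partial>centered_lebesgue pi)"
  unfolding nn_integral_rev_area[OF assms] by (simp add: nn_integral_centered_lebesgue)

text \<open>One longitude contributes the factor \<open>2 \<pi>\<close>. The new variables are half the sum and half the difference of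
the meridional angles, whence \<open>w\<close> runs over half a period and another factor \<open>2\<close> appears.\<close>

lemma emeasure_close_pairs_torus:
  assumes t: "t \<ge> 0"
  shows "emeasure (rev_area 2 \<Otimes>\<^sub>M rev_area 2) {(x, y). x \<in> T2 \<and> y \<in> T2 \<and> dist x y \<le> t}
    = ennreal (4 * pi) * (\<integral>\<^sup>+s. \<integral>\<^sup>+w. circle_integral t (s + w) (s - w)
        \<partial>centered_lebesgue (pi / 2) \<partial>centered_lebesgue pi)"
proof -
  let ?N = "centered_lebesgue pi" and ?H = "centered_lebesgue (pi / 2)"
  have ball: "emeasure (rev_area 2) {y. dist x y \<le> t}
     = (\<integral>\<^sup>+b. \<integral>\<^sup>+v. ennreal (2 + cos v) * indicator {y. dist x y \<le> t} (rev_point 2 b v) \<partial>?N \<partial>?N)" for x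
  proof -
    have "emeasure (rev_area 2) {y. dist x y \<le> t} = (\<integral>\<^sup>+y. indicator {y. dist x y \<le> t} y \<partial>rev_area 2)"
      by (rule nn_integral_indicator[symmetric]) (simp add: rev_area_def)
    also have "\<dots> = (\<integral>\<^sup>+b. \<integral>\<^sup>+v. ennreal (2 + cos v) * indicator {y. dist x y \<le> t} (rev_point 2 b v) \<partial>?N \<partial>?N)"
      by (rule nn_integral_rev_area_centered) simp
    finally show ?thesis .
  qed
  have "(\<lambda>x. \<integral>\<^sup>+b. \<integral>\<^sup>+v. ennreal (2 + cos v) * (if dist x (rev_point 2 b v) \<le> t then 1 else 0) \<partial>?N \<partial>?N) \<in> borel_measurable borel"
    by measurable
  then have [measurable]: "(\<lambda>x. emeasure (rev_area 2) {y. dist x y \<le> t}) \<in> borel_measurable borel"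
    unfolding ball by (simp add: indicator_def)
  have ind: "ennreal (2 + cos u) * (ennreal (2 + cos v) * indicator {y. dist (rev_point 2 a u) y \<le> t} (rev_point 2 b v))
     = pair_density t u v (b - a)" for a b u v
  proof -
    have "dist (rev_point 2 a u) (rev_point 2 b v) \<le> t \<longleftrightarrow> torus_chord_sq u v (b - a) \<le> t\<^sup>2"
      unfolding dist_torus[symmetric] using t by (simp add: power2_le_iff_abs_le)
    moreover have "2 + cos u \<ge> 0" "2 + cos v \<ge> 0" using cos_ge_minus_one[of u] cos_ge_minus_one[of v] by linarith+
    ultimately show ?thesis by (simp add: pair_density_def indicator_def ennreal_mult)
  qed
  have "emeasure (rev_area 2 \<Otimes>\<^sub>M rev_area 2) {(x, y). x \<in> T2 \<and> y \<in> T2 \<and> dist x y \<le> t}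
     = (\<integral>\<^sup>+a. \<integral>\<^sup>+u. ennreal (2 + cos u) * emeasure (rev_area 2) {y. dist (rev_point 2 a u) y \<le> t} \<partial>?N \<partial>?N)"
    unfolding torus.emeasure_close_pairs by (rule nn_integral_rev_area_centered) measurable
  also have "\<dots> = (\<integral>\<^sup>+a. \<integral>\<^sup>+u. \<integral>\<^sup>+b. \<integral>\<^sup>+v. pair_density t u v (b - a) \<partial>?N \<partial>?N \<partial>?N \<partial>?N)"
  proof (intro nn_integral_cong)
    fix a u
    have "ennreal (2 + cos u) * emeasure (rev_area 2) {y. dist (rev_point 2 a u) y \<le> t}
      = (\<integral>\<^sup>+b. ennreal (2 + cos u) * (\<integral>\<^sup>+v. ennreal (2 + cos v) * indicator {y. dist (rev_point 2 a u) y \<le> t} (rev_point 2 b v) \<partial>?N) \<partial>?N)"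
      unfolding ball by (rule nn_integral_cmult[symmetric]) measurable
    also have "\<dots> = (\<integral>\<^sup>+b. \<integral>\<^sup>+v. pair_density t u v (b - a) \<partial>?N \<partial>?N)"
      unfolding ind[symmetric] by (intro nn_integral_cong nn_integral_cmult[symmetric]) measurable
    finally show "ennreal (2 + cos u) * emeasure (rev_area 2) {y. dist (rev_point 2 a u) y \<le> t}
      = (\<integral>\<^sup>+b. \<integral>\<^sup>+v. pair_density t u v (b - a) \<partial>?N \<partial>?N)" .
  qed
  also have "\<dots> = (\<integral>\<^sup>+a. \<integral>\<^sup>+u. \<integral>\<^sup>+v. circle_integral t u v \<partial>?N \<partial>?N \<partial>?N)"
  proof (rule nn_integral_cong, rule nn_integral_cong)
    fix a u
    have "(\<integral>\<^sup>+b. \<integral>\<^sup>+v. pair_density t u v (b - a) \<partial>?N \<partial>?N) = (\<integral>\<^sup>+v. \<integral>\<^sup>+b. pair_density t u v (b - a) \<partial>?N \<partial>?N)"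
      by (rule centered_pair.Fubini'[symmetric]) measurable
    then show "(\<integral>\<^sup>+b. \<integral>\<^sup>+v. pair_density t u v (b - a) \<partial>?N \<partial>?N) = (\<integral>\<^sup>+v. circle_integral t u v \<partial>?N)"
      by (simp add: circle_integral_shift)
  qed
  also have "\<dots> = (\<integral>\<^sup>+u. \<integral>\<^sup>+v. circle_integral t u v \<partial>?N \<partial>?N) * ennreal (2 * pi)"
  proof -
    have "space ?N = UNIV" by (simp add: centered_lebesgue_def)
    then show ?thesis by (simp add: emeasure_centered_lebesgue)
  qed
  also have "(\<integral>\<^sup>+u. \<integral>\<^sup>+v. circle_integral t u v \<partial>?N \<partial>?N) = (\<integral>\<^sup>+v. \<integral>\<^sup>+u. circle_integral t u v \<partial>?N \<partial>?N)"
    by (rule centered_pair.Fubini'[symmetric]) measurable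
  also have "\<dots> = (\<integral>\<^sup>+v. \<integral>\<^sup>+m. circle_integral t (m + v) v \<partial>?N \<partial>?N)"
    by (rule nn_integral_cong, rule nn_integral_periodic_shift[symmetric])
      (measurable, rule circle_integral_periodic)
  also have "\<dots> = (\<integral>\<^sup>+v. 2 * (\<integral>\<^sup>+w. circle_integral t (2 * w + v) v \<partial>?H) \<partial>?N)"
    by (intro nn_integral_cong nn_integral_double) measurable
  also have "\<dots> = 2 * (\<integral>\<^sup>+v. \<integral>\<^sup>+w. circle_integral t (2 * w + v) v \<partial>?H \<partial>?N)"
    by (rule nn_integral_cmult) measurable
  also have "(\<integral>\<^sup>+v. \<integral>\<^sup>+w. circle_integral t (2 * w + v) v \<partial>?H \<partial>?N) = (\<integral>\<^sup>+w. \<integral>\<^sup>+v. circle_integral t (2 * w + v) v \<partial>?N \<partial>?H)"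
    by (rule centered_pair.Fubini'[symmetric]) measurable
  also have "\<dots> = (\<integral>\<^sup>+w. \<integral>\<^sup>+s. circle_integral t (s + w) (s - w) \<partial>?N \<partial>?H)"
  proof (rule nn_integral_cong)
    fix w
    have "(\<integral>\<^sup>+s. (\<lambda>v. circle_integral t (2 * w + v) v) (s + (- w)) \<partial>?N) = (\<integral>\<^sup>+v. circle_integral t (2 * w + v) v \<partial>?N)"
      using circle_integral_periodic
      by (intro nn_integral_periodic_shift) (measurable, simp add: add.assoc[symmetric])
    moreover have "2 * w + (s + (- w)) = s + w" for s by simp
    ultimately show "(\<integral>\<^sup>+v. circle_integral t (2 * w + v) v \<partial>?N) = (\<integral>\<^sup>+s. circle_integral t (s + w) (s - w) \<partial>?N)"
      by (simp add: add.commute)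
  qed
  also have "\<dots> = (\<integral>\<^sup>+s. \<integral>\<^sup>+w. circle_integral t (s + w) (s - w) \<partial>?H \<partial>?N)"
    by (rule centered_pair.Fubini'[symmetric]) measurable
  finally have "emeasure (rev_area 2 \<Otimes>\<^sub>M rev_area 2) {(x, y). x \<in> T2 \<and> y \<in> T2 \<and> dist x y \<le> t}
    = 2 * (\<integral>\<^sup>+s. \<integral>\<^sup>+w. circle_integral t (s + w) (s - w) \<partial>?H \<partial>?N) * ennreal (2 * pi)" .
  moreover have "ennreal (4 * pi) = 2 * ennreal (2 * pi)" using ennreal_mult[of 2 "2 * pi"] by simp
  ultimately show ?thesis by (simp only: mult_ac)
qed

definition radius_prod_at :: "real \<Rightarrow> real \<Rightarrow> real" where
  "radius_prod_at s w = 4 + 4 * cos s * cos w + (cos s)\<^sup>2 - (sin w)\<^sup>2"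

lemma radius_prod_at: "(2 + cos (s + w)) * (2 + cos (s - w)) = radius_prod_at s w"
proof -
  have "(2 + cos (s + w)) * (2 + cos (s - w)) = 4 + 4 * cos s * cos w + ((cos s)\<^sup>2 * (cos w)\<^sup>2 - (sin s)\<^sup>2 * (sin w)\<^sup>2)"
    by (simp add: cos_add cos_diff power2_eq_square algebra_simps)
  also have "(cos s)\<^sup>2 * (cos w)\<^sup>2 - (sin s)\<^sup>2 * (sin w)\<^sup>2 = (cos s)\<^sup>2 - (sin w)\<^sup>2"
    unfolding sin_squared_eq by (simp add: algebra_simps)
  finally show ?thesis by (simp add: radius_prod_at_def)
qed

lemma radius_prod_at_ge: "radius_prod_at s w \<ge> 1"
proof -
  have "1 \<le> 2 + cos (s + w)" "1 \<le> 2 + cos (s - w)"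
    using cos_ge_minus_one[of "s + w"] cos_ge_minus_one[of "s - w"] by linarith+
  then have "1 * 1 \<le> (2 + cos (s + w)) * (2 + cos (s - w))" by (intro mult_mono) auto
  then show ?thesis by (simp add: radius_prod_at)
qed

lemma abs_sin_le_iff:
  assumes "\<bar>x\<bar> \<le> pi / 2" "0 \<le> b" "b \<le> 1"
  shows "\<bar>sin x\<bar> \<le> b \<longleftrightarrow> \<bar>x\<bar> \<le> arcsin b"
proof -
  have "\<bar>sin x\<bar> = sin \<bar>x\<bar>"
  proof (cases "x \<ge> 0")
    case True
    then show ?thesis using assms sin_ge_zero[of x] by auto
  next
    case False
    then show ?thesis using assms sin_ge_zero[of "- x"] by auto
  qed
  then show ?thesis using le_arcsin_iff[of b "\<bar>x\<bar>"] assms by simp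
qed

lemma circle_integral_sum_difference:
  assumes t: "0 \<le> t" "t < 1"
  shows "circle_integral t (s + w) (s - w) = (if 2 * \<bar>sin w\<bar> \<le> t
    then ennreal (4 * radius_prod_at s w * arcsin (sqrt (t\<^sup>2 - 4 * (sin w)\<^sup>2) / (2 * sqrt (radius_prod_at s w)))) else 0)"
proof -
  let ?P = "radius_prod_at s w"
  have P: "?P \<ge> 1" by (rule radius_prod_at_ge)
  have ch: "torus_chord_sq (s + w) (s - w) m = 4 * (sin w)\<^sup>2 + 4 * ?P * (sin (m / 2))\<^sup>2" for m
  proof -
    have "cos (s + w - (s - w)) = 1 - 2 * (sin w)\<^sup>2" using cos_double_sin[of w] by simp
    moreover have "cos m = 1 - 2 * (sin (m / 2))\<^sup>2" using cos_double_sin[of "m / 2"] by simp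
    ultimately show ?thesis by (simp add: torus_chord_sq_def radius_prod_at)
  qed
  have le: "4 * (sin w)\<^sup>2 \<le> t\<^sup>2 \<longleftrightarrow> 2 * \<bar>sin w\<bar> \<le> t"
    using abs_le_square_iff[of "2 * sin w" t] t by (simp add: power_mult_distrib abs_mult)
  show ?thesis
  proof (cases "2 * \<bar>sin w\<bar> \<le> t")
    case False
    then have "t\<^sup>2 < 4 * (sin w)\<^sup>2" using le by linarith
    moreover have "4 * ?P * (sin (m / 2))\<^sup>2 \<ge> 0" for m using P by simp
    ultimately have "\<not> torus_chord_sq (s + w) (s - w) m \<le> t\<^sup>2" for m unfolding ch by (smt (verit))
    then show ?thesis using False by (simp add: circle_integral_def pair_density_def)
  next
    case True
    define b where "b = sqrt (t\<^sup>2 - 4 * (sin w)\<^sup>2) / (2 * sqrt ?P)"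
    have nn: "t\<^sup>2 - 4 * (sin w)\<^sup>2 \<ge> 0" using True le by simp
    have b2: "b\<^sup>2 = (t\<^sup>2 - 4 * (sin w)\<^sup>2) / (4 * ?P)"
      using nn P by (simp add: b_def power_divide power_mult_distrib)
    have "t\<^sup>2 \<le> 1" using t by (simp add: abs_square_le_1)
    then have "t\<^sup>2 - 4 * (sin w)\<^sup>2 \<le> 1 * (4 * ?P)" using P zero_le_power2[of "sin w"] by linarith
    then have "b\<^sup>2 \<le> 1\<^sup>2" unfolding b2 using P by (subst pos_divide_le_eq) auto
    then have b: "0 \<le> b" "b \<le> 1"
    proof -
      show "0 \<le> b" using nn P by (simp add: b_def)
      show "b \<le> 1" by (rule power2_le_imp_le[OF \<open>b\<^sup>2 \<le> 1\<^sup>2\<close>]) simp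
    qed
    have ab: "0 \<le> arcsin b" "arcsin b \<le> pi / 2" using b arcsin_le_arcsin[of 0 b] arcsin_bounded[of b] by auto
    have iff: "torus_chord_sq (s + w) (s - w) m \<le> t\<^sup>2 \<longleftrightarrow> \<bar>m\<bar> \<le> 2 * arcsin b" if "m \<in> {-pi..pi}" for m
    proof -
      have "torus_chord_sq (s + w) (s - w) m \<le> t\<^sup>2 \<longleftrightarrow> (sin (m / 2))\<^sup>2 \<le> b\<^sup>2"
        unfolding ch b2 using P by (subst pos_le_divide_eq) (auto simp: algebra_simps)
      also have "\<dots> \<longleftrightarrow> \<bar>sin (m / 2)\<bar> \<le> b" using b by (simp add: power2_le_iff_abs_le)
      also have "\<dots> \<longleftrightarrow> \<bar>m / 2\<bar> \<le> arcsin b" using that b by (intro abs_sin_le_iff) auto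
      finally show ?thesis by auto
    qed
    have "circle_integral t (s + w) (s - w) = (\<integral>\<^sup>+m\<in>{-pi..pi}. pair_density t (s + w) (s - w) m \<partial>lborel)"
      unfolding circle_integral_def by (rule nn_integral_centered_lebesgue) measurable
    also have "\<dots> = (\<integral>\<^sup>+m. ennreal ?P * indicator {- (2 * arcsin b)..2 * arcsin b} m \<partial>lborel)"
    proof (rule nn_integral_cong)
      fix m :: real
      show "pair_density t (s + w) (s - w) m * indicator {-pi..pi} m
         = ennreal ?P * indicator {- (2 * arcsin b)..2 * arcsin b} m"
        using iff[of m] ab by (cases "m \<in> {-pi..pi}") (auto simp: pair_density_def radius_prod_at indicator_def abs_le_iff)
    qed
    also have "\<dots> = ennreal ?P * ennreal (4 * arcsin b)"
      using ab by (subst nn_integral_cmult_indicator) auto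
    also have "\<dots> = ennreal (4 * ?P * arcsin b)" using P ab by (simp add: mult_ac flip: ennreal_mult)
    finally show ?thesis using True by (simp add: b_def)
  qed
qed

text \<open>The interval of admissible \<open>w\<close> is the image of \<open>[-\<pi>/2, \<pi>/2]\<close> under \<open>\<theta> \<mapsto> arcsin (t sin \<theta> / 2)\<close>.\<close>

lemma circle_integral_substitution:
  assumes t: "0 \<le> t" "t < 1"
  shows "(\<integral>\<^sup>+w. circle_integral t (s + w) (s - w) \<partial>centered_lebesgue (pi / 2))
    = (\<integral>\<^sup>+\<theta>\<in>{-(pi/2)..pi/2}. ennreal (torus_density t s \<theta> / (4 * pi)) \<partial>lborel)"
proof -
  define F where "F w = 4 * radius_prod_at s w * arcsin (sqrt (t\<^sup>2 - 4 * (sin w)\<^sup>2) / (2 * sqrt (radius_prod_at s w)))" for w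
  define g where "g \<theta> = arcsin (t / 2 * sin \<theta>)" for \<theta>
  define g' where "g' \<theta> = t * cos \<theta> / 2 / sqrt (1 - gap_sin_sq t \<theta>)" for \<theta>
  have t1: "\<bar>t\<bar> < 1" using t by simp
  have gab: "g (- (pi / 2)) = - arcsin (t / 2)" "g (pi / 2) = arcsin (t / 2)"
    using t arcsin_minus[of "t / 2"] by (simp_all add: g_def)
  have ab: "0 \<le> arcsin (t / 2)" "arcsin (t / 2) \<le> pi / 2"
    using t arcsin_le_arcsin[of 0 "t / 2"] arcsin_bounded[of "t / 2"] by auto
  have small: "\<bar>t / 2 * sin \<theta>\<bar> < 1" for \<theta>
  proof -
    have "\<bar>t / 2 * sin \<theta>\<bar> \<le> \<bar>t / 2\<bar> * 1" unfolding abs_mult by (intro mult_left_mono) auto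
    then show ?thesis using t1 by simp
  qed
  have iff: "2 * \<bar>sin w\<bar> \<le> t \<longleftrightarrow> \<bar>w\<bar> \<le> arcsin (t / 2)" if "\<bar>w\<bar> \<le> pi / 2" for w
    using abs_sin_le_iff[OF that, of "t / 2"] t by auto
  have "(\<integral>\<^sup>+w. circle_integral t (s + w) (s - w) \<partial>centered_lebesgue (pi / 2))
     = (\<integral>\<^sup>+w. circle_integral t (s + w) (s - w) * indicator {-(pi/2)..pi/2} w \<partial>lborel)"
    by (rule nn_integral_centered_lebesgue) measurable
  also have "\<dots> = (\<integral>\<^sup>+w. ennreal (F w * indicator {g (- (pi / 2))..g (pi / 2)} w) \<partial>lborel)"
    unfolding gab circle_integral_sum_difference[OF t] F_def[symmetric]
  proof (rule nn_integral_cong)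
    fix w
    show "(if 2 * \<bar>sin w\<bar> \<le> t then ennreal (F w) else 0) * indicator {-(pi/2)..pi/2} w
       = ennreal (F w * indicator {- arcsin (t / 2)..arcsin (t / 2)} w)"
      using iff[of w] ab by (cases "\<bar>w\<bar> \<le> pi / 2") (auto simp: indicator_def abs_le_iff)
  qed
  also have "\<dots> = (\<integral>\<^sup>+\<theta>. ennreal (F (g \<theta>) * g' \<theta> * indicator {-(pi/2)..pi/2} \<theta>) \<partial>lborel)"
  proof (rule nn_integral_substitution)
    have "continuous_on {- arcsin (t / 2)..arcsin (t / 2)} F"
      unfolding F_def
    proof (intro continuous_intros)
      show "continuous_on {- arcsin (t / 2)..arcsin (t / 2)} (radius_prod_at s)"
        unfolding radius_prod_at_def by (intro continuous_intros)
      show "continuous_on {- arcsin (t / 2)..arcsin (t / 2)} (radius_prod_at s)"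
        unfolding radius_prod_at_def by (intro continuous_intros)
      show "\<forall>w\<in>{- arcsin (t / 2)..arcsin (t / 2)}. 2 * sqrt (radius_prod_at s w) \<noteq> 0"
      proof
        fix w
        have "1 \<le> radius_prod_at s w" by (rule radius_prod_at_ge)
        then show "2 * sqrt (radius_prod_at s w) \<noteq> 0" by auto
      qed
      show "\<forall>w\<in>{- arcsin (t / 2)..arcsin (t / 2)}. - 1 \<le> sqrt (t\<^sup>2 - 4 * (sin w)\<^sup>2) / (2 * sqrt (radius_prod_at s w))
        \<and> sqrt (t\<^sup>2 - 4 * (sin w)\<^sup>2) / (2 * sqrt (radius_prod_at s w)) \<le> 1"
      proof
        fix w assume w: "w \<in> {- arcsin (t / 2)..arcsin (t / 2)}"
        then have "2 * \<bar>sin w\<bar> \<le> t" using ab by (subst iff) auto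
        then have "(2 * \<bar>sin w\<bar>)\<^sup>2 \<le> t\<^sup>2" by (intro power_mono) auto
        then have nn: "0 \<le> t\<^sup>2 - 4 * (sin w)\<^sup>2" by (simp add: power_mult_distrib)
        have "t\<^sup>2 \<le> 1" using t by (simp add: abs_square_le_1)
        then have "t\<^sup>2 - 4 * (sin w)\<^sup>2 \<le> 1" using zero_le_power2[of "sin w"] by linarith
        then have "sqrt (t\<^sup>2 - 4 * (sin w)\<^sup>2) \<le> 1" by simp
        moreover have q: "1 \<le> sqrt (radius_prod_at s w)" using radius_prod_at_ge[of s w] by simp
        ultimately have "sqrt (t\<^sup>2 - 4 * (sin w)\<^sup>2) / (2 * sqrt (radius_prod_at s w)) \<le> 1"
          by (subst pos_divide_le_eq) linarith+
        moreover have "0 \<le> sqrt (t\<^sup>2 - 4 * (sin w)\<^sup>2) / (2 * sqrt (radius_prod_at s w))"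
          using nn q by (intro divide_nonneg_nonneg) auto
        ultimately show "- 1 \<le> sqrt (t\<^sup>2 - 4 * (sin w)\<^sup>2) / (2 * sqrt (radius_prod_at s w))
          \<and> sqrt (t\<^sup>2 - 4 * (sin w)\<^sup>2) / (2 * sqrt (radius_prod_at s w)) \<le> 1" by linarith
      qed
    qed
    then show "set_borel_measurable borel {g (- (pi / 2))..g (pi / 2)} F"
      unfolding gab set_borel_measurable_def by (intro borel_measurable_continuous_on_indicator) auto
    fix \<theta> :: real assume \<theta>: "\<theta> \<in> {-(pi/2)..pi/2}"
    have "(arcsin has_real_derivative inverse (sqrt (1 - (t / 2 * sin \<theta>)\<^sup>2))) (at (t / 2 * sin \<theta>))"
      using small[of \<theta>] by (intro DERIV_arcsin) linarith+
    moreover have "((\<lambda>\<theta>. t / 2 * sin \<theta>) has_real_derivative t / 2 * cos \<theta>) (at \<theta>)"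
      by (intro DERIV_cmult DERIV_sin)
    ultimately have "(g has_real_derivative inverse (sqrt (1 - (t / 2 * sin \<theta>)\<^sup>2)) * (t / 2 * cos \<theta>)) (at \<theta>)"
      unfolding g_def by (rule DERIV_chain2)
    moreover have "inverse (sqrt (1 - (t / 2 * sin \<theta>)\<^sup>2)) * (t / 2 * cos \<theta>) = g' \<theta>"
      by (simp add: g'_def gap_sin_sq_def inverse_eq_divide)
    ultimately show "(g has_real_derivative g' \<theta>) (at \<theta>)" by (simp only:)
    show "0 \<le> g' \<theta>"
      using t \<theta> gap_sin_sq_less(1)[OF t1, of \<theta>] unfolding g'_def
      by (intro divide_nonneg_nonneg mult_nonneg_nonneg cos_ge_zero) auto
  next
    have "sqrt (1 - gap_sin_sq t \<theta>) \<noteq> 0" for \<theta> using gap_sin_sq_less(2)[OF t1, of \<theta>] by linarith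
    moreover have "continuous_on {-(pi/2)..pi/2} (gap_sin_sq t)" unfolding gap_sin_sq_def by (intro continuous_intros) auto
    ultimately show "continuous_on {-(pi/2)..pi/2} g'"
      unfolding g'_def by (intro continuous_intros) auto
  qed simp
  also have "\<dots> = (\<integral>\<^sup>+\<theta>\<in>{-(pi/2)..pi/2}. ennreal (torus_density t s \<theta> / (4 * pi)) \<partial>lborel)"
  proof (rule nn_integral_cong)
    fix \<theta> :: real
    have eq: "F (g \<theta>) * g' \<theta> = torus_density t s \<theta> / (4 * pi)" if "\<theta> \<in> {-(pi/2)..pi/2}"
    proof -
      have sg: "sin (g \<theta>) = t / 2 * sin \<theta>" and cg: "cos (g \<theta>) = sqrt (1 - (t / 2 * sin \<theta>)\<^sup>2)"
        using small[of \<theta>] by (auto simp: g_def cos_arcsin abs_less_iff)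
      have P: "radius_prod_at s (g \<theta>) = radius_prod t s \<theta>"
        unfolding radius_prod_at_def radius_prod_def gap_sin_sq_def sg cg by simp
      have "t\<^sup>2 - 4 * (sin (g \<theta>))\<^sup>2 = (t * cos \<theta>)\<^sup>2"
        unfolding sg power_mult_distrib cos_squared_eq by (simp add: power_divide algebra_simps)
      moreover have "t * cos \<theta> \<ge> 0" using t that by (intro mult_nonneg_nonneg cos_ge_zero) auto
      ultimately have r: "sqrt (t\<^sup>2 - 4 * (sin (g \<theta>))\<^sup>2) = t * cos \<theta>" by simp
      show ?thesis unfolding F_def g'_def torus_density_def P r by simp
    qed
    show "ennreal (F (g \<theta>) * g' \<theta> * indicator {-(pi/2)..pi/2} \<theta>)
        = ennreal (torus_density t s \<theta> / (4 * pi)) * indicator {-(pi/2)..pi/2} \<theta>"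
      using eq by (cases "\<theta> \<in> {-(pi/2)..pi/2}") auto
  qed
  finally show ?thesis .
qed

lemma torus_density_nonneg:
  assumes t: "0 \<le> t" "t < 1" and c: "cos \<theta> \<ge> 0"
  shows "torus_density t s \<theta> \<ge> 0"
proof -
  have "0 \<le> 4 * pi * (cos \<theta>)\<^sup>2 * (2 + cos s) * t\<^sup>2 + pi * (cos \<theta>)\<^sup>2 * (sin \<theta>)\<^sup>2 / 4 * t ^ 4"
  proof -
    have "0 \<le> 2 + cos s" using cos_ge_minus_one[of s] by linarith
    then have "0 \<le> 4 * pi * (cos \<theta>)\<^sup>2 * (2 + cos s) * t\<^sup>2" by (intro mult_nonneg_nonneg) auto
    then show ?thesis by (intro add_nonneg_nonneg) auto
  qed
  also have "\<dots> \<le> torus_density t s \<theta>" by (rule torus_density_lower[OF t c])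
  finally show ?thesis .
qed

lemma \<psi>_torus:
  assumes t: "0 \<le> t" "t < 1"
  shows "\<psi> T2 t = integral torus_box (\<lambda>(s, \<theta>). torus_density t s \<theta>)"
proof -
  let ?h = "\<lambda>q. torus_density t (fst q) (snd q)"
  have t1: "\<bar>t\<bar> < 1" using t by simp
  have h: "(\<lambda>(s, \<theta>). torus_density t s \<theta>) = ?h" by (simp add: case_prod_unfold)
  have cont: "continuous_on S ?h" for S using continuous_torus_density[OF t1, of S] unfolding h .
  have hm [measurable]: "?h \<in> borel_measurable borel" using cont by (rule borel_measurable_continuous_onI)
  have hm2 [measurable]: "?h \<in> borel_measurable (borel \<Otimes>\<^sub>M borel)" using hm by (simp add: borel_prod)
  have hs [measurable]: "(\<lambda>\<theta>. torus_density t s \<theta>) \<in> borel_measurable borel" for s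
    using measurable_compose[OF _ hm2, of "\<lambda>\<theta>. (s, \<theta>)" borel] by simp
  have nn: "?h q \<ge> 0" if "q \<in> torus_box" for q
  proof -
    obtain s \<theta> where q: "q = (s, \<theta>)" by (cases q)
    have "cos \<theta> \<ge> 0" using \<open>q \<in> torus_box\<close> by (intro cos_ge_zero) (auto simp: q mem_torus_box)
    then show ?thesis using torus_density_nonneg[OF t] by (simp add: q)
  qed
  have int: "?h absolutely_integrable_on torus_box"
    unfolding torus_box_def by (rule absolutely_integrable_continuous[OF cont])
  have "emeasure (rev_area 2 \<Otimes>\<^sub>M rev_area 2) {(x, y). x \<in> T2 \<and> y \<in> T2 \<and> dist x y \<le> t}
    = ennreal (4 * pi) * (\<integral>\<^sup>+s. (\<integral>\<^sup>+\<theta>\<in>{-(pi/2)..pi/2}. ennreal (torus_density t s \<theta> / (4 * pi)) \<partial>lborel) \<partial>centered_lebesgue pi)"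
    unfolding emeasure_close_pairs_torus[OF t(1)] circle_integral_substitution[OF t] ..
  also have "\<dots> = (\<integral>\<^sup>+s. ennreal (4 * pi) * (\<integral>\<^sup>+\<theta>\<in>{-(pi/2)..pi/2}. ennreal (torus_density t s \<theta> / (4 * pi)) \<partial>lborel) \<partial>centered_lebesgue pi)"
    by (rule nn_integral_cmult[symmetric]) (use hm2 in measurable)
  also have "\<dots> = (\<integral>\<^sup>+s. (\<integral>\<^sup>+\<theta>\<in>{-(pi/2)..pi/2}. ennreal (torus_density t s \<theta>) \<partial>lborel) \<partial>centered_lebesgue pi)"
  proof (rule nn_integral_cong)
    fix s
    have "ennreal (4 * pi) * (\<integral>\<^sup>+\<theta>\<in>{-(pi/2)..pi/2}. ennreal (torus_density t s \<theta> / (4 * pi)) \<partial>lborel)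
      = (\<integral>\<^sup>+\<theta>. ennreal (4 * pi) * (ennreal (torus_density t s \<theta> / (4 * pi)) * indicator {-(pi/2)..pi/2} \<theta>) \<partial>lborel)"
      by (rule nn_integral_cmult[symmetric]) measurable
    also have "\<dots> = (\<integral>\<^sup>+\<theta>\<in>{-(pi/2)..pi/2}. ennreal (torus_density t s \<theta>) \<partial>lborel)"
      by (intro nn_integral_cong) (auto simp: indicator_def ennreal_mult'[symmetric])
    finally show "ennreal (4 * pi) * (\<integral>\<^sup>+\<theta>\<in>{-(pi/2)..pi/2}. ennreal (torus_density t s \<theta> / (4 * pi)) \<partial>lborel)
      = (\<integral>\<^sup>+\<theta>\<in>{-(pi/2)..pi/2}. ennreal (torus_density t s \<theta>) \<partial>lborel)" .
  qed
  also have "\<dots> = (\<integral>\<^sup>+s\<in>{-pi..pi}. (\<integral>\<^sup>+\<theta>\<in>{-(pi/2)..pi/2}. ennreal (torus_density t s \<theta>) \<partial>lborel) \<partial>lborel)"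
    by (rule nn_integral_centered_lebesgue) (use hm2 in measurable)
  also have "\<dots> = (\<integral>\<^sup>+s. \<integral>\<^sup>+\<theta>. ennreal (?h (s, \<theta>)) * indicator torus_box (s, \<theta>) \<partial>lborel \<partial>lborel)"
    by (intro nn_integral_cong) (auto simp: indicator_def mem_torus_box)
  also have "\<dots> = (\<integral>\<^sup>+q. ennreal (?h q) * indicator torus_box q \<partial>(lborel \<Otimes>\<^sub>M lborel))"
    by (rule lborel.nn_integral_fst) (simp add: torus_box_def lborel_prod)
  also have "\<dots> = (\<integral>\<^sup>+q\<in>torus_box. ennreal (?h q) \<partial>lborel)" by (simp add: lborel_prod)
  also have "\<dots> = ennreal (integral torus_box ?h)"
    by (rule nn_integral_absolutely_integrable[OF int nn])
  finally have em: "emeasure (rev_area 2 \<Otimes>\<^sub>M rev_area 2) {(x, y). x \<in> T2 \<and> y \<in> T2 \<and> dist x y \<le> t}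
    = ennreal (integral torus_box ?h)" .
  have "integral torus_box ?h \<ge> 0"
    using nn int by (intro integral_nonneg) (auto simp: absolutely_integrable_on_def)
  then show ?thesis unfolding \<psi>_def torus.area_measure measure_def em h by simp
qed

section \<open>The critical exponent\<close>

text \<open>The remainder of \<open>\<psi>'\<close> after its cubic Taylor polynomial is of order \<open>t\<^sup>4\<close>, so that its product with
\<open>t\<^sup>-\<^sup>4\<close> is bounded and the finite part exists.\<close>

lemma torus_energy_limit:
  obtains D :: "nat \<Rightarrow> real \<Rightarrow> real" and E where
    "\<forall>t\<in>{0..1/2}. D 0 t = \<psi> T2 t"
    "\<forall>j<4. \<forall>t\<in>{0..1/2}. (D j has_real_derivative D (Suc j) t) (at t within {0..1/2})" "D 4 0 > 0"
    "((\<lambda>\<epsilon>. truncated_energy T2 (-4) \<epsilon> +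
        (\<Sum>j=1..4. complex_of_real (D j 0 / fact (j - 1)) * counterterm (-4 + of_nat j) \<epsilon>)) \<longlongrightarrow> E) (at_right 0)"
proof -
  obtain D :: "nat \<Rightarrow> real \<Rightarrow> real" where
    D0: "D 0 = (\<lambda>t. integral torus_box (\<lambda>(s, \<theta>). torus_density t s \<theta>))" and
    D: "\<And>j t. \<bar>t\<bar> < 1 \<Longrightarrow> (D j has_real_derivative D (Suc j) t) (at t)" and D4: "D 4 0 > 0"
    by (rule torus_distribution) blast
  have \<psi>: "D 0 t = \<psi> T2 t" if "0 \<le> t" "t < 1" for t using \<psi>_torus[OF that] by (simp add: D0)
  have Dw: "(D j has_real_derivative D (Suc j) t) (at t within {0..1/2})" if "t \<in> {0..1/2}" for j t
    by (rule has_field_derivative_at_within, rule D) (use that in auto)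
  define h where "h t = D 1 t - (\<Sum>j=1..4. D j 0 / fact (j - 1) * t ^ (j - 1))" for t
  obtain B where B: "\<And>t. t \<in> {0..1/2} \<Longrightarrow> \<bar>D 1 t - (\<Sum>m<4. D (1 + m) 0 / fact m * t ^ m)\<bar> \<le> B * t ^ 4" "B > 0"
    using taylor_bound[where D = D, OF D, of 4 1] by auto
  have hB: "\<bar>h t\<bar> \<le> B * t ^ 4" if "t \<in> {0..1/2}" for t
    using B(1)[OF that] by (simp add: h_def sum.atLeast1_atMost_eq)
  have contD: "continuous_on {0..1/2} (D 1)"
    by (intro continuous_at_imp_continuous_on ballI DERIV_isCont[OF D]) auto
  have conth: "continuous_on {0..1/2} h" unfolding h_def by (intro continuous_intros contD)
  let ?f = "\<lambda>t. complex_of_real t powr (-4) * of_real (h t)"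
  have "?f integrable_on {0..1/2}"
  proof (rule measurable_bounded_by_integrable_imp_integrable)
    have "(\<lambda>t. complex_of_real t powr (-4)) \<in> borel_measurable lebesgue"
      using torus.powr_measurable[of "-4"] by (intro measurable_completion) simp
    then have "(\<lambda>t. complex_of_real t powr (-4)) \<in> borel_measurable (lebesgue_on {0..1/2})"
      by (rule measurable_restrict_space1)
    moreover have "h \<in> borel_measurable (lebesgue_on {0..1/2})"
      using conth by (rule continuous_imp_measurable_on_sets_lebesgue) simp
    then have "(\<lambda>t. complex_of_real (h t)) \<in> borel_measurable (lebesgue_on {0..1/2})" by measurable
    ultimately show "?f \<in> borel_measurable (lebesgue_on {0..1/2})" by (rule borel_measurable_times)
    show "(\<lambda>_. B) integrable_on {0..1/2::real}" by (rule integrable_const_ivl)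
    fix t :: real assume t: "t \<in> {0..1/2}"
    show "norm (?f t) \<le> B"
    proof (cases "t = 0")
      case True
      then show ?thesis using B(2) by simp
    next
      case False
      then have t0: "t > 0" using t by simp
      have "norm (?f t) = t powr (-4) * \<bar>h t\<bar>" using t0 by (simp add: norm_mult norm_powr_real_powr)
      also have "\<dots> \<le> t powr (-4) * (B * t ^ 4)" by (intro mult_left_mono hB t) simp
      also have "\<dots> = B" using t0 by (simp add: powr_minus powr_numeral)
      finally show ?thesis .
    qed
  qed simp
  then have "continuous_on {0..1/2} (\<lambda>\<epsilon>. integral {\<epsilon>..1/2} ?f)" by (rule indefinite_integral_continuous_1')
  then have L: "((\<lambda>\<epsilon>. integral {\<epsilon>..1/2} ?f) \<longlongrightarrow> integral {0..1/2} ?f) (at_right 0)"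
    by (rule continuous_on_Icc_at_rightD) simp
  have mono: "mono_on {0<..<1} (D 0)"
  proof (rule mono_onI)
    interpret d: finite_measure torus.dist_measure by (rule torus.finite_dist_measure)
    fix x y :: real assume "x \<in> {0<..<1}" "y \<in> {0<..<1}" "x \<le> y"
    then show "D 0 x \<le> D 0 y"
      by (simp add: \<psi> torus.\<psi>_dist_measure) (rule d.finite_measure_mono, auto)
  qed
  have nonneg: "D 1 t \<ge> 0" if "t \<in> {0<..1/2}" for t
    using that D[of t 0] by (intro mono_on_imp_deriv_nonneg[OF mono]) (auto simp: interior_open)
  show thesis
  proof (rule that)
    show "\<forall>t\<in>{0..1/2}. D 0 t = \<psi> T2 t" using \<psi> by auto
    show "\<forall>j<4. \<forall>t\<in>{0..1/2}. (D j has_real_derivative D (Suc j) t) (at t within {0..1/2})" using Dw by blast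
    show "((\<lambda>\<epsilon>. truncated_energy T2 (-4) \<epsilon> +
        (\<Sum>j=1..4. complex_of_real (D j 0 / fact (j - 1)) * counterterm (-4 + of_nat j) \<epsilon>)) \<longlongrightarrow>
        truncated_energy T2 (-4) (1/2) + (\<Sum>j=1..4. complex_of_real (D j 0 / fact (j - 1)) * counterterm (-4 + of_nat j) (1/2))
        + integral {0..1/2} ?f) (at_right 0)"
      by (rule torus.regularized_energy_tendsto[where h = h])
        (use \<psi> Dw contD nonneg L in \<open>auto simp: h_def\<close>)
  qed (rule D4)
qed

section \<open>Scalings are Moebius transformations\<close>

text \<open>A dilation is the product of two inversions in concentric spheres.\<close>

lemma moebius_scaling:
  assumes c: "c > 0"
  obtains I where "moebius_transformation I" "\<And>x. I (Some x) = Some (c *\<^sub>R x)"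
proof
  let ?I = "sphere_inversion 0 (sqrt c) \<circ> (sphere_inversion 0 1 \<circ> id)"
  show "moebius_transformation ?I"
    using c by (intro moebius_inversion moebius_id) auto
  show "?I (Some x) = Some (c *\<^sub>R x)" for x
    using c by (cases "x = 0") (simp_all add: sphere_inversion_def power2_eq_square)
qed

lemma not_invariant_if_scaling_changes_energy:
  assumes "measured_surface M \<mu>" "c > 0" "has_regularized_energy M z E"
    "has_regularized_energy ((\<lambda>x. c *\<^sub>R x) ` M) z E'" "E' \<noteq> E"
  shows "\<exists>M I M' E E'.
           closed_surface M \<and> moebius_transformation I \<and>
           I ` (Some ` M) = Some ` M' \<and> compact M' \<and>
           has_regularized_energy M z E \<and> has_regularized_energy M' z E' \<and>
           E' \<noteq> E"
proof -
  interpret measured_surface M \<mu> by fact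
  interpret s: measured_surface "(\<lambda>x. c *\<^sub>R x) ` M" "scaled_measure c"
    by (rule measured_surface_scaled[OF assms(2)])
  obtain I where "moebius_transformation I" "\<And>x. I (Some x) = Some (c *\<^sub>R x)"
    using moebius_scaling[OF assms(2)] by blast
  moreover from this have "I ` (Some ` M) = Some ` (\<lambda>x. c *\<^sub>R x) ` M" by (simp add: image_image)
  ultimately show ?thesis using closed_surface s.compact assms(3-5) by blast
qed

theorem mainTheorem5:
  fixes z :: complex
  shows "\<exists>M I M' E E'.
           closed_surface M \<and> moebius_transformation I \<and>
           I ` (Some ` M) = Some ` M' \<and> compact M' \<and>
           has_regularized_energy M z E \<and> has_regularized_energy M' z E' \<and>
           E' \<noteq> E"
proof (cases "z = -4")
  case True
  obtain D :: "nat \<Rightarrow> real \<Rightarrow> real" and E where D: "\<forall>t\<in>{0..1/2}. D 0 t = \<psi> T2 t"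
    "\<forall>j<4. \<forall>t\<in>{0..1/2}. (D j has_real_derivative D (Suc j) t) (at t within {0..1/2})" "D 4 0 > 0"
    and E: "((\<lambda>\<epsilon>. truncated_energy T2 (-4) \<epsilon> +
        (\<Sum>j=1..4. complex_of_real (D j 0 / fact (j - 1)) * counterterm (-4 + of_nat j) \<epsilon>)) \<longlongrightarrow> E) (at_right 0)"
    by (rule torus_energy_limit)
  have k: "Re (-4) > - real 4 - 1" and d: "(1/2 :: real) > 0" by simp_all
  have 1: "has_regularized_energy T2 z E"
    unfolding has_regularized_energy_def True using k d D(1,2) E by blast
  let ?E' = "complex_of_real 2 powr (4 + -4) * (E + (\<Sum>j=1..4. complex_of_real (D j 0 / fact (j - 1)) *
        (if -4 + of_nat j = (0::complex) then of_real (ln 2) else 0)))"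
  have 2: "has_regularized_energy ((\<lambda>x. 2 *\<^sub>R x) ` T2) z ?E'"
    unfolding True by (rule torus.has_regularized_energy_scaled[OF _ k d D(1,2) E]) simp
  have eq: "?E' = E + of_real (D 4 0 / 6 * ln 2)"
    by (simp add: eval_nat_numeral)
  have ne: "?E' \<noteq> E" unfolding eq using D(3) by simp
  show ?thesis
    by (rule not_invariant_if_scaling_changes_energy[OF torus.measured_surface_axioms zero_less_numeral 1 2 ne])
next
  case False
  obtain n :: nat where n: "- Re z - 1 < real n" using reals_Archimedean2 by blast
  define k where "k = max 2 n"
  have k: "Re z > - real k - 1" "k \<ge> 2" using n by (auto simp: k_def)
  have D: "\<forall>t\<in>{0..2}. sphere_D 0 t = \<psi> S2 t"
    "\<forall>j<k. \<forall>t\<in>{0..2}. (sphere_D j has_real_derivative sphere_D (Suc j) t) (at t within {0..2})"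
    using sphere_D by (auto simp: sphere_D_def[of 0] \<psi>_sphere)
  define E where "E = 8 * complex_of_real pi ^ 2 * counterterm (z + 2) 2"
  note lim = sphere_energy_limit[OF k(2), of z, folded E_def]
  have 1: "has_regularized_energy S2 z E"
    unfolding has_regularized_energy_def using k(1) D lim zero_less_numeral by blast
  have 2: "has_regularized_energy ((\<lambda>x. c *\<^sub>R x) ` S2) z (complex_of_real c powr (4 + z) *
      (E + 8 * complex_of_real pi ^ 2 * (if z + 2 = 0 then of_real (ln c) else 0)))" if "c > 0" for c
  proof -
    have "(\<Sum>j=1..k. complex_of_real (sphere_D j 0 / fact (j - 1)) * (if z + of_nat j = 0 then of_real (ln c) else 0))
      = (\<Sum>j\<in>{2}. complex_of_real (sphere_D j 0 / fact (j - 1)) * (if z + of_nat j = 0 then of_real (ln c) else 0))"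
      using k by (intro sum.mono_neutral_right) (auto simp: sphere_D_def)
    then show ?thesis
      using sphere.has_regularized_energy_scaled[OF that k(1) zero_less_numeral D lim]
      by (simp add: sphere_D_def)
  qed
  show ?thesis
  proof (cases "z + 2 = 0")
    case True
    then have z: "z = -2" by (simp add: eq_neg_iff_add_eq_0)
    have E: "E = of_real (8 * pi ^ 2 * ln 2)" using True by (simp add: E_def counterterm_def)
    have "complex_of_real 2 powr (4 + z) = 4" using powr_nat'[of "2::complex" 2] by (simp add: z)
    then have eq: "complex_of_real 2 powr (4 + z) * (E + 8 * complex_of_real pi ^ 2 * (if z + 2 = 0 then of_real (ln 2) else 0))
      = of_real (64 * pi ^ 2 * ln 2)" using True by (simp add: E)
    have ne: "complex_of_real 2 powr (4 + z) * (E + 8 * complex_of_real pi ^ 2 * (if z + 2 = 0 then of_real (ln 2) else 0)) \<noteq> E"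
      unfolding eq unfolding E of_real_eq_iff by simp
    show ?thesis
      by (rule not_invariant_if_scaling_changes_energy[OF sphere.measured_surface_axioms zero_less_numeral 1 2[OF zero_less_numeral] ne])
  next
    case z2: False
    \<comment> \<open>For this dilation \<open>c\<^sup>4\<^sup>+\<^sup>z\<close> is the exponential of a number of modulus \<open>1\<close>, and the nonzero periods of
      \<open>exp\<close> are larger.\<close>
    define c where "c = exp (1 / norm (4 + z))"
    have z4: "4 + z \<noteq> 0" using False by (metis add.commute add_eq_0_iff)
    have "complex_of_real c powr (4 + z) = exp ((4 + z) / of_real (norm (4 + z)))"
      by (simp add: c_def powr_def flip: exp_of_real)
    also have "\<dots> \<noteq> 1"
    proof
      define w where "w = (4 + z) / of_real (norm (4 + z))"
      assume "exp ((4 + z) / of_real (norm (4 + z))) = 1"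
      then have "exp w = 1" by (simp only: w_def)
      then obtain n where n: "Re w = 0" "Im w = of_int (2 * n) * pi" unfolding exp_eq_1 by blast
      have "norm w = 1" using z4 by (simp add: w_def norm_divide)
      then have "\<bar>Im w\<bar> = 1" using n(1) by (simp add: cmod_def)
      then have one: "\<bar>real_of_int (2 * n)\<bar> * pi = 1" unfolding n(2) abs_mult by simp
      show False
      proof (cases "n = 0")
        case True
        then show False using one by simp
      next
        case False
        then have "1 \<le> \<bar>real_of_int (2 * n)\<bar>" by linarith
        then have "1 * pi \<le> \<bar>real_of_int (2 * n)\<bar> * pi" by (intro mult_right_mono) auto
        then show False using one pi_gt3 by linarith
      qed
    qed
    finally have "complex_of_real c powr (4 + z) \<noteq> 1" .
    moreover have "E \<noteq> 0" using z2 by (simp add: E_def counterterm_def)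
    ultimately have "complex_of_real c powr (4 + z) * (E + 8 * complex_of_real pi ^ 2 * (if z + 2 = 0 then of_real (ln c) else 0)) \<noteq> E"
      using z2 by simp
    moreover have "c > 0" by (simp add: c_def)
    ultimately show ?thesis
      using not_invariant_if_scaling_changes_energy[OF sphere.measured_surface_axioms _ 1 2] by blast
  qed
qed

end
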